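(* Let $q\in\mathbb{K}$. For any $n\ge1$ the module $(q\text{-}\mathrm{permAs})_{n+1}$ is one-dimensional (free of rank one over $\mathbb{K}$), spanned by $\Gamma(1_n;\mu,\dots,\mu)$. For any permutation $\sigma\in\mathbb{S}_n$, considered as a surjective map from $\underline{n}$ to $\underline{n}$, one has $$\Gamma(\sigma;\mu,\dots,\mu)=q^{\ell(\sigma)}\,\Gamma(1_n;\mu,\dots,\mu),$$ where $\ell(\sigma)$ is the length of $\sigma$ in the Coxeter group $\mathbb{S}_n$.
   Context: $\mathbb{K}$ is a commutative ring; $\underline{n}=\{1,\dots,n\}$; $1_n$ is the identity of $\mathbb{S}_n$; $\ell$ is the length with respect to the generators $s_i=(i\ i{+}1)$. $\mathrm{Sur}(\underline{n},\underline{k})$ is the set of surjections $\underline{n}\to\underline{k}$; the unique element of $\mathrm{Sur}(\underline{n},\underline{1})$ is the corolla $c_{n+1}$. Substitution: for $t\in\mathrm{Sur}(\underline{n},\underline{k})$ and $t_j\in\mathrm{Sur}(\underline{i_j},\underline{m_j})$ with $i_j=\#t^{-1}(j)$, $(t;t_1,\dots,t_k):\underline{n}\to\underline{m_1+\cdots+m_k}$ is the surjection with $(t;t_1,\dots,t_k)(a)=m_1+\cdots+m_{j-1}+t_j(b)$ whenever $t(a)=j$ and $a$ is the $b$-th element of $t^{-1}(j)$ in increasing order. A permutad is an arity-graded module $\mathcal{P}=\{\mathcal{P}_n\}_{n\ge1}$ of $\mathbb{K}$-modules with $\mathcal{P}_1=\mathbb{K}\,\mathrm{id}$ together with, for each surjection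 $t:\underline{n}\to\underline{k}$ ($1\le k\le n$), a linear map $\Gamma(t;-,\dots,-):\bigotimes_{j=1}^k\mathcal{P}_{\#t^{-1}(j)+1}\to\mathcal{P}_{n+1}$, such that $\Gamma(c_{n+1};\mu)=\mu$ and $$\Gamma\big((t;t_1,\dots,t_k);\lambda^1_1,\dots,\lambda^1_{m_1},\dots,\lambda^k_{m_k}\big)=\Gamma\big(t;\Gamma(t_1;\lambda^1_1,\dots,\lambda^1_{m_1}),\dots,\Gamma(t_k;\lambda^k_1,\dots,\lambda^k_{m_k})\big).$$ The free permutad $\mathbb{P}(M)$ on an arity-graded module $M$ with $M_1=0$ is $\mathbb{P}(M)_1=\mathbb{K}\,\mathrm{id}$, $\mathbb{P}(M)_{n+1}=\bigoplus_{k}\bigoplus_{t\in\mathrm{Sur}(\underline{n},\underline{k})}\bigotimes_{j=1}^kM_{\#t^{-1}(j)+1}$ for $n\ge 1$, with $\Gamma$ induced by substitution. An ideal of a permutad is an arity-graded submodule $\mathcal{I}$ such that any permutadic composition $\Gamma(t;\lambda_1,\dots,\lambda_k)$ with at least one $\lambda_j\in\mathcal{I}$ lies in $\mathcal{I}$; the quotient by an ideal is a permutad. The parametrized associative permutad $q\text{-}\mathrm{permAs}$ is the permutad generated by one element $\mu$ of arity $2$ with the relation $\Gamma((12);\mu,\mu)=q\,\Gamma(1_2;\mu,\mu)$, where $(12)\in\mathbb{S}_2$ is the transposition; i.e. it is the quotient of the free permutad on $M$, with $M_2=\mathbb{K}\mu$ and $M_n=0$ for $n\neq2$, by the ideal generated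 by $\Gamma((12);\mu,\mu)-q\,\Gamma(1_2;\mu,\mu)$. *)

theory Defs
  imports
    "HOL-Combinatorics.Permutations"
    "HOL-Algebra.QuotRing"
    "HOL-Algebra.Module"
begin

section \<open>Modules over a commutative ring\<close>

text \<open>The fields \<^const>\<open>mult\<close> and \<^const>\<open>one\<close> of a module record carry no meaning here.\<close>

definition regular_module :: "('k, 'z) ring_scheme \<Rightarrow> ('k, 'k) module" where
  "regular_module K =
    \<lparr>carrier = carrier K, mult = mult K, one = one K, zero = zero K, add = add K,
     smult = mult K\<rparr>"

definition direct_sum :: "'i set \<Rightarrow> ('i \<Rightarrow> ('k, 'm) module) \<Rightarrow> ('k, 'i \<Rightarrow> 'm) module" where
  "direct_sum I M =
    \<lparr>carrier = {x \<in> \<Pi>\<^sub>E i\<in>I. carrier (M i). finite {i \<in> I. x i \<noteq> \<zero>\<^bsub>M i\<^esub>}},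
     mult = undefined, one = undefined,
     zero = (\<lambda>i\<in>I. \<zero>\<^bsub>M i\<^esub>),
     add = (\<lambda>x y. \<lambda>i\<in>I. x i \<oplus>\<^bsub>M i\<^esub> y i),
     smult = (\<lambda>a x. \<lambda>i\<in>I. a \<odot>\<^bsub>M i\<^esub> x i)\<rparr>"

definition sum_inj :: "'i set \<Rightarrow> ('i \<Rightarrow> ('k, 'm) module) \<Rightarrow> 'i \<Rightarrow> 'm \<Rightarrow> ('i \<Rightarrow> 'm)" where
  "sum_inj I M i v = (\<lambda>j\<in>I. if j = i then v else \<zero>\<^bsub>M j\<^esub>)"

definition free_module :: "('k, 'z) ring_scheme \<Rightarrow> 's set \<Rightarrow> ('k, 's \<Rightarrow> 'k) module" where
  "free_module K S = direct_sum S (\<lambda>_. regular_module K)"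

definition free_gen :: "('k, 'z) ring_scheme \<Rightarrow> 's set \<Rightarrow> 's \<Rightarrow> ('s \<Rightarrow> 'k)" where
  "free_gen K S s = sum_inj S (\<lambda>_. regular_module K) s \<one>\<^bsub>K\<^esub>"

definition module_basis :: "('k, 'z) ring_scheme \<Rightarrow> ('k, 'm) module \<Rightarrow> 'm set \<Rightarrow> bool" where
  "module_basis K M B \<longleftrightarrow> module K M \<and> B \<subseteq> carrier M \<and>
     bij_betw (\<lambda>f. \<Oplus>\<^bsub>M\<^esub>b\<in>{b \<in> B. f b \<noteq> \<zero>\<^bsub>K\<^esub>}. f b \<odot>\<^bsub>M\<^esub> b)
       (carrier (free_module K B)) (carrier M)"

definition submodule_span :: "('k, 'z) ring_scheme \<Rightarrow> ('k, 'm) module \<Rightarrow> 'm set \<Rightarrow> 'm set" where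
  "submodule_span K M S = \<Inter>{N. submodule N K M \<and> S \<subseteq> N}"

text \<open>As for \<^const>\<open>FactRing\<close>, the elements of a quotient are cosets, and an operation is applied
  to cosets by taking the union over all representatives.\<close>

definition quotient_module :: "('k, 'm) module \<Rightarrow> 'm set \<Rightarrow> ('k, 'm set) module" where
  "quotient_module M N =
    \<lparr>carrier = a_rcosets\<^bsub>M\<^esub> N, mult = undefined, one = undefined,
     zero = N, add = set_add M,
     smult = (\<lambda>a X. \<Union>x\<in>X. N +>\<^bsub>M\<^esub> (a \<odot>\<^bsub>M\<^esub> x))\<rparr>"


section \<open>Tensor products\<close>

text \<open>The tensor product of a family of modules is the free module on the product of the carriers
  modulo the relations of multilinearity. The empty tensor product is the free module on one
  generator.\<close>

definition tensor_pre ::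
  "('k, 'z) ring_scheme \<Rightarrow> 'i set \<Rightarrow> ('i \<Rightarrow> ('k, 'm) module) \<Rightarrow> ('k, ('i \<Rightarrow> 'm) \<Rightarrow> 'k) module" where
  "tensor_pre K I M = free_module K (\<Pi>\<^sub>E i\<in>I. carrier (M i))"

definition tensor_relations ::
  "('k, 'z) ring_scheme \<Rightarrow> 'i set \<Rightarrow> ('i \<Rightarrow> ('k, 'm) module) \<Rightarrow> (('i \<Rightarrow> 'm) \<Rightarrow> 'k) set" where
  "tensor_relations K I M =
    (let F = tensor_pre K I M; V = (\<Pi>\<^sub>E i\<in>I. carrier (M i)); \<delta> = free_gen K V
     in submodule_span K F
       ({\<delta> (v(i := x \<oplus>\<^bsub>M i\<^esub> y)) \<ominus>\<^bsub>F\<^esub> (\<delta> (v(i := x)) \<oplus>\<^bsub>F\<^esub> \<delta> (v(i := y))) | v i x y.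
           v \<in> V \<and> i \<in> I \<and> x \<in> carrier (M i) \<and> y \<in> carrier (M i)} \<union>
        {\<delta> (v(i := a \<odot>\<^bsub>M i\<^esub> x)) \<ominus>\<^bsub>F\<^esub> a \<odot>\<^bsub>F\<^esub> \<delta> (v(i := x)) | v i a x.
           v \<in> V \<and> i \<in> I \<and> a \<in> carrier K \<and> x \<in> carrier (M i)}))"

definition tensor ::
  "('k, 'z) ring_scheme \<Rightarrow> 'i set \<Rightarrow> ('i \<Rightarrow> ('k, 'm) module) \<Rightarrow> ('k, (('i \<Rightarrow> 'm) \<Rightarrow> 'k) set) module"
  where "tensor K I M = quotient_module (tensor_pre K I M) (tensor_relations K I M)"

definition pure_tensor ::
  "('k, 'z) ring_scheme \<Rightarrow> 'i set \<Rightarrow> ('i \<Rightarrow> ('k, 'm) module) \<Rightarrow> ('i \<Rightarrow> 'm) \<Rightarrow> (('i \<Rightarrow> 'm) \<Rightarrow> 'k) set"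
  where
  "pure_tensor K I M v =
     tensor_relations K I M +>\<^bsub>tensor_pre K I M\<^esub> free_gen K (\<Pi>\<^sub>E i\<in>I. carrier (M i)) v"

text \<open>\<open>offset m j = m\<^sub>1 + \<dots> + m\<^sub>j\<^sub>-\<^sub>1\<close>.\<close>

definition offset :: "(nat \<Rightarrow> nat) \<Rightarrow> nat \<Rightarrow> nat" where
  "offset m j = (\<Sum>l\<in>{1..<j}. m l)"

text \<open>The canonical map from the tensor product over \<open>j \<in> {1..k}\<close> of the tensor products of the
  \<open>N (offset m j + i)\<close>, \<open>i \<in> {1..m j}\<close>, to the tensor product of all \<open>N i\<close>, evaluated on
  the family \<open>X\<close>. A tensor is represented by a finitely supported function on tuples, so the
  concatenation of formal combinations \<open>f 1, \<dots>, f k\<close> has as coefficient at a long tuple the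
  product of the coefficients of \<open>f j\<close> at the \<open>j\<close>-th block of that tuple.\<close>

definition tensor_join ::
  "('k, 'z) ring_scheme \<Rightarrow> nat \<Rightarrow> (nat \<Rightarrow> nat) \<Rightarrow> (nat \<Rightarrow> ('k, 'm) module) \<Rightarrow>
     (nat \<Rightarrow> ((nat \<Rightarrow> 'm) \<Rightarrow> 'k) set) \<Rightarrow> ((nat \<Rightarrow> 'm) \<Rightarrow> 'k) set" where
  "tensor_join K k m N X =
    (let I = {1..\<Sum>j=1..k. m j} in
     \<Union>f\<in>(\<Pi>\<^sub>E j\<in>{1..k}. X j).
       tensor_relations K I N +>\<^bsub>tensor_pre K I N\<^esub>
         (\<lambda>v\<in>(\<Pi>\<^sub>E i\<in>I. carrier (N i)). \<Otimes>\<^bsub>K\<^esub>j\<in>{1..k}. f j (\<lambda>i\<in>{1..m j}. v (offset m j + i))))"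


section \<open>Surjections and substitution\<close>

definition Sur :: "nat \<Rightarrow> nat \<Rightarrow> (nat \<Rightarrow> nat) set" where
  "Sur n k = {t \<in> {1..n} \<rightarrow>\<^sub>E {1..k}. t ` {1..n} = {1..k}}"

definition fiber_card :: "nat \<Rightarrow> (nat \<Rightarrow> nat) \<Rightarrow> nat \<Rightarrow> nat" where
  "fiber_card n t j = card {a \<in> {1..n}. t a = j}"

definition corolla :: "nat \<Rightarrow> (nat \<Rightarrow> nat)" where
  "corolla n = (\<lambda>a\<in>{1..n}. 1)"

text \<open>\<open>surj_subst n t m ts\<close> is the substitution \<open>(t; ts 1, \<dots>, ts k)\<close> for \<open>t \<in> Sur n k\<close> and
  \<open>ts j \<in> Sur (fiber_card n t j) (m j)\<close>; the cardinality below is the position of \<open>a\<close> in its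
  fiber.\<close>

definition surj_subst ::
  "nat \<Rightarrow> (nat \<Rightarrow> nat) \<Rightarrow> (nat \<Rightarrow> nat) \<Rightarrow> (nat \<Rightarrow> nat \<Rightarrow> nat) \<Rightarrow> (nat \<Rightarrow> nat)" where
  "surj_subst n t m ts =
    (\<lambda>a\<in>{1..n}. offset m (t a) + ts (t a) (card {a' \<in> {1..n}. t a' = t a \<and> a' \<le> a}))"


section \<open>Permutads\<close>

text \<open>\<open>comp P n\<close> is the component of arity \<open>n \<ge> 1\<close>; the value at \<open>0\<close> is irrelevant.
  \<open>gam P n k t x\<close> is the composition of \<open>x 1, \<dots>, x k\<close> along \<open>t \<in> Sur n k\<close>.\<close>

record ('k, 'p) permutad_data =
  comp :: "nat \<Rightarrow> ('k, 'p) module"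
  ident :: 'p
  gam :: "nat \<Rightarrow> nat \<Rightarrow> (nat \<Rightarrow> nat) \<Rightarrow> (nat \<Rightarrow> 'p) \<Rightarrow> 'p"

abbreviation gam_dom :: "('k, 'p) permutad_data \<Rightarrow> nat \<Rightarrow> nat \<Rightarrow> (nat \<Rightarrow> nat) \<Rightarrow> (nat \<Rightarrow> 'p) set" where
  "gam_dom P n k t \<equiv> (\<Pi>\<^sub>E j\<in>{1..k}. carrier (comp P (fiber_card n t j + 1)))"

text \<open>Linearity of a composition on the tensor product is expressed as multilinearity. Ideals and
  quotients below only refer to the operations, so they are defined on the raw data.\<close>

locale permutad =
  fixes K :: "('k, 'z) ring_scheme" and P :: "('k, 'p) permutad_data"
  assumes comp_module: "1 \<le> n \<Longrightarrow> module K (comp P n)"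
    and comp_one: "module_basis K (comp P 1) {ident P}"
    and gam_closed:
      "\<lbrakk>1 \<le> n; t \<in> Sur n k; x \<in> gam_dom P n k t\<rbrakk> \<Longrightarrow> gam P n k t x \<in> carrier (comp P (n + 1))"
    and gam_add:
      "\<lbrakk>1 \<le> n; t \<in> Sur n k; x \<in> gam_dom P n k t; j \<in> {1..k}; d = fiber_card n t j + 1;
        y \<in> carrier (comp P d); z \<in> carrier (comp P d)\<rbrakk> \<Longrightarrow>
        gam P n k t (x(j := y \<oplus>\<^bsub>comp P d\<^esub> z)) =
        gam P n k t (x(j := y)) \<oplus>\<^bsub>comp P (n + 1)\<^esub> gam P n k t (x(j := z))"
    and gam_smult:
      "\<lbrakk>1 \<le> n; t \<in> Sur n k; x \<in> gam_dom P n k t; j \<in> {1..k}; d = fiber_card n t j + 1;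
        a \<in> carrier K; y \<in> carrier (comp P d)\<rbrakk> \<Longrightarrow>
        gam P n k t (x(j := a \<odot>\<^bsub>comp P d\<^esub> y)) =
        a \<odot>\<^bsub>comp P (n + 1)\<^esub> gam P n k t (x(j := y))"
    and gam_corolla:
      "\<lbrakk>1 \<le> n; y \<in> carrier (comp P (n + 1))\<rbrakk> \<Longrightarrow> gam P n 1 (corolla n) (\<lambda>j\<in>{1..1}. y) = y"
    and gam_subst:
      "\<lbrakk>1 \<le> n; t \<in> Sur n k; \<forall>j\<in>{1..k}. ts j \<in> Sur (fiber_card n t j) (m j);
        s = surj_subst n t m ts; l = (\<Sum>j=1..k. m j); x \<in> gam_dom P n l s\<rbrakk> \<Longrightarrow>
        gam P n l s x =
        gam P n k t
          (\<lambda>j\<in>{1..k}. gam P (fiber_card n t j) (m j) (ts j) (\<lambda>i\<in>{1..m j}. x (offset m j + i)))"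

definition permutad_ideal ::
  "('k, 'z) ring_scheme \<Rightarrow> ('k, 'p) permutad_data \<Rightarrow> (nat \<Rightarrow> 'p set) \<Rightarrow> bool" where
  "permutad_ideal K P I \<longleftrightarrow>
     (\<forall>n\<ge>1. submodule (I n) K (comp P n)) \<and>
     (\<forall>n\<ge>1. \<forall>k. \<forall>t\<in>Sur n k. \<forall>x\<in>gam_dom P n k t.
        (\<exists>j\<in>{1..k}. x j \<in> I (fiber_card n t j + 1)) \<longrightarrow> gam P n k t x \<in> I (n + 1))"

definition generated_ideal ::
  "('k, 'z) ring_scheme \<Rightarrow> ('k, 'p) permutad_data \<Rightarrow> (nat \<Rightarrow> 'p set) \<Rightarrow> (nat \<Rightarrow> 'p set)" where
  "generated_ideal K P R = (\<lambda>n. \<Inter>{I n | I. permutad_ideal K P I \<and> (\<forall>m\<ge>1. R m \<subseteq> I m)})"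

definition quotient_permutad ::
  "('k, 'p) permutad_data \<Rightarrow> (nat \<Rightarrow> 'p set) \<Rightarrow> ('k, 'p set) permutad_data" where
  "quotient_permutad P I =
    \<lparr>comp = (\<lambda>n. quotient_module (comp P n) (I n)),
     ident = I 1 +>\<^bsub>comp P 1\<^esub> ident P,
     gam = (\<lambda>n k t X. \<Union>x\<in>(\<Pi>\<^sub>E j\<in>{1..k}. X j). I (n + 1) +>\<^bsub>comp P (n + 1)\<^esub> gam P n k t x)\<rparr>"


section \<open>The free permutad\<close>

text \<open>For \<open>n = 0\<close> there is exactly one index, the empty surjection onto the empty set, and the
  corresponding summand below is an empty tensor product. Thus the formula for arity \<open>n + 1\<close>
  with \<open>n \<ge> 1\<close> also yields the component \<open>K id\<close> of arity \<open>1\<close>.\<close>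

definition surj_index :: "nat \<Rightarrow> (nat \<times> (nat \<Rightarrow> nat)) set" where
  "surj_index n = (SIGMA k:{..n}. Sur n k)"

definition decoration :: "(nat \<Rightarrow> ('k, 'm) module) \<Rightarrow> nat \<Rightarrow> (nat \<Rightarrow> nat) \<Rightarrow> nat \<Rightarrow> ('k, 'm) module"
  where "decoration M n t j = M (fiber_card n t j + 1)"

definition free_summand ::
  "('k, 'z) ring_scheme \<Rightarrow> (nat \<Rightarrow> ('k, 'm) module) \<Rightarrow> nat \<Rightarrow> nat \<times> (nat \<Rightarrow> nat) \<Rightarrow>
     ('k, ((nat \<Rightarrow> 'm) \<Rightarrow> 'k) set) module" where
  "free_summand K M n = (\<lambda>(k, t). tensor K {1..k} (decoration M n t))"

type_synonym ('k, 'm) free_permutad_elem =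
  "nat \<times> (nat \<Rightarrow> nat) \<Rightarrow> ((nat \<Rightarrow> 'm) \<Rightarrow> 'k) set"

definition free_comp ::
  "('k, 'z) ring_scheme \<Rightarrow> (nat \<Rightarrow> ('k, 'm) module) \<Rightarrow> nat \<Rightarrow>
     ('k, ('k, 'm) free_permutad_elem) module" where
  "free_comp K M n = direct_sum (surj_index (n - 1)) (free_summand K M (n - 1))"

text \<open>The multilinear extension of substitution: \<open>c\<close> selects for each \<open>j\<close> a summand
  \<open>(m j, ts j)\<close> of the arity of \<open>x j\<close>.\<close>

definition free_gam ::
  "('k, 'z) ring_scheme \<Rightarrow> (nat \<Rightarrow> ('k, 'm) module) \<Rightarrow> nat \<Rightarrow> nat \<Rightarrow> (nat \<Rightarrow> nat) \<Rightarrow>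
     (nat \<Rightarrow> ('k, 'm) free_permutad_elem) \<Rightarrow> ('k, 'm) free_permutad_elem" where
  "free_gam K M n k t x =
    (\<Oplus>\<^bsub>free_comp K M (n + 1)\<^esub>c\<in>(\<Pi>\<^sub>E j\<in>{1..k}. surj_index (fiber_card n t j)).
       let m = (\<lambda>j. fst (c j)); ts = (\<lambda>j. snd (c j)); s = surj_subst n t m ts
       in sum_inj (surj_index n) (free_summand K M n) (\<Sum>j=1..k. m j, s)
            (tensor_join K k m (decoration M n s) (\<lambda>j. x j (c j))))"

definition free_permutad ::
  "('k, 'z) ring_scheme \<Rightarrow> (nat \<Rightarrow> ('k, 'm) module) \<Rightarrow>
     ('k, ('k, 'm) free_permutad_elem) permutad_data" where
  "free_permutad K M =
    \<lparr>comp = free_comp K M,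
     ident = sum_inj (surj_index 0) (free_summand K M 0) (0, \<lambda>_. undefined)
       (pure_tensor K {} (decoration M 0 (\<lambda>_. undefined)) (\<lambda>_. undefined)),
     gam = free_gam K M\<rparr>"

text \<open>The image of \<open>y \<in> M (n + 1)\<close> in the free permutad, for \<open>n \<ge> 1\<close>.\<close>

definition free_incl ::
  "('k, 'z) ring_scheme \<Rightarrow> (nat \<Rightarrow> ('k, 'm) module) \<Rightarrow> nat \<Rightarrow> 'm \<Rightarrow> ('k, 'm) free_permutad_elem"
  where
  "free_incl K M n y =
     sum_inj (surj_index n) (free_summand K M n) (1, corolla n)
       (pure_tensor K {1..1} (decoration M n (corolla n)) (\<lambda>j\<in>{1..1}. y))"


section \<open>The parametrized associative permutad\<close>

definition as_surj :: "nat \<Rightarrow> (nat \<Rightarrow> nat) \<Rightarrow> (nat \<Rightarrow> nat)" where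
  "as_surj n \<sigma> = restrict \<sigma> {1..n}"

definition binary_gens :: "('k, 'z) ring_scheme \<Rightarrow> nat \<Rightarrow> ('k, unit \<Rightarrow> 'k) module" where
  "binary_gens K n = free_module K (if n = 2 then {()} else {})"

definition free_mu :: "('k, 'z) ring_scheme \<Rightarrow> ('k, unit \<Rightarrow> 'k) free_permutad_elem" where
  "free_mu K = free_incl K (binary_gens K) 1 (free_gen K {()} ())"

definition q_relations ::
  "('k, 'z) ring_scheme \<Rightarrow> 'k \<Rightarrow> nat \<Rightarrow> ('k, unit \<Rightarrow> 'k) free_permutad_elem set" where
  "q_relations K q n =
    (let P = free_permutad K (binary_gens K); mus = (\<lambda>j\<in>{1..2}. free_mu K) in
     if n = 3
     then {gam P 2 2 (as_surj 2 (transpose 1 2)) mus \<ominus>\<^bsub>comp P 3\<^esub>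
             q \<odot>\<^bsub>comp P 3\<^esub> gam P 2 2 (as_surj 2 id) mus}
     else {})"

definition q_ideal ::
  "('k, 'z) ring_scheme \<Rightarrow> 'k \<Rightarrow> nat \<Rightarrow> ('k, unit \<Rightarrow> 'k) free_permutad_elem set" where
  "q_ideal K q =
     generated_ideal K (free_permutad K (binary_gens K)) (q_relations K q)"

definition q_permAs ::
  "('k, 'z) ring_scheme \<Rightarrow> 'k \<Rightarrow> ('k, ('k, unit \<Rightarrow> 'k) free_permutad_elem set) permutad_data" where
  "q_permAs K q = quotient_permutad (free_permutad K (binary_gens K)) (q_ideal K q)"

definition q_mu ::
  "('k, 'z) ring_scheme \<Rightarrow> 'k \<Rightarrow> ('k, unit \<Rightarrow> 'k) free_permutad_elem set" where
  "q_mu K q = q_ideal K q 2 +>\<^bsub>comp (free_permutad K (binary_gens K)) 2\<^esub> free_mu K"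


section \<open>Coxeter length\<close>

definition coxeter_length :: "nat \<Rightarrow> (nat \<Rightarrow> nat) \<Rightarrow> nat" where
  "coxeter_length n \<sigma> =
    (LEAST l. \<exists>is. length is = l \<and> set is \<subseteq> {1..<n} \<and>
       \<sigma> = foldr (\<circ>) (map (\<lambda>i. transpose i (Suc i)) is) id)"

end

theory Submission
  imports Defs
begin

text \<open>Let \<open>inv t\<close> be the number of pairs \<open>a < b\<close> with \<open>t a > t b\<close>. Inversions add up under
  substitution, so the ground ring in every arity, where \<open>\<Gamma>(t; \<lambda>\<^sub>1, \<dots>, \<lambda>\<^sub>k)\<close> is the product of the
  \<open>\<lambda>\<^sub>j\<close> times \<open>q ^ inv t\<close>, receives a map from the free permutad that respects the defining
  relation. This map sends \<open>\<Gamma>(\<sigma>; \<mu>, \<dots>, \<mu>)\<close> to \<open>q ^ inv \<sigma>\<close>, and its kernel contains the ideal of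
  relations. Conversely, a descent \<open>\<sigma> a = j + 1\<close>, \<open>\<sigma> b = j\<close>, \<open>a < b\<close> lets one write \<open>\<sigma>\<close> as the
  surjection that merges \<open>j\<close> and \<open>j + 1\<close> with a transposition substituted, so the relation removes the
  descent at the cost of a factor \<open>q\<close>. By induction \<open>\<Gamma>(\<sigma>; \<mu>, \<dots>, \<mu>) - q ^ inv \<sigma> \<Gamma>(1; \<mu>, \<dots>, \<mu>)\<close> is in
  the ideal, hence the ideal is the whole kernel. All tensor factors are free of rank at most one, so
  the tensor relations, too, are the kernel of a linear form; every quotient that occurs therefore
  consists of level sets of a form.\<close>

section \<open>Modules and linear forms\<close>

text \<open>Operations on a quotient are unions of cosets over all representatives, so each of them
  hides a well-definedness claim. A form with the right kernel settles it: a coset is the level set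
  of its value, the value of a result depends only on the values of the arguments, and the union is
  one coset as soon as a representative exists. Values are taken in the image of the form, which can
  be smaller than the ring: a fiber with more than one element is decorated by the zero module.

  The form also prevents a collapse of the quotient, since its value on \<Gamma>(1; \<mu>, ...,
  \<mu>) is 1 whatever q is. As q may be zero or a zero divisor, the relation is applied only in the
  direction that removes a descent and multiplies by q.

  Inversions are counted for all surjections and not only for permutations, because the kernel can
  be an ideal only if the form respects compositions along every surjection, including the merging
  ones.\<close>

definition linear_form :: "('k, 'z) ring_scheme \<Rightarrow> ('k, 'm, 'y) module_scheme \<Rightarrow> ('m \<Rightarrow> 'k) \<Rightarrow> bool"
  where "linear_form K M \<phi> \<longleftrightarrow> \<phi> \<in> carrier M \<rightarrow> carrier K \<and>
     (\<forall>x\<in>carrier M. \<forall>y\<in>carrier M. \<phi> (x \<oplus>\<^bsub>M\<^esub> y) = \<phi> x \<oplus>\<^bsub>K\<^esub> \<phi> y) \<and>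
     (\<forall>a\<in>carrier K. \<forall>x\<in>carrier M. \<phi> (a \<odot>\<^bsub>M\<^esub> x) = a \<otimes>\<^bsub>K\<^esub> \<phi> x)"

definition form_kernel :: "('k, 'z) ring_scheme \<Rightarrow> ('k, 'm, 'y) module_scheme \<Rightarrow> ('m \<Rightarrow> 'k) \<Rightarrow> 'm set"
  where "form_kernel K M \<phi> = {x \<in> carrier M. \<phi> x = \<zero>\<^bsub>K\<^esub>}"

text \<open>Level sets name the elements of a quotient by a scalar instead of by a
  representative.\<close>

definition level_set :: "('k, 'm, 'y) module_scheme \<Rightarrow> ('m \<Rightarrow> 'k) \<Rightarrow> 'k \<Rightarrow> 'm set"
  where "level_set M \<phi> c = {x \<in> carrier M. \<phi> x = c}"

lemma (in cring) module_regular: "module R (regular_module R)"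
  unfolding regular_module_def
  by (rule moduleI)
    (auto simp: is_cring l_distr r_distr m_assoc intro!: abelian_groupI a_assoc a_comm l_neg
      intro: exI[of _ "a_inv R x" for x] bexI[of _ "a_inv R x" for x])

lemma linear_formD:
  assumes "linear_form K M \<phi>"
  shows "x \<in> carrier M \<Longrightarrow> \<phi> x \<in> carrier K"
    and "x \<in> carrier M \<Longrightarrow> y \<in> carrier M \<Longrightarrow> \<phi> (x \<oplus>\<^bsub>M\<^esub> y) = \<phi> x \<oplus>\<^bsub>K\<^esub> \<phi> y"
    and "a \<in> carrier K \<Longrightarrow> x \<in> carrier M \<Longrightarrow> \<phi> (a \<odot>\<^bsub>M\<^esub> x) = a \<otimes>\<^bsub>K\<^esub> \<phi> x"
  using assms by (auto simp: linear_form_def)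

section \<open>Quotients by the kernel of a linear form\<close>

context
  fixes R (structure) and M :: "('a, 'm) module" (structure) and \<phi>
  assumes M: "module R M" and \<phi>: "linear_form R M \<phi>"
begin

interpretation module R M by (rule M)

lemma linear_form_zero: "\<phi> \<zero>\<^bsub>M\<^esub> = \<zero>"
  using linear_formD(3)[OF \<phi>, of \<zero> "\<zero>\<^bsub>M\<^esub>"] linear_formD(1)[OF \<phi>] by simp

lemma linear_form_minus: "x \<in> carrier M \<Longrightarrow> \<phi> (\<ominus>\<^bsub>M\<^esub> x) = \<ominus> \<phi> x"
  using linear_formD(2)[OF \<phi>, of x "\<ominus>\<^bsub>M\<^esub> x"] linear_formD(1)[OF \<phi>, of x]
    linear_formD(1)[OF \<phi>, of "\<ominus>\<^bsub>M\<^esub> x"]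
  by (metis M.a_inv_closed M.r_neg R.a_comm R.minus_equality linear_form_zero)

lemma linear_form_diff:
  "x \<in> carrier M \<Longrightarrow> y \<in> carrier M \<Longrightarrow> \<phi> (x \<ominus>\<^bsub>M\<^esub> y) = \<phi> x \<ominus> \<phi> y"
  using linear_formD(2)[OF \<phi>, of x "\<ominus>\<^bsub>M\<^esub> y"]
  by (simp add: a_minus_def linear_form_minus)

lemma linear_form_finsum:
  "f \<in> A \<rightarrow> carrier M \<Longrightarrow> \<phi> (\<Oplus>\<^bsub>M\<^esub>a\<in>A. f a) = (\<Oplus>a\<in>A. \<phi> (f a))"
proof (induction A rule: infinite_finite_induct)
  case (insert a A)
  then show ?case
    by (simp add: linear_formD[OF \<phi>] Pi_def)
qed (simp_all add: linear_form_zero)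

lemma form_kernel_submodule: "submodule (form_kernel R M \<phi>) R M"
  by (rule submoduleI)
    (auto simp: form_kernel_def linear_form_zero linear_form_minus linear_formD[OF \<phi>])

text \<open>Two elements have the same value iff their difference lies in the kernel.\<close>

lemma form_kernel_coset:
  assumes x: "x \<in> carrier M"
  shows "form_kernel R M \<phi> +>\<^bsub>M\<^esub> x = level_set M \<phi> (\<phi> x)"
proof
  show "form_kernel R M \<phi> +>\<^bsub>M\<^esub> x \<subseteq> level_set M \<phi> (\<phi> x)"
    using x by (auto simp: a_r_coset_def' form_kernel_def level_set_def linear_formD[OF \<phi>])
  show "level_set M \<phi> (\<phi> x) \<subseteq> form_kernel R M \<phi> +>\<^bsub>M\<^esub> x"
  proof
    fix y assume "y \<in> level_set M \<phi> (\<phi> x)"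
    then have y: "y \<in> carrier M" "\<phi> y = \<phi> x" by (auto simp: level_set_def)
    then have "y \<ominus>\<^bsub>M\<^esub> x \<in> form_kernel R M \<phi>"
      using x by (simp add: form_kernel_def linear_form_diff linear_formD[OF \<phi>] a_minus_def[of R] R.r_neg)
    moreover have "y = (y \<ominus>\<^bsub>M\<^esub> x) \<oplus>\<^bsub>M\<^esub> x"
      using x y by (simp add: a_minus_def M.a_assoc M.l_neg)
    ultimately show "y \<in> form_kernel R M \<phi> +>\<^bsub>M\<^esub> x"
      by (auto simp: a_r_coset_def')
  qed
qed

text \<open>The value must be attained: otherwise the level set is empty and \<open>the_elem\<close>
  is unspecified.\<close>

lemma level_set_value: "c \<in> \<phi> ` carrier M \<Longrightarrow> the_elem (\<phi> ` level_set M \<phi> c) = c"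
proof -
  assume "c \<in> \<phi> ` carrier M"
  then have "\<phi> ` level_set M \<phi> c = {c}" by (auto simp: level_set_def)
  then show ?thesis by simp
qed

text \<open>The form is not assumed surjective, so that zero modules are covered; hence the cosets
  are indexed by its image.\<close>

lemma quotient_kernel_carrier:
  "carrier (quotient_module M (form_kernel R M \<phi>)) = level_set M \<phi> ` \<phi> ` carrier M"
  by (auto simp: quotient_module_def A_RCOSETS_def' form_kernel_coset)

text \<open>\<open>set_add\<close> is the elementwise sum of two level sets. That it fills the whole
  level set of a + b uses that b is attained, say at y: any z of value a + b is (z - y) + y.\<close>

lemma quotient_kernel_add:
  assumes "a \<in> \<phi> ` carrier M" "b \<in> \<phi> ` carrier M"
  shows "level_set M \<phi> a \<oplus>\<^bsub>quotient_module M (form_kernel R M \<phi>)\<^esub> level_set M \<phi> b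
    = level_set M \<phi> (a \<oplus> b)"
proof -
  obtain x where x: "x \<in> carrier M" "\<phi> x = a" using assms by auto
  obtain y where y: "y \<in> carrier M" "\<phi> y = b" using assms by auto
  have "\<exists>v\<in>level_set M \<phi> a. \<exists>w\<in>level_set M \<phi> b. z = v \<oplus>\<^bsub>M\<^esub> w"
    if z: "z \<in> carrier M" "\<phi> z = a \<oplus> b" for z
  proof (intro bexI)
    show "z = (z \<ominus>\<^bsub>M\<^esub> y) \<oplus>\<^bsub>M\<^esub> y"
      using z y by (simp add: a_minus_def M.a_assoc M.l_neg)
    show "z \<ominus>\<^bsub>M\<^esub> y \<in> level_set M \<phi> a"
      using z x y linear_formD(1)[OF \<phi>, of x] linear_formD(1)[OF \<phi>, of y] linear_form_diff[of z y]
      by (auto simp: level_set_def a_minus_def[of R] R.a_assoc R.r_neg)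
    show "y \<in> level_set M \<phi> b" using y by (simp add: level_set_def)
  qed
  then show ?thesis
    by (auto simp: quotient_module_def set_add_def' level_set_def linear_formD[OF \<phi>])
qed

text \<open>All representatives x yield the same coset and at least one x exists, so the union in
  \<open>quotient_module\<close> is that coset.\<close>

lemma quotient_kernel_smult:
  assumes a: "a \<in> carrier R" and b: "b \<in> \<phi> ` carrier M"
  shows "a \<odot>\<^bsub>quotient_module M (form_kernel R M \<phi>)\<^esub> level_set M \<phi> b = level_set M \<phi> (a \<otimes> b)"
proof -
  have "form_kernel R M \<phi> +>\<^bsub>M\<^esub> (a \<odot>\<^bsub>M\<^esub> x) = level_set M \<phi> (a \<otimes> b)" if "x \<in> level_set M \<phi> b" for x
    using that a by (auto simp: level_set_def form_kernel_coset linear_formD[OF \<phi>])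
  moreover have "level_set M \<phi> b \<noteq> {}" using b by (auto simp: level_set_def)
  ultimately show ?thesis by (simp add: quotient_module_def)
qed

text \<open>The image of the form is an ideal of the ring, and level sets add and scale as their
  values do, so each module axiom is the corresponding law for scalars.\<close>

lemma quotient_kernel_module: "module R (quotient_module M (form_kernel R M \<phi>))"
proof -
  let ?Q = "quotient_module M (form_kernel R M \<phi>)" and ?I = "\<phi> ` carrier M"
  have I: "a \<in> carrier R" if "a \<in> ?I" for a
    using that linear_formD(1)[OF \<phi>] by auto
  have Iadd: "a \<oplus> b \<in> ?I" if ab: "a \<in> ?I" "b \<in> ?I" for a b
  proof -
    obtain x y where "x \<in> carrier M" "y \<in> carrier M" "a = \<phi> x" "b = \<phi> y"
      using ab by auto
    then show ?thesis by (intro image_eqI[of _ _ "x \<oplus>\<^bsub>M\<^esub> y"]) (auto simp: linear_formD[OF \<phi>])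
  qed
  have Iuminus: "\<ominus> a \<in> ?I" if a: "a \<in> ?I" for a
  proof -
    obtain x where "x \<in> carrier M" "a = \<phi> x"
      using a by auto
    then show ?thesis by (intro image_eqI[of _ _ "\<ominus>\<^bsub>M\<^esub> x"]) (auto simp: linear_form_minus)
  qed
  have Ismult: "r \<otimes> a \<in> ?I" if ra: "r \<in> carrier R" "a \<in> ?I" for r a
  proof -
    obtain x where "x \<in> carrier M" "a = \<phi> x"
      using ra(2) by blast
    then show ?thesis using ra
      by (intro image_eqI[of _ _ "r \<odot>\<^bsub>M\<^esub> x"]) (auto simp: linear_formD[OF \<phi>])
  qed
  have Q0: "\<zero>\<^bsub>?Q\<^esub> = level_set M \<phi> \<zero>"
    by (simp add: quotient_module_def form_kernel_def level_set_def)
  have I0: "\<zero> \<in> ?I"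
    using linear_form_zero by (metis M.zero_closed imageI)
  note ops = quotient_kernel_add quotient_kernel_smult Iadd Ismult I0
  show ?thesis
  proof (rule moduleI)
    show "abelian_group ?Q"
      unfolding quotient_kernel_carrier
    proof (rule abelian_groupI, unfold quotient_kernel_carrier Q0)
      fix X assume "X \<in> level_set M \<phi> ` ?I"
      then obtain a where a: "a \<in> ?I" "X = level_set M \<phi> a" by blast
      show "\<exists>y\<in>level_set M \<phi> ` ?I. y \<oplus>\<^bsub>?Q\<^esub> X = level_set M \<phi> \<zero>"
        using a I[OF a(1)]
        by (intro bexI[of _ "level_set M \<phi> (\<ominus> a)"]) (auto simp: ops Iuminus R.l_neg simp del: image_iff)
    qed (use I in \<open>force simp: ops I R.a_ac\<close>)+
  qed (use I in \<open>force simp: quotient_kernel_carrier ops R.is_cring R.l_distr R.r_distr R.m_assoc\<close>)+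
qed

end

text \<open>An element of value 1 makes the form surjective. The quotient is then a copy of the ring
  in which the level set of 1 plays the part of the unit.\<close>

lemma quotient_kernel_basis:
  fixes R (structure) and M :: "('a, 'm) module" (structure)
  assumes M: "module R M" and \<phi>: "linear_form R M \<phi>" and e: "e \<in> carrier M" "\<phi> e = \<one>"
  shows "module_basis R (quotient_module M (form_kernel R M \<phi>)) {level_set M \<phi> \<one>}"
proof -
  let ?Q = "quotient_module M (form_kernel R M \<phi>)" and ?g = "level_set M \<phi> \<one>"
  interpret module R M by (rule M)
  interpret Q: module R ?Q by (rule quotient_kernel_module[OF M \<phi>])
  have I: "\<phi> ` carrier M = carrier R"
  proof
    show "\<phi> ` carrier M \<subseteq> carrier R" using linear_formD(1)[OF \<phi>] by auto
    show "carrier R \<subseteq> \<phi> ` carrier M"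
    proof
      fix a assume "a \<in> carrier R"
      then show "a \<in> \<phi> ` carrier M"
        using e by (intro image_eqI[of _ _ "a \<odot>\<^bsub>M\<^esub> e"]) (auto simp: linear_formD[OF \<phi>])
    qed
  qed
  have g: "?g \<in> carrier ?Q"
    by (simp add: quotient_kernel_carrier[OF M \<phi>] I)
  have smult: "a \<odot>\<^bsub>?Q\<^esub> ?g = level_set M \<phi> a" if "a \<in> carrier R" for a
    using that by (simp add: quotient_kernel_smult[OF M \<phi>] I)
  have car: "carrier (free_module R {?g}) = {?g} \<rightarrow>\<^sub>E carrier R"
    by (auto simp: free_module_def direct_sum_def regular_module_def)
  \<comment> \<open>The sum in \<open>module_basis\<close> runs over the support only, so a zero
    coefficient leaves the empty sum and needs its own case.\<close>
  have eq: "(\<Oplus>\<^bsub>?Q\<^esub>b\<in>{b \<in> {?g}. f b \<noteq> \<zero>}. f b \<odot>\<^bsub>?Q\<^esub> b) = level_set M \<phi> (f ?g)"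
    if f: "f \<in> {?g} \<rightarrow>\<^sub>E carrier R" for f
  proof (cases "f ?g = \<zero>")
    case True
    then have "{b \<in> {?g}. f b \<noteq> \<zero>} = {}" by auto
    moreover have "level_set M \<phi> (f ?g) = \<zero>\<^bsub>?Q\<^esub>"
      using True by (simp add: quotient_module_def form_kernel_def level_set_def)
    ultimately show ?thesis by (simp only: Q.finsum_empty)
  next
    case False
    then have "{b \<in> {?g}. f b \<noteq> \<zero>} = {?g}" by auto
    then show ?thesis
      using f g smult[of "f ?g"] Q.smult_closed[of "f ?g" ?g]
        Q.finsum_insert[of "{}" ?g "\<lambda>b. f b \<odot>\<^bsub>?Q\<^esub> b"]
      by (simp add: PiE_iff Pi_def)
  qed
  have "bij_betw (\<lambda>f. level_set M \<phi> (f ?g)) ({?g} \<rightarrow>\<^sub>E carrier R) (carrier ?Q)"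
  proof (rule bij_betw_imageI)
    show "inj_on (\<lambda>f. level_set M \<phi> (f ?g)) ({?g} \<rightarrow>\<^sub>E carrier R)"
    proof (rule inj_onI)
      fix f h assume fh: "f \<in> {?g} \<rightarrow>\<^sub>E carrier R" "h \<in> {?g} \<rightarrow>\<^sub>E carrier R"
        and "level_set M \<phi> (f ?g) = level_set M \<phi> (h ?g)"
      then have "f ?g = h ?g"
        using level_set_value[OF M \<phi>, unfolded I] by (metis PiE_mem insertI1)
      then show "f = h" using fh by (intro PiE_ext) auto
    qed
    show "(\<lambda>f. level_set M \<phi> (f ?g)) ` ({?g} \<rightarrow>\<^sub>E carrier R) = carrier ?Q"
    proof
      show "(\<lambda>f. level_set M \<phi> (f ?g)) ` ({?g} \<rightarrow>\<^sub>E carrier R) \<subseteq> carrier ?Q"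
        by (auto simp: quotient_kernel_carrier[OF M \<phi>] I)
      show "carrier ?Q \<subseteq> (\<lambda>f. level_set M \<phi> (f ?g)) ` ({?g} \<rightarrow>\<^sub>E carrier R)"
      proof
        fix X assume "X \<in> carrier ?Q"
        then obtain a where a: "a \<in> carrier R" "X = level_set M \<phi> a"
          by (auto simp: quotient_kernel_carrier[OF M \<phi>] I)
        then show "X \<in> (\<lambda>f. level_set M \<phi> (f ?g)) ` ({?g} \<rightarrow>\<^sub>E carrier R)"
          by (intro image_eqI[of _ _ "\<lambda>_\<in>{?g}. a"]) auto
      qed
    qed
  qed
  then show ?thesis
    unfolding module_basis_def car using g Q.module_axioms eq
    by (simp cong: bij_betw_cong)
qed

section \<open>Direct sums and free modules\<close>

lemma direct_sum_simps:
  "x \<in> carrier (direct_sum I M) \<longleftrightarrow>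
     x \<in> (\<Pi>\<^sub>E i\<in>I. carrier (M i)) \<and> finite {i \<in> I. x i \<noteq> \<zero>\<^bsub>M i\<^esub>}"
  "\<zero>\<^bsub>direct_sum I M\<^esub> = (\<lambda>i\<in>I. \<zero>\<^bsub>M i\<^esub>)"
  "x \<oplus>\<^bsub>direct_sum I M\<^esub> y = (\<lambda>i\<in>I. x i \<oplus>\<^bsub>M i\<^esub> y i)"
  "a \<odot>\<^bsub>direct_sum I M\<^esub> x = (\<lambda>i\<in>I. a \<odot>\<^bsub>M i\<^esub> x i)"
  by (auto simp: direct_sum_def)

lemma (in cring) direct_sum_module:
  assumes M: "\<And>i. i \<in> I \<Longrightarrow> module R (M i)"
  shows "module R (direct_sum I M)"
proof -
  note ax = module.axioms(2)[OF M, THEN abelian_group.axioms(1)]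
  have zc: "\<zero>\<^bsub>M i\<^esub> \<in> carrier (M i)" if "i \<in> I" for i
    using abelian_monoid.zero_closed[OF ax[OF that]] .
  have mz: "\<ominus>\<^bsub>M i\<^esub> \<zero>\<^bsub>M i\<^esub> = \<zero>\<^bsub>M i\<^esub>" if "i \<in> I" for i
    using module.axioms(2)[OF M[OF that]] zc[OF that]
    by (metis abelian_group.minus_equality abelian_monoid.l_zero ax that)
  have ac: "x \<oplus>\<^bsub>M i\<^esub> y \<in> carrier (M i)" if "i \<in> I" "x \<in> carrier (M i)" "y \<in> carrier (M i)" for i x y
    using abelian_monoid.a_closed[OF ax[OF that(1)]] that by blast
  have fin_add: "finite {i \<in> I. x i \<oplus>\<^bsub>M i\<^esub> y i \<noteq> \<zero>\<^bsub>M i\<^esub>}"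
    if "finite {i \<in> I. x i \<noteq> \<zero>\<^bsub>M i\<^esub>}" "finite {i \<in> I. y i \<noteq> \<zero>\<^bsub>M i\<^esub>}" for x y
    by (rule finite_subset[OF _ finite_UnI[OF that]])
      (auto simp: abelian_monoid.l_zero[OF ax] zc)
  have fin_smult: "finite {i \<in> I. a \<odot>\<^bsub>M i\<^esub> x i \<noteq> \<zero>\<^bsub>M i\<^esub>}"
    if "finite {i \<in> I. x i \<noteq> \<zero>\<^bsub>M i\<^esub>}" "a \<in> carrier R" for a x
    by (rule finite_subset[OF _ that(1)])
      (use that in \<open>auto simp: module.smult_r_null[OF M]\<close>)
  show ?thesis
  proof (rule moduleI)
    show "abelian_group (direct_sum I M)"
    proof (rule abelian_groupI)
      fix x assume x: "x \<in> carrier (direct_sum I M)"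
      let ?y = "\<lambda>i\<in>I. \<ominus>\<^bsub>M i\<^esub> x i"
      have xi: "x i \<in> carrier (M i)" if "i \<in> I" for i
        using x that by (auto simp: direct_sum_simps)
      have "finite {i \<in> I. ?y i \<noteq> \<zero>\<^bsub>M i\<^esub>}"
        by (rule finite_subset[of _ "{i \<in> I. x i \<noteq> \<zero>\<^bsub>M i\<^esub>}"])
          (use x in \<open>auto simp: direct_sum_simps mz\<close>)
      then have "?y \<in> carrier (direct_sum I M)"
        using xi by (auto simp: direct_sum_simps abelian_group.a_inv_closed[OF module.axioms(2)[OF M]])
      moreover have "?y \<oplus>\<^bsub>direct_sum I M\<^esub> x = \<zero>\<^bsub>direct_sum I M\<^esub>"
        using xi by (auto simp: direct_sum_simps abelian_group.l_neg[OF module.axioms(2)[OF M]])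
      ultimately show "\<exists>y\<in>carrier (direct_sum I M). y \<oplus>\<^bsub>direct_sum I M\<^esub> x = \<zero>\<^bsub>direct_sum I M\<^esub>"
        by blast
    next
      fix x y assume "x \<in> carrier (direct_sum I M)" "y \<in> carrier (direct_sum I M)"
      then show "x \<oplus>\<^bsub>direct_sum I M\<^esub> y \<in> carrier (direct_sum I M)"
        using fin_add[of x y] by (auto simp: direct_sum_simps intro!: ac cong: conj_cong)
    next
      fix x y z assume "x \<in> carrier (direct_sum I M)" "y \<in> carrier (direct_sum I M)"
        "z \<in> carrier (direct_sum I M)"
      then show "x \<oplus>\<^bsub>direct_sum I M\<^esub> y \<oplus>\<^bsub>direct_sum I M\<^esub> z =
        x \<oplus>\<^bsub>direct_sum I M\<^esub> (y \<oplus>\<^bsub>direct_sum I M\<^esub> z)"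
        by (auto simp: direct_sum_simps PiE_iff abelian_monoid.a_assoc[OF ax] intro!: restrict_ext)
    next
      fix x y assume "x \<in> carrier (direct_sum I M)" "y \<in> carrier (direct_sum I M)"
      then show "x \<oplus>\<^bsub>direct_sum I M\<^esub> y = y \<oplus>\<^bsub>direct_sum I M\<^esub> x"
        by (auto simp: direct_sum_simps PiE_iff abelian_monoid.a_comm[OF ax] intro!: restrict_ext)
    next
      fix x assume "x \<in> carrier (direct_sum I M)"
      then show "\<zero>\<^bsub>direct_sum I M\<^esub> \<oplus>\<^bsub>direct_sum I M\<^esub> x = x"
        by (auto simp: direct_sum_simps PiE_iff abelian_monoid.l_zero[OF ax] extensional_def)
    qed (auto simp: direct_sum_simps zc cong: conj_cong)
  next
    fix a x assume "a \<in> carrier R" "x \<in> carrier (direct_sum I M)"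
    then show "a \<odot>\<^bsub>direct_sum I M\<^esub> x \<in> carrier (direct_sum I M)"
      using fin_smult[of x a]
      by (auto simp: direct_sum_simps intro!: module.smult_closed[OF M] cong: conj_cong)
  qed (auto simp: is_cring direct_sum_simps PiE_iff module.smult_l_distr[OF M] module.smult_r_distr[OF M]
      module.smult_assoc1[OF M] module.smult_one[OF M] extensional_def intro!: restrict_ext)
qed

lemma (in cring) sum_inj_closed:
  assumes "\<And>i. i \<in> I \<Longrightarrow> module R (M i)" "y \<in> carrier (M i)"
  shows "sum_inj I M i y \<in> carrier (direct_sum I M)"
proof -
  have "\<zero>\<^bsub>M j\<^esub> \<in> carrier (M j)" if "j \<in> I" for j
    using assms(1)[OF that] by (meson module.axioms(2) abelian_group.axioms(1) abelian_monoid.zero_closed)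
  moreover have "finite {j \<in> I. sum_inj I M i y j \<noteq> \<zero>\<^bsub>M j\<^esub>}"
    by (rule finite_subset[of _ "{i}"]) (auto simp: sum_inj_def)
  ultimately show ?thesis using assms(2) by (auto simp: direct_sum_simps sum_inj_def)
qed

text \<open>Elements have finite support, and induction on the support splits off one coordinate at
  a time.\<close>

lemma (in cring) direct_sum_generated:
  assumes M: "\<And>i. i \<in> I \<Longrightarrow> module R (M i)"
    and N: "submodule N R (direct_sum I M)"
    and gen: "\<And>i y. i \<in> I \<Longrightarrow> y \<in> carrier (M i) \<Longrightarrow> sum_inj I M i y \<in> N"
    and x: "x \<in> carrier (direct_sum I M)"
  shows "x \<in> N"
proof -
  interpret D: module R "direct_sum I M" by (rule direct_sum_module[OF M])
  note ax = module.axioms(2)[OF M, THEN abelian_group.axioms(1)]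
  have zc: "\<zero>\<^bsub>M i\<^esub> \<in> carrier (M i)" if "i \<in> I" for i
    using abelian_monoid.zero_closed[OF ax[OF that]] .
  have "finite F \<Longrightarrow> x \<in> carrier (direct_sum I M) \<Longrightarrow> {i \<in> I. x i \<noteq> \<zero>\<^bsub>M i\<^esub>} = F \<Longrightarrow> x \<in> N" for F x
  proof (induction F arbitrary: x rule: finite_induct)
    case empty
    then have "x = \<zero>\<^bsub>direct_sum I M\<^esub>"
      by (auto simp: direct_sum_simps PiE_iff extensional_def)
    then show ?case using subgroup.one_closed[OF submodule.axioms(1)[OF N]] by simp
  next
    case (insert i F)
    let ?y = "x(i := \<zero>\<^bsub>M i\<^esub>)"
    have i: "i \<in> I" using insert by blast
    have F: "{j \<in> I. ?y j \<noteq> \<zero>\<^bsub>M j\<^esub>} = F" using insert by auto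
    have y: "?y \<in> carrier (direct_sum I M)"
      using insert.prems(1) i F insert.hyps(1) zc by (auto simp: direct_sum_simps PiE_iff extensional_def)
    have "?y \<in> N" by (rule insert.IH[OF y F])
    moreover have xi: "x i \<in> carrier (M i)" using insert.prems(1) i by (auto simp: direct_sum_simps)
    moreover have "x = sum_inj I M i (x i) \<oplus>\<^bsub>direct_sum I M\<^esub> ?y"
      using insert.prems(1) i xi zc
      by (auto simp: direct_sum_simps sum_inj_def PiE_iff extensional_def fun_eq_iff
         abelian_monoid.l_zero[OF ax] abelian_monoid.r_zero[OF ax])
    ultimately show ?case using D.submoduleE(5)[OF N] gen[OF i xi] by metis
  qed
  then show ?thesis using x by (auto simp: direct_sum_simps)
qed

lemma (in cring) direct_sum_form:
  assumes M: "\<And>i. i \<in> I \<Longrightarrow> module R (M i)" and "finite I"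
    and a: "a \<in> I \<rightarrow> carrier R" and \<psi>: "\<And>i. i \<in> I \<Longrightarrow> linear_form R (M i) (\<psi> i)"
  shows "linear_form R (direct_sum I M) (\<lambda>x. \<Oplus>i\<in>I. a i \<otimes> \<psi> i (x i))"
  unfolding linear_form_def
proof (intro conjI ballI funcsetI)
  note \<psi>D = linear_formD[OF \<psi>]
  have c: "\<psi> i (x i) \<in> carrier R" if "i \<in> I" "x \<in> carrier (direct_sum I M)" for i x
    using that by (auto simp: direct_sum_simps intro: \<psi>D)
  have ai: "a i \<in> carrier R" if "i \<in> I" for i using that a by auto
  fix x assume x: "x \<in> carrier (direct_sum I M)"
  show "(\<Oplus>i\<in>I. a i \<otimes> \<psi> i (x i)) \<in> carrier R" using x by (auto intro!: finsum_closed ai c)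
  show "(\<Oplus>i\<in>I. a i \<otimes> \<psi> i ((x \<oplus>\<^bsub>direct_sum I M\<^esub> y) i)) =
     (\<Oplus>i\<in>I. a i \<otimes> \<psi> i (x i)) \<oplus> (\<Oplus>i\<in>I. a i \<otimes> \<psi> i (y i))"
    if y: "y \<in> carrier (direct_sum I M)" for y
  proof -
    have "(\<Oplus>i\<in>I. a i \<otimes> \<psi> i (x i)) \<oplus> (\<Oplus>i\<in>I. a i \<otimes> \<psi> i (y i)) =
      (\<Oplus>i\<in>I. a i \<otimes> \<psi> i (x i) \<oplus> a i \<otimes> \<psi> i (y i))"
      using x y by (subst finsum_addf) (auto intro!: ai c)
    also have "\<dots> = (\<Oplus>i\<in>I. a i \<otimes> \<psi> i ((x \<oplus>\<^bsub>direct_sum I M\<^esub> y) i))"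
      using x y by (intro finsum_cong')
        (auto simp: direct_sum_simps PiE_iff \<psi>D r_distr ai c[OF _ x] c[OF _ y]
          abelian_monoid.a_closed[OF module.axioms(2)[OF M, THEN abelian_group.axioms(1)]])
    finally show ?thesis by simp
  qed
  show "(\<Oplus>i\<in>I. a i \<otimes> \<psi> i ((b \<odot>\<^bsub>direct_sum I M\<^esub> x) i)) = b \<otimes> (\<Oplus>i\<in>I. a i \<otimes> \<psi> i (x i))"
    if b: "b \<in> carrier R" for b
  proof -
    have "b \<otimes> (\<Oplus>i\<in>I. a i \<otimes> \<psi> i (x i)) = (\<Oplus>i\<in>I. b \<otimes> (a i \<otimes> \<psi> i (x i)))"
      using x b \<open>finite I\<close> by (subst finsum_rdistr) (auto intro!: ai c)
    also have "\<dots> = (\<Oplus>i\<in>I. a i \<otimes> \<psi> i ((b \<odot>\<^bsub>direct_sum I M\<^esub> x) i))"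
      using x b by (intro finsum_cong')
        (auto simp: direct_sum_simps PiE_iff \<psi>D m_lcomm ai c[OF _ x] module.smult_closed[OF M])
    finally show ?thesis by simp
  qed
qed

section \<open>Congruences modulo a submodule\<close>

lemma (in abelian_group) minus_zero_imp_eq:
  "x \<in> carrier G \<Longrightarrow> y \<in> carrier G \<Longrightarrow> x \<ominus> y = \<zero> \<Longrightarrow> x = y"
  by (metis a_inv_closed a_minus_def minus_equality minus_minus)

lemma (in abelian_group) diff_zero: "x \<in> carrier G \<Longrightarrow> x \<ominus> \<zero> = x"
  using minus_equality[of \<zero> \<zero>] by (simp add: a_minus_def)

text \<open>Read modulo \<open>N\<close>: from x = a y and y = b z follows x = (a b) z. Both
  rewriting arguments are chained by it, the one that normalizes pure tensors and the one that sorts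
  permutations.\<close>

lemma (in module) submodule_chain:
  assumes N: "submodule N R M" and "x \<ominus>\<^bsub>M\<^esub> a \<odot>\<^bsub>M\<^esub> y \<in> N" "y \<ominus>\<^bsub>M\<^esub> b \<odot>\<^bsub>M\<^esub> z \<in> N"
    and c: "a \<in> carrier R" "b \<in> carrier R" "x \<in> carrier M" "y \<in> carrier M" "z \<in> carrier M"
  shows "x \<ominus>\<^bsub>M\<^esub> (a \<otimes> b) \<odot>\<^bsub>M\<^esub> z \<in> N"
proof -
  have "(x \<ominus>\<^bsub>M\<^esub> a \<odot>\<^bsub>M\<^esub> y) \<oplus>\<^bsub>M\<^esub> a \<odot>\<^bsub>M\<^esub> (y \<ominus>\<^bsub>M\<^esub> b \<odot>\<^bsub>M\<^esub> z) \<in> N"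
    using assms submoduleE[OF N] by blast
  also have "(x \<ominus>\<^bsub>M\<^esub> a \<odot>\<^bsub>M\<^esub> y) \<oplus>\<^bsub>M\<^esub> a \<odot>\<^bsub>M\<^esub> (y \<ominus>\<^bsub>M\<^esub> b \<odot>\<^bsub>M\<^esub> z) = x \<ominus>\<^bsub>M\<^esub> (a \<otimes> b) \<odot>\<^bsub>M\<^esub> z"
    using c by (simp add: a_minus_def smult_r_distr smult_r_minus smult_assoc1 M.a_assoc M.r_neg1 M.r_neg2)
  finally show ?thesis .
qed

text \<open>Being congruent modulo \<open>N\<close> to the multiple of \<open>e\<close> prescribed
  by the form is a linear condition, so it can be tested on generators.\<close>

lemma form_multiples_submodule:
  fixes R (structure) and M :: "('a, 'm) module" (structure)
  assumes M: "module R M" and N: "submodule N R M" and \<phi>: "linear_form R M \<phi>" and e: "e \<in> carrier M"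
  shows "submodule {x \<in> carrier M. x \<ominus>\<^bsub>M\<^esub> \<phi> x \<odot>\<^bsub>M\<^esub> e \<in> N} R M"
proof -
  interpret module R M by (rule M)
  note NE = submoduleE[OF N]
  note f = linear_formD[OF \<phi>] linear_form_zero[OF M \<phi>] linear_form_minus[OF M \<phi>]
  have z: "\<zero>\<^bsub>M\<^esub> \<in> N" using subgroup.one_closed[OF submodule.axioms(1)[OF N]] by simp
  show ?thesis
  proof (rule submoduleI)
    show "\<zero>\<^bsub>M\<^esub> \<in> {x \<in> carrier M. x \<ominus>\<^bsub>M\<^esub> \<phi> x \<odot>\<^bsub>M\<^esub> e \<in> N}"
      using z e by (simp add: f a_minus_def M.r_neg)
  next
    fix x assume x: "x \<in> {x \<in> carrier M. x \<ominus>\<^bsub>M\<^esub> \<phi> x \<odot>\<^bsub>M\<^esub> e \<in> N}"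
    then have "\<ominus>\<^bsub>M\<^esub> x \<ominus>\<^bsub>M\<^esub> \<phi> (\<ominus>\<^bsub>M\<^esub> x) \<odot>\<^bsub>M\<^esub> e = \<ominus>\<^bsub>M\<^esub> (x \<ominus>\<^bsub>M\<^esub> \<phi> x \<odot>\<^bsub>M\<^esub> e)"
      using e by (simp add: f a_minus_def M.minus_add smult_l_minus)
    then show "\<ominus>\<^bsub>M\<^esub> x \<in> {x \<in> carrier M. x \<ominus>\<^bsub>M\<^esub> \<phi> x \<odot>\<^bsub>M\<^esub> e \<in> N}" using x NE(3) by simp
  next
    fix x y assume x: "x \<in> {x \<in> carrier M. x \<ominus>\<^bsub>M\<^esub> \<phi> x \<odot>\<^bsub>M\<^esub> e \<in> N}"
      and y: "y \<in> {x \<in> carrier M. x \<ominus>\<^bsub>M\<^esub> \<phi> x \<odot>\<^bsub>M\<^esub> e \<in> N}"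
    then have "x \<oplus>\<^bsub>M\<^esub> y \<ominus>\<^bsub>M\<^esub> \<phi> (x \<oplus>\<^bsub>M\<^esub> y) \<odot>\<^bsub>M\<^esub> e =
        (x \<ominus>\<^bsub>M\<^esub> \<phi> x \<odot>\<^bsub>M\<^esub> e) \<oplus>\<^bsub>M\<^esub> (y \<ominus>\<^bsub>M\<^esub> \<phi> y \<odot>\<^bsub>M\<^esub> e)"
      using e by (simp add: f a_minus_def M.minus_add smult_l_distr M.a_ac)
    then show "x \<oplus>\<^bsub>M\<^esub> y \<in> {x \<in> carrier M. x \<ominus>\<^bsub>M\<^esub> \<phi> x \<odot>\<^bsub>M\<^esub> e \<in> N}" using x y NE(5) by simp
  next
    fix a x assume a: "a \<in> carrier R" and x: "x \<in> {x \<in> carrier M. x \<ominus>\<^bsub>M\<^esub> \<phi> x \<odot>\<^bsub>M\<^esub> e \<in> N}"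
    then have "a \<odot>\<^bsub>M\<^esub> x \<ominus>\<^bsub>M\<^esub> \<phi> (a \<odot>\<^bsub>M\<^esub> x) \<odot>\<^bsub>M\<^esub> e = a \<odot>\<^bsub>M\<^esub> (x \<ominus>\<^bsub>M\<^esub> \<phi> x \<odot>\<^bsub>M\<^esub> e)"
      using e by (simp add: f a_minus_def smult_r_distr smult_r_minus smult_assoc1)
    then show "a \<odot>\<^bsub>M\<^esub> x \<in> {x \<in> carrier M. x \<ominus>\<^bsub>M\<^esub> \<phi> x \<odot>\<^bsub>M\<^esub> e \<in> N}" using x a NE(4) by simp
  qed auto
qed

section \<open>Free modules and linear extension\<close>

lemma (in cring) free_module_module: "module R (free_module R S)"
  unfolding free_module_def by (rule direct_sum_module) (rule module_regular)

lemma (in cring) free_module_carrier: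
  "f \<in> carrier (free_module R S) \<longleftrightarrow> f \<in> S \<rightarrow>\<^sub>E carrier R \<and> finite {s \<in> S. f s \<noteq> \<zero>}"
  by (simp add: free_module_def direct_sum_simps regular_module_def)

lemma (in cring) free_module_ops:
  "\<zero>\<^bsub>free_module R S\<^esub> = (\<lambda>s\<in>S. \<zero>)"
  "f \<oplus>\<^bsub>free_module R S\<^esub> g = (\<lambda>s\<in>S. f s \<oplus> g s)"
  "a \<odot>\<^bsub>free_module R S\<^esub> f = (\<lambda>s\<in>S. a \<otimes> f s)"
  by (simp_all add: free_module_def direct_sum_simps regular_module_def)

lemma (in cring) free_gen_closed: "free_gen R S s \<in> carrier (free_module R S)"
  unfolding free_gen_def free_module_def
  by (rule sum_inj_closed) (rule module_regular, simp add: regular_module_def)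

lemma (in cring) free_module_generated:
  assumes N: "submodule N R (free_module R S)" and gen: "\<And>s. s \<in> S \<Longrightarrow> free_gen R S s \<in> N"
    and f: "f \<in> carrier (free_module R S)"
  shows "f \<in> N"
proof (rule direct_sum_generated[OF module_regular _ _ f[unfolded free_module_def]])
  show N': "submodule N R (direct_sum S (\<lambda>_. regular_module R))"
    using N by (simp add: free_module_def)
  fix s y assume s: "s \<in> S" and y: "y \<in> carrier (regular_module R)"
  then have "sum_inj S (\<lambda>_. regular_module R) s y = y \<odot>\<^bsub>free_module R S\<^esub> free_gen R S s"
    by (auto simp: free_module_ops free_gen_def sum_inj_def regular_module_def)
  then show "sum_inj S (\<lambda>_. regular_module R) s y \<in> N"
    using module.submoduleE(4)[OF free_module_module N] gen[OF s] y
    by (simp add: regular_module_def)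
qed

text \<open>The linear extension of \<open>g\<close> to the free module. The sum is restricted to
  the support because \<open>S\<close> may be infinite: below it is a set of tuples of module
  elements.\<close>

definition combination_form :: "('k, 'z) ring_scheme \<Rightarrow> 's set \<Rightarrow> ('s \<Rightarrow> 'k) \<Rightarrow> ('s \<Rightarrow> 'k) \<Rightarrow> 'k" where
  "combination_form K S g f = (\<Oplus>\<^bsub>K\<^esub>s\<in>{s \<in> S. f s \<noteq> \<zero>\<^bsub>K\<^esub>}. f s \<otimes>\<^bsub>K\<^esub> g s)"

text \<open>Terms off the support vanish. Enlarging the index set gives two summands and their sum a
  common one.\<close>

lemma (in cring) combination_form_superset:
  assumes "finite A" "A \<subseteq> S" "{s \<in> S. f s \<noteq> \<zero>} \<subseteq> A"
    and "g \<in> S \<rightarrow> carrier R" "f \<in> S \<rightarrow> carrier R"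
  shows "combination_form R S g f = (\<Oplus>s\<in>A. f s \<otimes> g s)"
  unfolding combination_form_def
proof (rule add.finprod_mono_neutral_cong_left)
  show "f s \<otimes> g s = \<zero>" if "s \<in> A - {s \<in> S. f s \<noteq> \<zero>}" for s
    using that assms(2,4) by (auto simp: Pi_iff subset_iff)
qed (use assms in \<open>auto simp: Pi_iff subset_iff\<close>)

lemma (in cring) combination_form_linear:
  assumes g: "g \<in> S \<rightarrow> carrier R"
  shows "linear_form R (free_module R S) (combination_form R S g)"
  unfolding linear_form_def
proof (intro conjI ballI funcsetI)
  have gc: "g s \<in> carrier R" if "s \<in> S" for s using g that by auto
  fix f assume f: "f \<in> carrier (free_module R S)"
  have fc: "f s \<in> carrier R" if "s \<in> S" for s
    using f that by (auto simp: free_module_carrier)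
  show "combination_form R S g f \<in> carrier R"
    unfolding combination_form_def by (rule finsum_closed) (auto intro: fc gc)
  {
    fix h assume h: "h \<in> carrier (free_module R S)"
    have hc: "h s \<in> carrier R" if "s \<in> S" for s
      using h that by (auto simp: free_module_carrier)
    let ?A = "{s \<in> S. f s \<noteq> \<zero>} \<union> {s \<in> S. h s \<noteq> \<zero>}"
    have A: "finite ?A" using f h by (simp add: free_module_carrier)
    have "combination_form R S g (f \<oplus>\<^bsub>free_module R S\<^esub> h) = (\<Oplus>s\<in>?A. (f \<oplus>\<^bsub>free_module R S\<^esub> h) s \<otimes> g s)"
      by (rule combination_form_superset) (use A g fc hc in \<open>auto simp: free_module_ops\<close>)
    also have "\<dots> = (\<Oplus>s\<in>?A. f s \<otimes> g s \<oplus> h s \<otimes> g s)"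
      by (rule finsum_cong') (auto simp: free_module_ops fc hc gc l_distr)
    also have "\<dots> = (\<Oplus>s\<in>?A. f s \<otimes> g s) \<oplus> (\<Oplus>s\<in>?A. h s \<otimes> g s)"
      by (rule finsum_addf) (auto simp: fc hc gc)
    also have "(\<Oplus>s\<in>?A. f s \<otimes> g s) = combination_form R S g f"
      by (rule combination_form_superset[symmetric]) (use A g fc hc in \<open>auto simp: free_module_ops\<close>)
    also have "(\<Oplus>s\<in>?A. h s \<otimes> g s) = combination_form R S g h"
      by (rule combination_form_superset[symmetric]) (use A g fc hc in \<open>auto simp: free_module_ops\<close>)
    finally show "combination_form R S g (f \<oplus>\<^bsub>free_module R S\<^esub> h) =
        combination_form R S g f \<oplus> combination_form R S g h" .
  }
  {
    fix a assume a: "a \<in> carrier R"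
    let ?A = "{s \<in> S. f s \<noteq> \<zero>}"
    have A: "finite ?A" using f by (simp add: free_module_carrier)
    have "combination_form R S g (a \<odot>\<^bsub>free_module R S\<^esub> f) = (\<Oplus>s\<in>?A. (a \<odot>\<^bsub>free_module R S\<^esub> f) s \<otimes> g s)"
      by (rule combination_form_superset) (use A g fc a in \<open>auto simp: free_module_ops\<close>)
    also have "\<dots> = (\<Oplus>s\<in>?A. a \<otimes> (f s \<otimes> g s))"
      by (rule finsum_cong') (auto simp: free_module_ops fc gc a m_assoc)
    also have "\<dots> = a \<otimes> combination_form R S g f"
      unfolding combination_form_def
      by (rule finsum_rdistr[symmetric]) (auto simp: fc gc a A)
    finally show "combination_form R S g (a \<odot>\<^bsub>free_module R S\<^esub> f) = a \<otimes> combination_form R S g f" .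
  }
qed

lemma (in cring) combination_form_gen:
  assumes g: "g \<in> S \<rightarrow> carrier R" and s: "s \<in> S"
  shows "combination_form R S g (free_gen R S s) = g s"
proof -
  have "combination_form R S g (free_gen R S s) = (\<Oplus>r\<in>{s}. free_gen R S s r \<otimes> g r)"
    by (rule combination_form_superset)
      (use assms in \<open>auto simp: free_gen_def sum_inj_def regular_module_def\<close>)
  also have "\<dots> = g s"
    using assms by (auto simp: free_gen_def sum_inj_def Pi_iff)
  finally show ?thesis .
qed

section \<open>Tensor products of cyclic modules\<close>

text \<open>Besides the free module of rank one this covers the zero module, with \<open>\<epsilon> = 0\<close> and \<open>u = 0\<close>.\<close>

definition cyclic_dual ::
  "('k, 'z) ring_scheme \<Rightarrow> ('k, 'm) module \<Rightarrow> ('m \<Rightarrow> 'k) \<Rightarrow> 'm \<Rightarrow> bool" where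
  "cyclic_dual K M \<epsilon> u \<longleftrightarrow> module K M \<and> linear_form K M \<epsilon> \<and> u \<in> carrier M \<and>
     (\<forall>x\<in>carrier M. \<epsilon> x \<odot>\<^bsub>M\<^esub> u = x)"

lemma cyclic_dualD:
  assumes "cyclic_dual K M \<epsilon> u"
  shows "module K M" "linear_form K M \<epsilon>" "u \<in> carrier M" "x \<in> carrier M \<Longrightarrow> \<epsilon> x \<odot>\<^bsub>M\<^esub> u = x"
    "x \<in> carrier M \<Longrightarrow> \<epsilon> x \<in> carrier K"
  using assms by (auto simp: cyclic_dual_def linear_form_def)

text \<open>The linear extension of the multilinear map that multiplies the coordinates of a
  tuple.\<close>

definition tensor_form ::
  "('k, 'z) ring_scheme \<Rightarrow> 'i set \<Rightarrow> ('i \<Rightarrow> ('k, 'm) module) \<Rightarrow> ('i \<Rightarrow> 'm \<Rightarrow> 'k) \<Rightarrow> (('i \<Rightarrow> 'm) \<Rightarrow> 'k) \<Rightarrow> 'k"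
  where "tensor_form K I M \<epsilon> =
     combination_form K (\<Pi>\<^sub>E i\<in>I. carrier (M i)) (\<lambda>v. \<Otimes>\<^bsub>K\<^esub>i\<in>I. \<epsilon> i (v i))"

text \<open>The form is constant on cosets of the tensor relations
  (\<open>tensor_relations_kernel\<close>), so its image of a tensor is a singleton.\<close>

definition tensor_coord ::
  "('k, 'z) ring_scheme \<Rightarrow> 'i set \<Rightarrow> ('i \<Rightarrow> ('k, 'm) module) \<Rightarrow> ('i \<Rightarrow> 'm \<Rightarrow> 'k) \<Rightarrow>
     (('i \<Rightarrow> 'm) \<Rightarrow> 'k) set \<Rightarrow> 'k"
  where "tensor_coord K I M \<epsilon> X = the_elem (tensor_form K I M \<epsilon> ` X)"

lemma (in cring) tensor_pre_module: "module R (tensor_pre R I M)"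
  unfolding tensor_pre_def by (rule free_module_module)

text \<open>The generating relations as membership conditions: the span becomes an intersection of
  submodules, each of which can be tested relation by relation.\<close>

definition contains_relations ::
  "('k, 'z) ring_scheme \<Rightarrow> 'i set \<Rightarrow> ('i \<Rightarrow> ('k, 'm) module) \<Rightarrow> (('i \<Rightarrow> 'm) \<Rightarrow> 'k) set \<Rightarrow> bool" where
  "contains_relations K I M N \<longleftrightarrow>
    (let F = tensor_pre K I M; V = (\<Pi>\<^sub>E i\<in>I. carrier (M i)); \<delta> = free_gen K V in
     (\<forall>v i x y. v \<in> V \<and> i \<in> I \<and> x \<in> carrier (M i) \<and> y \<in> carrier (M i) \<longrightarrow>
        \<delta> (v(i := x \<oplus>\<^bsub>M i\<^esub> y)) \<ominus>\<^bsub>F\<^esub> (\<delta> (v(i := x)) \<oplus>\<^bsub>F\<^esub> \<delta> (v(i := y))) \<in> N) \<and>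
     (\<forall>v i a x. v \<in> V \<and> i \<in> I \<and> a \<in> carrier K \<and> x \<in> carrier (M i) \<longrightarrow>
        \<delta> (v(i := a \<odot>\<^bsub>M i\<^esub> x)) \<ominus>\<^bsub>F\<^esub> a \<odot>\<^bsub>F\<^esub> \<delta> (v(i := x)) \<in> N))"

lemma tensor_relations_Inter:
  "tensor_relations K I M = \<Inter>{N. submodule N K (tensor_pre K I M) \<and> contains_relations K I M N}"
  unfolding tensor_relations_def submodule_span_def contains_relations_def Let_def Un_subset_iff
  by (intro arg_cong[where f = Inter] Collect_cong conj_cong refl) blast+

section \<open>The tensor relations as the kernel of a form\<close>

context
  fixes R (structure) and I :: "'i set" and M :: "'i \<Rightarrow> ('a, 'm) module" and \<epsilon> u
  assumes R: "cring R" and fin: "finite I" and dual: "\<And>i. i \<in> I \<Longrightarrow> cyclic_dual R (M i) (\<epsilon> i) (u i)"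
begin

interpretation cring R by (rule R)

interpretation T: module R "tensor_pre R I M" by (rule tensor_pre_module)

private abbreviation "V \<equiv> \<Pi>\<^sub>E i\<in>I. carrier (M i)"
private abbreviation "\<delta> \<equiv> free_gen R V"
private abbreviation "T \<equiv> tensor_pre R I M"

lemma product_form_closed: "v \<in> V \<Longrightarrow> (\<Otimes>i\<in>I. \<epsilon> i (v i)) \<in> carrier R"
  by (auto intro!: finprod_closed cyclic_dualD(5)[OF dual])

lemma tensor_form_linear: "linear_form R T (tensor_form R I M \<epsilon>)"
  unfolding tensor_pre_def tensor_form_def
  by (rule combination_form_linear) (use product_form_closed in auto)

lemma tensor_form_gen: "v \<in> V \<Longrightarrow> tensor_form R I M \<epsilon> (\<delta> v) = (\<Otimes>i\<in>I. \<epsilon> i (v i))"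
  unfolding tensor_form_def
  by (rule combination_form_gen) (use product_form_closed in auto)

lemma tensor_gen_closed: "\<delta> v \<in> carrier T"
  unfolding tensor_pre_def by (rule free_gen_closed)

private lemma tuple_update: "v \<in> V \<Longrightarrow> i \<in> I \<Longrightarrow> x \<in> carrier (M i) \<Longrightarrow> v(i := x) \<in> V"
  by (auto simp: PiE_iff extensional_def)

private lemma product_update:
  assumes "v \<in> V" "i \<in> I" "x \<in> carrier (M i)"
  shows "(\<Otimes>j\<in>I. \<epsilon> j ((v(i := x)) j)) = \<epsilon> i x \<otimes> (\<Otimes>j\<in>I - {i}. \<epsilon> j (v j))"
    and "(\<Otimes>j\<in>I - {i}. \<epsilon> j (v j)) \<in> carrier R"
proof -
  have c: "\<epsilon> j (v j) \<in> carrier R" if "j \<in> I" for j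
    using assms that by (auto intro: cyclic_dualD(5)[OF dual])
  show "(\<Otimes>j\<in>I - {i}. \<epsilon> j (v j)) \<in> carrier R" by (auto intro!: finprod_closed c)
  have "(\<Otimes>j\<in>I. \<epsilon> j ((v(i := x)) j)) = (\<Otimes>j\<in>insert i (I - {i}). \<epsilon> j ((v(i := x)) j))"
    using assms by (simp add: insert_absorb)
  also have "\<dots> = \<epsilon> i x \<otimes> (\<Otimes>j\<in>I - {i}. \<epsilon> j ((v(i := x)) j))"
    by (subst finprod_insert) (use fin c cyclic_dualD(5)[OF dual[OF assms(2)] assms(3)] in auto)
  also have "(\<Otimes>j\<in>I - {i}. \<epsilon> j ((v(i := x)) j)) = (\<Otimes>j\<in>I - {i}. \<epsilon> j (v j))"
    by (rule finprod_cong') (auto intro: c)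
  finally show "(\<Otimes>j\<in>I. \<epsilon> j ((v(i := x)) j)) = \<epsilon> i x \<otimes> (\<Otimes>j\<in>I - {i}. \<epsilon> j (v j))" .
qed

text \<open>Every entry is x = \<epsilon>(x) u, so the scalar relation replaces it by u at the price
  of the factor \<epsilon>(x). In the induction \<open>A\<close> is the set of entries already
  replaced.\<close>

private lemma gen_reduce:
  assumes N: "submodule N R T"
    and sm: "\<And>v i a x. v \<in> V \<Longrightarrow> i \<in> I \<Longrightarrow> a \<in> carrier R \<Longrightarrow> x \<in> carrier (M i) \<Longrightarrow>
           \<delta> (v(i := a \<odot>\<^bsub>M i\<^esub> x)) \<ominus>\<^bsub>T\<^esub> a \<odot>\<^bsub>T\<^esub> \<delta> (v(i := x)) \<in> N"
    and v: "v \<in> V"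
  shows "\<delta> v \<ominus>\<^bsub>T\<^esub> (\<Otimes>i\<in>I. \<epsilon> i (v i)) \<odot>\<^bsub>T\<^esub> \<delta> (\<lambda>i\<in>I. u i) \<in> N"
proof -
  have c: "\<epsilon> j (v j) \<in> carrier R" if "j \<in> I" for j
    using v that by (auto intro: cyclic_dualD(5)[OF dual])
  have "A \<subseteq> I \<Longrightarrow> \<delta> v \<ominus>\<^bsub>T\<^esub> (\<Otimes>i\<in>A. \<epsilon> i (v i)) \<odot>\<^bsub>T\<^esub> \<delta> (\<lambda>i\<in>I. if i \<in> A then u i else v i) \<in> N"
    if "finite A" for A
    using that
  proof (induction A rule: finite_induct)
    case empty
    have "(\<lambda>i\<in>I. if i \<in> {} then u i else v i) = v"
      using v by auto
    then show ?case
      using subgroup.one_closed[OF submodule.axioms(1)[OF N]] tensor_gen_closed[of v]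
      by (simp add: a_minus_def T.M.r_neg)
  next
    case (insert i A)
    let ?w = "\<lambda>j\<in>I. if j \<in> A then u j else v j"
    have w: "?w \<in> V" using v cyclic_dualD(3)[OF dual] by auto
    have i: "i \<in> I" and A: "A \<subseteq> I" using insert by auto
    have vi: "v i \<in> carrier (M i)" using v i by auto
    have ww: "?w(i := \<epsilon> i (v i) \<odot>\<^bsub>M i\<^esub> u i) = ?w"
      using i insert.hyps vi cyclic_dualD(4)[OF dual[OF i]] by auto
    have wu: "?w(i := u i) = (\<lambda>j\<in>I. if j \<in> insert i A then u j else v j)"
      using i by auto
    have "\<delta> ?w \<ominus>\<^bsub>T\<^esub> \<epsilon> i (v i) \<odot>\<^bsub>T\<^esub> \<delta> (\<lambda>j\<in>I. if j \<in> insert i A then u j else v j) \<in> N"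
      using sm[OF w i c[OF i] cyclic_dualD(3)[OF dual[OF i]]] unfolding ww wu .
    note chain = T.submodule_chain[OF N insert.IH[OF A] this]
    have "\<delta> v \<ominus>\<^bsub>T\<^esub> ((\<Otimes>i\<in>A. \<epsilon> i (v i)) \<otimes> \<epsilon> i (v i)) \<odot>\<^bsub>T\<^esub>
        \<delta> (\<lambda>j\<in>I. if j \<in> insert i A then u j else v j) \<in> N"
      by (rule chain) (use A i c in \<open>auto intro!: finprod_closed tensor_gen_closed\<close>)
    moreover have "(\<Otimes>i\<in>A. \<epsilon> i (v i)) \<otimes> \<epsilon> i (v i) = (\<Otimes>i\<in>insert i A. \<epsilon> i (v i))"
      using A i c insert.hyps
      by (subst finprod_insert) (auto intro!: m_comm[OF finprod_closed])
    ultimately show ?case by (simp only:)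
  qed
  from this[OF fin order_refl] show ?thesis
    by (simp cong: restrict_cong)
qed

text \<open>\<open>N\<close> is kept general because there are two uses: any submodule containing
  the relations, in \<open>tensor_relations_kernel\<close>, and the kernel of the form itself, in
  \<open>tensor_expand\<close>.\<close>

private lemma reduce:
  assumes N: "submodule N R T"
    and sm: "\<And>v i a x. v \<in> V \<Longrightarrow> i \<in> I \<Longrightarrow> a \<in> carrier R \<Longrightarrow> x \<in> carrier (M i) \<Longrightarrow>
           \<delta> (v(i := a \<odot>\<^bsub>M i\<^esub> x)) \<ominus>\<^bsub>T\<^esub> a \<odot>\<^bsub>T\<^esub> \<delta> (v(i := x)) \<in> N"
    and f: "f \<in> carrier T"
  shows "f \<ominus>\<^bsub>T\<^esub> tensor_form R I M \<epsilon> f \<odot>\<^bsub>T\<^esub> \<delta> (\<lambda>i\<in>I. u i) \<in> N"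
proof -
  have "f \<in> {f \<in> carrier T. f \<ominus>\<^bsub>T\<^esub> tensor_form R I M \<epsilon> f \<odot>\<^bsub>T\<^esub> \<delta> (\<lambda>i\<in>I. u i) \<in> N}" (is "f \<in> ?N")
  proof (rule free_module_generated)
    show "submodule ?N R (free_module R V)"
      using form_multiples_submodule[OF tensor_pre_module N tensor_form_linear tensor_gen_closed]
      by (simp add: tensor_pre_def)
    show "\<delta> v \<in> ?N" if "v \<in> V" for v
      using gen_reduce[OF N sm that] that by (simp add: tensor_gen_closed tensor_form_gen)
    show "f \<in> carrier (free_module R V)" using f by (simp add: tensor_pre_def)
  qed
  then show ?thesis by simp
qed

private lemma tensor_form_update:
  assumes "v \<in> V" "i \<in> I" "x \<in> carrier (M i)"
  shows "tensor_form R I M \<epsilon> (\<delta> (v(i := x))) = \<epsilon> i x \<otimes> (\<Otimes>j\<in>I - {i}. \<epsilon> j (v j))"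
  using tensor_form_gen[OF tuple_update[OF assms]] product_update(1)[OF assms] by (simp only:)

private lemma diff_kernel:
  assumes "f \<in> carrier T" "g \<in> carrier T" "tensor_form R I M \<epsilon> f = tensor_form R I M \<epsilon> g"
  shows "f \<ominus>\<^bsub>T\<^esub> g \<in> form_kernel R T (tensor_form R I M \<epsilon>)"
  using assms linear_formD(1)[OF tensor_form_linear assms(2)]
  by (simp add: form_kernel_def linear_form_diff[OF tensor_pre_module tensor_form_linear] r_neg
      a_minus_def[of R])

private lemma smult_relation:
  assumes v: "v \<in> V" and i: "i \<in> I" and a: "a \<in> carrier R" and x: "x \<in> carrier (M i)"
  shows "\<delta> (v(i := a \<odot>\<^bsub>M i\<^esub> x)) \<ominus>\<^bsub>T\<^esub> a \<odot>\<^bsub>T\<^esub> \<delta> (v(i := x)) \<in> form_kernel R T (tensor_form R I M \<epsilon>)"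
proof (rule diff_kernel)
  interpret Mi: module R "M i" by (rule cyclic_dualD(1)[OF dual[OF i]])
  note \<epsilon>i = linear_formD[OF cyclic_dualD(2)[OF dual[OF i]]]
  show "tensor_form R I M \<epsilon> (\<delta> (v(i := a \<odot>\<^bsub>M i\<^esub> x))) =
      tensor_form R I M \<epsilon> (a \<odot>\<^bsub>T\<^esub> \<delta> (v(i := x)))"
    unfolding linear_formD(3)[OF tensor_form_linear a tensor_gen_closed]
      tensor_form_update[OF v i x] tensor_form_update[OF v i Mi.smult_closed[OF a x]] \<epsilon>i(3)[OF a x]
    by (rule m_assoc[OF a \<epsilon>i(1)[OF x] product_update(2)[OF v i x]])
qed (use a tensor_gen_closed in auto)

private lemma add_relation:
  assumes v: "v \<in> V" and i: "i \<in> I" and x: "x \<in> carrier (M i)" and y: "y \<in> carrier (M i)"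
  shows "\<delta> (v(i := x \<oplus>\<^bsub>M i\<^esub> y)) \<ominus>\<^bsub>T\<^esub> (\<delta> (v(i := x)) \<oplus>\<^bsub>T\<^esub> \<delta> (v(i := y)))
     \<in> form_kernel R T (tensor_form R I M \<epsilon>)"
proof (rule diff_kernel)
  interpret Mi: module R "M i" by (rule cyclic_dualD(1)[OF dual[OF i]])
  note \<epsilon>i = linear_formD[OF cyclic_dualD(2)[OF dual[OF i]]]
  show "tensor_form R I M \<epsilon> (\<delta> (v(i := x \<oplus>\<^bsub>M i\<^esub> y))) =
      tensor_form R I M \<epsilon> (\<delta> (v(i := x)) \<oplus>\<^bsub>T\<^esub> \<delta> (v(i := y)))"
    unfolding linear_formD(2)[OF tensor_form_linear tensor_gen_closed tensor_gen_closed]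
      tensor_form_update[OF v i x] tensor_form_update[OF v i y]
      tensor_form_update[OF v i Mi.a_closed[OF x y]] \<epsilon>i(2)[OF x y]
    by (rule l_distr[OF \<epsilon>i(1)[OF x] \<epsilon>i(1)[OF y] product_update(2)[OF v i x]])
qed (use tensor_gen_closed in auto)

text \<open>The relations have value zero because the product of coordinates is multilinear.
  Conversely, by \<open>reduce\<close>, an element of value zero is congruent to 0 times a generator
  modulo every submodule that contains the relations.\<close>

lemma tensor_relations_kernel:
  "tensor_relations R I M = form_kernel R T (tensor_form R I M \<epsilon>)"
proof (rule antisym)
  have "contains_relations R I M (form_kernel R T (tensor_form R I M \<epsilon>))"
    unfolding contains_relations_def Let_def
    by (intro conjI allI impI; elim conjE; rule add_relation smult_relation)
  then show "tensor_relations R I M \<subseteq> form_kernel R T (tensor_form R I M \<epsilon>)"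
    unfolding tensor_relations_Inter
    using form_kernel_submodule[OF tensor_pre_module tensor_form_linear] by (intro Inter_lower CollectI conjI)
  show "form_kernel R T (tensor_form R I M \<epsilon>) \<subseteq> tensor_relations R I M"
    unfolding tensor_relations_Inter
  proof (intro Inter_greatest subsetI)
    fix N f assume "N \<in> {N. submodule N R T \<and> contains_relations R I M N}"
    then have N: "submodule N R T" and cont: "contains_relations R I M N" by blast+
    have sm: "\<delta> (v(i := a \<odot>\<^bsub>M i\<^esub> x)) \<ominus>\<^bsub>T\<^esub> a \<odot>\<^bsub>T\<^esub> \<delta> (v(i := x)) \<in> N"
      if "v \<in> V" "i \<in> I" "a \<in> carrier R" "x \<in> carrier (M i)" for v i a x
      using cont that unfolding contains_relations_def Let_def by blast
    assume "f \<in> form_kernel R T (tensor_form R I M \<epsilon>)"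
    then have f: "f \<in> carrier T" "tensor_form R I M \<epsilon> f = \<zero>" by (simp_all add: form_kernel_def)
    have "f \<ominus>\<^bsub>T\<^esub> \<zero> \<odot>\<^bsub>T\<^esub> \<delta> (\<lambda>i\<in>I. u i) \<in> N"
      using reduce[OF N sm f(1)] unfolding f(2) .
    then show "f \<in> N"
      unfolding T.smult_l_null[OF tensor_gen_closed] T.M.diff_zero[OF f(1)] .
  qed
qed

section \<open>Tensor products in terms of their coordinate\<close>

lemma tensor_module: "module R (tensor R I M)"
  unfolding tensor_def tensor_relations_kernel
  by (rule quotient_kernel_module[OF tensor_pre_module tensor_form_linear])

lemma tensor_carrier:
  "carrier (tensor R I M) =
     level_set T (tensor_form R I M \<epsilon>) ` tensor_form R I M \<epsilon> ` carrier T"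
  unfolding tensor_def tensor_relations_kernel
  by (rule quotient_kernel_carrier[OF tensor_pre_module tensor_form_linear])

lemma tensor_coord_level:
  "c \<in> tensor_form R I M \<epsilon> ` carrier T \<Longrightarrow> tensor_coord R I M \<epsilon> (level_set T (tensor_form R I M \<epsilon>) c) = c"
  unfolding tensor_coord_def
  by (rule level_set_value[OF tensor_pre_module tensor_form_linear])

lemma tensor_level_coord:
  assumes "X \<in> carrier (tensor R I M)"
  shows "X = level_set T (tensor_form R I M \<epsilon>) (tensor_coord R I M \<epsilon> X)"
    and "tensor_coord R I M \<epsilon> X \<in> tensor_form R I M \<epsilon> ` carrier T"
  using assms by (auto simp: tensor_carrier tensor_coord_level)

lemma tensor_coord_coset:
  "f \<in> carrier T \<Longrightarrow>
   tensor_coord R I M \<epsilon> (level_set T (tensor_form R I M \<epsilon>) (tensor_form R I M \<epsilon> f)) = tensor_form R I M \<epsilon> f"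
  by (rule tensor_coord_level) (rule imageI)

lemma tensor_cases:
  assumes "X \<in> carrier (tensor R I M)"
  obtains f where "f \<in> carrier T" "X = level_set T (tensor_form R I M \<epsilon>) (tensor_form R I M \<epsilon> f)"
  using assms by (auto simp: tensor_carrier)

lemma tensor_coord_linear: "linear_form R (tensor R I M) (tensor_coord R I M \<epsilon>)"
  unfolding linear_form_def
proof (intro conjI ballI funcsetI)
  note coset_ops = quotient_kernel_add[OF tensor_pre_module tensor_form_linear,
      folded tensor_relations_kernel tensor_def, OF imageI imageI]
    quotient_kernel_smult[OF tensor_pre_module tensor_form_linear,
      folded tensor_relations_kernel tensor_def, OF _ imageI]
  fix X assume X: "X \<in> carrier (tensor R I M)"
  obtain f where f: "f \<in> carrier T" and
    Xf: "X = level_set T (tensor_form R I M \<epsilon>) (tensor_form R I M \<epsilon> f)"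
    using X by (rule tensor_cases)
  show "tensor_coord R I M \<epsilon> X \<in> carrier R"
    unfolding Xf tensor_coord_coset[OF f] by (rule linear_formD(1)[OF tensor_form_linear f])
  show "tensor_coord R I M \<epsilon> (X \<oplus>\<^bsub>tensor R I M\<^esub> Y) = tensor_coord R I M \<epsilon> X \<oplus> tensor_coord R I M \<epsilon> Y"
    if Y: "Y \<in> carrier (tensor R I M)" for Y
  proof -
    obtain g where g: "g \<in> carrier T" and
      Yg: "Y = level_set T (tensor_form R I M \<epsilon>) (tensor_form R I M \<epsilon> g)"
      using Y by (rule tensor_cases)
    show ?thesis
      unfolding Xf Yg coset_ops(1)[OF f g] linear_formD(2)[OF tensor_form_linear f g, symmetric]
        tensor_coord_coset[OF f] tensor_coord_coset[OF g] tensor_coord_coset[OF T.a_closed[OF f g]] ..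
  qed
  show "tensor_coord R I M \<epsilon> (a \<odot>\<^bsub>tensor R I M\<^esub> X) = a \<otimes> tensor_coord R I M \<epsilon> X"
    if a: "a \<in> carrier R" for a
    unfolding Xf coset_ops(2)[OF a f] linear_formD(3)[OF tensor_form_linear a f, symmetric]
        tensor_coord_coset[OF f] tensor_coord_coset[OF T.smult_closed[OF a f]] ..
qed

lemma pure_tensor_level:
  "v \<in> V \<Longrightarrow> pure_tensor R I M v = level_set T (tensor_form R I M \<epsilon>) (\<Otimes>i\<in>I. \<epsilon> i (v i))"
  by (simp add: pure_tensor_def tensor_relations_kernel tensor_gen_closed tensor_form_gen
      form_kernel_coset[OF tensor_pre_module tensor_form_linear])

lemma product_form_image: "v \<in> V \<Longrightarrow> (\<Otimes>i\<in>I. \<epsilon> i (v i)) \<in> tensor_form R I M \<epsilon> ` carrier T"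
  using imageI[OF tensor_gen_closed, of "tensor_form R I M \<epsilon>" v] by (simp only: tensor_form_gen)

lemma pure_tensor_closed: "v \<in> V \<Longrightarrow> pure_tensor R I M v \<in> carrier (tensor R I M)"
  unfolding pure_tensor_level tensor_carrier by (intro imageI product_form_image)

lemma pure_tensor_coord: "v \<in> V \<Longrightarrow> tensor_coord R I M \<epsilon> (pure_tensor R I M v) = (\<Otimes>i\<in>I. \<epsilon> i (v i))"
  unfolding pure_tensor_level by (rule tensor_coord_level[OF product_form_image])

lemma tensor_eqI:
  assumes X: "X \<in> carrier (tensor R I M)" and Y: "Y \<in> carrier (tensor R I M)"
    and eq: "tensor_coord R I M \<epsilon> X = tensor_coord R I M \<epsilon> Y"
  shows "X = Y"
proof -
  have "X = level_set T (tensor_form R I M \<epsilon>) (tensor_coord R I M \<epsilon> Y)"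
    unfolding eq[symmetric] by (rule tensor_level_coord(1)[OF X])
  also have "\<dots> = Y" by (rule tensor_level_coord(1)[OF Y, symmetric])
  finally show ?thesis .
qed

text \<open>The generator need not have coordinate 1: if a factor is zero, the product of the
  \<epsilon>(u) can vanish. What has to be shown is that the coordinate of X equals itself times
  this product, and \<open>reduce\<close> applied to the kernel says so.\<close>

lemma tensor_expand:
  assumes X: "X \<in> carrier (tensor R I M)"
  shows "X = tensor_coord R I M \<epsilon> X \<odot>\<^bsub>tensor R I M\<^esub> pure_tensor R I M (\<lambda>i\<in>I. u i)"
proof (rule tensor_eqI[OF X])
  interpret Q: module R "tensor R I M" by (rule tensor_module)
  have u: "(\<lambda>i\<in>I. u i) \<in> V" using cyclic_dualD(3)[OF dual] by auto
  note cX = linear_formD(1)[OF tensor_coord_linear X]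
  show "tensor_coord R I M \<epsilon> X \<odot>\<^bsub>tensor R I M\<^esub> pure_tensor R I M (\<lambda>i\<in>I. u i) \<in> carrier (tensor R I M)"
    using cX pure_tensor_closed[OF u] by simp
  obtain f where f: "f \<in> carrier T" "tensor_coord R I M \<epsilon> X = tensor_form R I M \<epsilon> f"
    using tensor_level_coord(2)[OF X] by (elim imageE)
  note Gf = linear_formD(1)[OF tensor_form_linear f(1)]
  have "f \<ominus>\<^bsub>T\<^esub> tensor_form R I M \<epsilon> f \<odot>\<^bsub>T\<^esub> \<delta> (\<lambda>i\<in>I. u i) \<in> form_kernel R T (tensor_form R I M \<epsilon>)"
    by (rule reduce[OF form_kernel_submodule[OF tensor_pre_module tensor_form_linear] smult_relation f(1)])
  then have "tensor_form R I M \<epsilon> f \<ominus> tensor_form R I M \<epsilon> f \<otimes> (\<Otimes>i\<in>I. \<epsilon> i ((\<lambda>i\<in>I. u i) i)) = \<zero>"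
    unfolding form_kernel_def mem_Collect_eq
      linear_form_diff[OF tensor_pre_module tensor_form_linear f(1)
        T.smult_closed[OF Gf tensor_gen_closed]]
      linear_formD(3)[OF tensor_form_linear Gf tensor_gen_closed] tensor_form_gen[OF u] by (rule conjunct2)
  then have "tensor_form R I M \<epsilon> f = tensor_form R I M \<epsilon> f \<otimes> (\<Otimes>i\<in>I. \<epsilon> i ((\<lambda>i\<in>I. u i) i))"
    by (rule minus_zero_imp_eq[OF Gf m_closed[OF Gf product_form_closed[OF u]]])
  then show "tensor_coord R I M \<epsilon> X =
      tensor_coord R I M \<epsilon> (tensor_coord R I M \<epsilon> X \<odot>\<^bsub>tensor R I M\<^esub> pure_tensor R I M (\<lambda>i\<in>I. u i))"
    unfolding f(2) linear_formD(3)[OF tensor_coord_linear Gf pure_tensor_closed[OF u]]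
      pure_tensor_coord[OF u] .
qed

end

section \<open>Concatenation of tensors\<close>

lemma offset_Suc: "1 \<le> j \<Longrightarrow> offset m (Suc j) = offset m j + m j"
  by (simp add: offset_def)

lemma offset_Suc_sum: "offset m (Suc k) = (\<Sum>j=1..k. m j)"
  by (simp add: offset_def atLeastLessThanSuc_atLeastAtMost)

lemma offset_block_mono: "1 \<le> j \<Longrightarrow> j < j' \<Longrightarrow> offset m j + m j \<le> offset m j'"
proof -
  assume "1 \<le> j" "j < j'"
  then have "offset m j + m j = (\<Sum>l\<in>{1..<Suc j}. m l)" by (simp add: offset_def)
  also have "\<dots> \<le> offset m j'"
    unfolding offset_def by (rule sum_mono2) (use \<open>j < j'\<close> in auto)
  finally show ?thesis .
qed

lemma offset_block_le: "j \<in> {1..k} \<Longrightarrow> offset m j + m j \<le> (\<Sum>j=1..k. m j)"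
  using offset_block_mono[of j "Suc k" m] by (simp add: offset_Suc_sum)

lemma block_unique:
  assumes "1 \<le> j" "1 \<le> j'" "i \<in> {1..m j}" "i' \<in> {1..m j'}" "offset m j + i = offset m j' + i'"
  shows "j = j' \<and> i = i'"
  using assms offset_block_mono[of j j' m] offset_block_mono[of j' j m]
  by (cases j j' rule: linorder_cases) auto

lemma block_exists:
  "l \<in> {1..\<Sum>j=1..k. m j} \<Longrightarrow> \<exists>j\<in>{1..k}. \<exists>i\<in>{1..m j}. l = offset m j + i"
proof (induction k)
  case (Suc k)
  show ?case
  proof (cases "l \<le> (\<Sum>j=1..k. m j)")
    case True
    then show ?thesis using Suc by fastforce
  next
    case False
    then show ?thesis using Suc.prems
      by (intro bexI[of _ "Suc k"] bexI[of _ "l - offset m (Suc k)"]) (auto simp: offset_Suc_sum)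
  qed
qed simp

lemma blocks_UN: "{1..\<Sum>j=1..k. m j} = (\<Union>j\<in>{1..k}. (\<lambda>i. offset m j + i) ` {1..m j})"
proof
  show "{1..\<Sum>j=1..k. m j} \<subseteq> (\<Union>j\<in>{1..k}. (\<lambda>i. offset m j + i) ` {1..m j})"
    using block_exists by fast
  show "(\<Union>j\<in>{1..k}. (\<lambda>i. offset m j + i) ` {1..m j}) \<subseteq> {1..\<Sum>j=1..k. m j}"
  proof clarify
    fix j i assume "j \<in> {1..k}" "i \<in> {1..m j}"
    then show "offset m j + i \<in> {1..\<Sum>j=1..k. m j}"
      using offset_block_le[of j k m] by auto
  qed
qed

lemma block_mem: "j \<in> {1..k} \<Longrightarrow> i \<in> {1..m j} \<Longrightarrow> offset m j + i \<in> {1..\<Sum>j=1..k. m j}"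
  unfolding blocks_UN by blast

lemma (in comm_monoid) finprod_blocks:
  assumes "g \<in> {1..\<Sum>j=1..k. m j} \<rightarrow> carrier G"
  shows "(\<Otimes>l\<in>{1..\<Sum>j=1..k. m j}. g l) = (\<Otimes>j\<in>{1..k}. \<Otimes>i\<in>{1..m j}. g (offset m j + i))"
proof -
  have c: "g (offset m j + i) \<in> carrier G" if "j \<in> {1..k}" "i \<in> {1..m j}" for j i
    by (rule funcset_mem[OF assms block_mem[where m = m, OF that]])
  have "(\<Otimes>l\<in>{1..\<Sum>j=1..k. m j}. g l) = (\<Otimes>j\<in>{1..k}. \<Otimes>l\<in>(\<lambda>i. offset m j + i) ` {1..m j}. g l)"
    unfolding blocks_UN
  proof (rule finprod_UN_disjoint)
    show "pairwise (\<lambda>j j'. disjnt ((\<lambda>i. offset m j + i) ` {1..m j}) ((\<lambda>i. offset m j' + i) ` {1..m j'})) {1..k}"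
    proof (rule pairwiseI)
      fix j j' assume "j \<in> {1..k}" "j' \<in> {1..k}" "j \<noteq> j'"
      then show "disjnt ((\<lambda>i. offset m j + i) ` {1..m j}) ((\<lambda>i. offset m j' + i) ` {1..m j'})"
        using offset_block_mono[of j j' m] offset_block_mono[of j' j m]
        by (cases j j' rule: linorder_cases) (auto simp: disjnt_iff)
    qed
    show "g x \<in> carrier G" if "j \<in> {1..k}" "x \<in> (\<lambda>i. offset m j + i) ` {1..m j}" for j x
      using that c by blast
  qed auto
  also have "\<dots> = (\<Otimes>j\<in>{1..k}. \<Otimes>i\<in>{1..m j}. g (offset m j + i))"
  proof (rule finprod_cong')
    fix j assume j: "j \<in> {1..k}"
    show "(\<Otimes>l\<in>(\<lambda>i. offset m j + i) ` {1..m j}. g l) = (\<Otimes>i\<in>{1..m j}. g (offset m j + i))"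
      by (rule finprod_reindex) (use c[OF j] in \<open>blast, simp add: inj_on_def\<close>)
  qed (use c in \<open>auto intro!: finprod_closed\<close>)
  finally show ?thesis .
qed

text \<open>Expanding a product of sums means choosing one term per factor. It is used twice: for
  the join of tensors, where tuples are chosen, and for compositions in the free permutad, where
  summands are chosen.\<close>

lemma (in cring) finprod_finsum_distrib:
  assumes "finite A" and "\<And>a. a \<in> A \<Longrightarrow> finite (B a)"
    and "\<And>a b. a \<in> A \<Longrightarrow> b \<in> B a \<Longrightarrow> F a b \<in> carrier R"
  shows "(\<Otimes>a\<in>A. \<Oplus>b\<in>B a. F a b) = (\<Oplus>c\<in>(\<Pi>\<^sub>E a\<in>A. B a). \<Otimes>a\<in>A. F a (c a))"
  using assms
proof (induction A rule: finite_induct)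
  case empty
  then show ?case by simp
next
  case (insert x A)
  let ?ext = "\<lambda>b c. c(x := b)"
  have F: "F a b \<in> carrier R" if "a = x \<or> a \<in> A" "b \<in> B a" for a b using insert.prems that by auto
  have P: "(\<Otimes>a\<in>A. F a (c a)) \<in> carrier R" if "c \<in> PiE A B" for c
    using that by (auto intro!: finprod_closed F)
  have PiE_insert: "PiE (insert x A) B = (\<Union>b\<in>B x. ?ext b ` PiE A B)"
    by (auto simp: PiE_insert_eq)
  have fin: "finite (PiE A B)" using insert by (intro finite_PiE) auto
  have inj: "inj_on (?ext b) (PiE A B)" for b
  proof (rule inj_onI)
    fix c d assume "c \<in> PiE A B" "d \<in> PiE A B" and eq: "c(x := b) = d(x := b)"
    then show "c = d"
      using insert.hyps(2) by (intro ext) (metis PiE_arb fun_upd_other)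
  qed
  have val: "(\<Otimes>a\<in>insert x A. F a (?ext b c a)) = F x b \<otimes> (\<Otimes>a\<in>A. F a (c a))"
    if "b \<in> B x" "c \<in> PiE A B" for b c
  proof -
    have "(\<Otimes>a\<in>insert x A. F a (?ext b c a)) = F x b \<otimes> (\<Otimes>a\<in>A. F a (?ext b c a))"
      using insert.hyps that by (subst finprod_insert) (auto intro!: F)
    also have "(\<Otimes>a\<in>A. F a (?ext b c a)) = (\<Otimes>a\<in>A. F a (c a))"
      using insert.hyps that by (intro finprod_cong') (auto intro!: F)
    finally show ?thesis .
  qed
  have "(\<Oplus>c\<in>PiE (insert x A) B. \<Otimes>a\<in>insert x A. F a (c a)) =
      (\<Oplus>b\<in>B x. \<Oplus>c\<in>?ext b ` PiE A B. \<Otimes>a\<in>insert x A. F a (c a))"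
    unfolding PiE_insert
  proof (rule add.finprod_UN_disjoint)
    show "pairwise (\<lambda>i j. disjnt (?ext i ` PiE A B) (?ext j ` PiE A B)) (B x)"
    proof (rule pairwiseI)
      fix i j assume "i \<in> B x" "j \<in> B x" "i \<noteq> j"
      then show "disjnt (?ext i ` PiE A B) (?ext j ` PiE A B)"
        by (auto simp: disjnt_def dest: fun_cong[of _ _ x])
    qed
  qed (use insert fin val P F in auto)
  also have "\<dots> = (\<Oplus>b\<in>B x. F x b \<otimes> (\<Oplus>c\<in>PiE A B. \<Otimes>a\<in>A. F a (c a)))"
  proof (rule finsum_cong')
    fix b assume b: "b \<in> B x"
    have "(\<Oplus>c\<in>?ext b ` PiE A B. \<Otimes>a\<in>insert x A. F a (c a)) =
        (\<Oplus>c\<in>PiE A B. \<Otimes>a\<in>insert x A. F a (?ext b c a))"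
      by (rule finsum_reindex[OF _ inj]) (use b val P F in auto)
    also have "\<dots> = (\<Oplus>c\<in>PiE A B. F x b \<otimes> (\<Otimes>a\<in>A. F a (c a)))"
      by (rule finsum_cong') (use b val P F in auto)
    also have "\<dots> = F x b \<otimes> (\<Oplus>c\<in>PiE A B. \<Otimes>a\<in>A. F a (c a))"
      by (rule finsum_rdistr[symmetric]) (use b P F fin in auto)
    finally show "(\<Oplus>c\<in>?ext b ` PiE A B. \<Otimes>a\<in>insert x A. F a (c a)) =
        F x b \<otimes> (\<Oplus>c\<in>PiE A B. \<Otimes>a\<in>A. F a (c a))" .
  qed (use P F in \<open>auto intro!: finsum_closed\<close>)
  also have "\<dots> = (\<Oplus>b\<in>B x. F x b) \<otimes> (\<Oplus>c\<in>PiE A B. \<Otimes>a\<in>A. F a (c a))"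
    by (rule finsum_ldistr[symmetric]) (use P F insert in \<open>auto intro!: finsum_closed\<close>)
  also have "\<dots> = (\<Otimes>a\<in>insert x A. \<Oplus>b\<in>B a. F a b)"
    using insert F by (subst finprod_insert) (auto intro!: finsum_closed)
  finally show ?case by simp
qed

section \<open>Cutting tuples into blocks, and the join of tensors\<close>

definition tuple_block :: "(nat \<Rightarrow> nat) \<Rightarrow> nat \<Rightarrow> (nat \<Rightarrow> 'm) \<Rightarrow> (nat \<Rightarrow> 'm)" where
  "tuple_block m j v = (\<lambda>i\<in>{1..m j}. v (offset m j + i))"

lemma tuple_blocks_bij:
  "bij_betw (\<lambda>v. \<lambda>j\<in>{1..k}. tuple_block m j v)
     (\<Pi>\<^sub>E l\<in>{1..\<Sum>j=1..k. m j}. A l)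
     (\<Pi>\<^sub>E j\<in>{1..k}. \<Pi>\<^sub>E i\<in>{1..m j}. A (offset m j + i))"
proof (rule bij_betw_imageI)
  show "inj_on (\<lambda>v. \<lambda>j\<in>{1..k}. tuple_block m j v) (\<Pi>\<^sub>E l\<in>{1..\<Sum>j=1..k. m j}. A l)"
  proof (rule inj_onI)
    fix v w assume v: "v \<in> (\<Pi>\<^sub>E l\<in>{1..\<Sum>j=1..k. m j}. A l)" and w: "w \<in> (\<Pi>\<^sub>E l\<in>{1..\<Sum>j=1..k. m j}. A l)"
      and eq: "(\<lambda>j\<in>{1..k}. tuple_block m j v) = (\<lambda>j\<in>{1..k}. tuple_block m j w)"
    show "v = w"
    proof (rule PiE_ext[OF v w])
      fix l assume "l \<in> {1..\<Sum>j=1..k. m j}"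
      then obtain j i where ji: "j \<in> {1..k}" "i \<in> {1..m j}" "l = offset m j + i"
        using block_exists by blast
      then have "tuple_block m j v i = tuple_block m j w i"
        using fun_cong[OF eq, of j] by simp
      then show "v l = w l" using ji by (simp add: tuple_block_def)
    qed
  qed
  show "(\<lambda>v. \<lambda>j\<in>{1..k}. tuple_block m j v) ` (\<Pi>\<^sub>E l\<in>{1..\<Sum>j=1..k. m j}. A l) =
     (\<Pi>\<^sub>E j\<in>{1..k}. \<Pi>\<^sub>E i\<in>{1..m j}. A (offset m j + i))"
  proof
    show "(\<lambda>v. \<lambda>j\<in>{1..k}. tuple_block m j v) ` (\<Pi>\<^sub>E l\<in>{1..\<Sum>j=1..k. m j}. A l)
      \<subseteq> (\<Pi>\<^sub>E j\<in>{1..k}. \<Pi>\<^sub>E i\<in>{1..m j}. A (offset m j + i))"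
    proof (rule image_subsetI)
      fix v assume v: "v \<in> (\<Pi>\<^sub>E l\<in>{1..\<Sum>j=1..k. m j}. A l)"
      have "v (offset m j + i) \<in> A (offset m j + i)" if "j \<in> {1..k}" "i \<in> {1..m j}" for j i
        by (rule PiE_mem[OF v block_mem[where m = m, OF that]])
      then show "(\<lambda>j\<in>{1..k}. tuple_block m j v) \<in> (\<Pi>\<^sub>E j\<in>{1..k}. \<Pi>\<^sub>E i\<in>{1..m j}. A (offset m j + i))"
        unfolding tuple_block_def restrict_PiE_iff by blast
    qed
    show "(\<Pi>\<^sub>E j\<in>{1..k}. \<Pi>\<^sub>E i\<in>{1..m j}. A (offset m j + i))
       \<subseteq> (\<lambda>v. \<lambda>j\<in>{1..k}. tuple_block m j v) ` (\<Pi>\<^sub>E l\<in>{1..\<Sum>j=1..k. m j}. A l)"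
    proof
      fix c assume c: "c \<in> (\<Pi>\<^sub>E j\<in>{1..k}. \<Pi>\<^sub>E i\<in>{1..m j}. A (offset m j + i))"
      \<comment> \<open>\<open>pr\<close> recovers block and position from a place in the long
        tuple. By \<open>block_unique\<close> the description determines the pair, so a family
        \<open>c\<close> of short tuples can be glued together.\<close>
      define pr where "pr l = (SOME p. fst p \<in> {1..k} \<and> snd p \<in> {1..m (fst p)} \<and> l = offset m (fst p) + snd p)" for l
      have pr: "pr (offset m j + i) = (j, i)" if "j \<in> {1..k}" "i \<in> {1..m j}" for j i
        unfolding pr_def
      proof (rule some_equality)
        fix p assume "fst p \<in> {1..k} \<and> snd p \<in> {1..m (fst p)} \<and> offset m j + i = offset m (fst p) + snd p"
        then have "fst p = j \<and> snd p = i"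
          using that by (intro block_unique[where m = m]) auto
        then show "p = (j, i)" by (simp add: prod_eq_iff)
      qed (use that in simp)
      define v where "v = (\<lambda>l\<in>{1..\<Sum>j=1..k. m j}. c (fst (pr l)) (snd (pr l)))"
      have val: "v (offset m j + i) = c j i" if "j \<in> {1..k}" "i \<in> {1..m j}" for j i
        using block_mem[where m = m, OF that] pr[OF that] by (simp add: v_def)
      have "v l \<in> A l" if l: "l \<in> {1..\<Sum>j=1..k. m j}" for l
      proof -
        obtain j i where ji: "j \<in> {1..k}" "i \<in> {1..m j}" "l = offset m j + i"
          using block_exists[OF l] by blast
        show ?thesis
          using PiE_mem[OF PiE_mem[OF c ji(1)] ji(2)] unfolding ji(3) val[OF ji(1,2)] .
      qed
      then have "v \<in> (\<Pi>\<^sub>E l\<in>{1..\<Sum>j=1..k. m j}. A l)"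
        by (auto simp: v_def)
      moreover have "(\<lambda>j\<in>{1..k}. tuple_block m j v) = c"
      proof
        fix j
        show "(\<lambda>j\<in>{1..k}. tuple_block m j v) j = c j"
        proof (cases "j \<in> {1..k}")
          case True
          then have "c j \<in> (\<Pi>\<^sub>E i\<in>{1..m j}. A (offset m j + i))" using c by (rule PiE_mem[rotated])
          then have "tuple_block m j v = c j"
            using val[OF True] by (intro ext) (auto simp: tuple_block_def PiE_iff extensional_def)
          then show ?thesis using True by simp
        next
          case False
          then show ?thesis using c by (auto simp: PiE_iff extensional_def)
        qed
      qed
      ultimately show "c \<in> (\<lambda>v. \<lambda>j\<in>{1..k}. tuple_block m j v) ` (\<Pi>\<^sub>E l\<in>{1..\<Sum>j=1..k. m j}. A l)"
        by blast
    qed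
  qed
qed

lemma (in cring) finprod_zero:
  assumes "finite A" "a \<in> A" "f a = \<zero>" "f \<in> A \<rightarrow> carrier R"
  shows "(\<Otimes>x\<in>A. f x) = \<zero>"
proof -
  have "(\<Otimes>x\<in>A. f x) = (\<Otimes>x\<in>insert a (A - {a}). f x)" using assms by (simp add: insert_absorb)
  also have "\<dots> = f a \<otimes> (\<Otimes>x\<in>A - {a}. f x)"
    using assms by (subst finprod_insert) auto
  also have "\<dots> = \<zero>" using assms by (simp add: Pi_def)
  finally show ?thesis .
qed

text \<open>The coefficient of a join at a long tuple is the product of the coefficients at its
  blocks, and the product of coordinates factors over the blocks too. Distributivity then makes the
  value of the join the product of the values, so all representatives give the same coset.
  \<open>M\<close> and \<open>e\<close> are tied to \<open>N\<close> and \<open>\<epsilon>\<close>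
  only inside the blocks, which is where the decorations of the pieces and of the substituted
  surjection correspond.\<close>

lemma (in cring)
  fixes N :: "nat \<Rightarrow> ('a, 'm) module"
  assumes dual: "\<And>l. l \<in> {1..\<Sum>j=1..k. m j} \<Longrightarrow> cyclic_dual R (N l) (\<epsilon> l) (u l)"
    and MN: "\<And>j i. j \<in> {1..k} \<Longrightarrow> i \<in> {1..m j} \<Longrightarrow> M j i = N (offset m j + i)"
    and e: "\<And>j i. j \<in> {1..k} \<Longrightarrow> i \<in> {1..m j} \<Longrightarrow> e j i = \<epsilon> (offset m j + i)"
    and X: "\<And>j. j \<in> {1..k} \<Longrightarrow> X j \<in> carrier (tensor R {1..m j} (M j))"
  shows tensor_join_closed: "tensor_join R k m N X \<in> carrier (tensor R {1..\<Sum>j=1..k. m j} N)"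
    and tensor_join_coord: "tensor_coord R {1..\<Sum>j=1..k. m j} N \<epsilon> (tensor_join R k m N X) =
      (\<Otimes>j\<in>{1..k}. tensor_coord R {1..m j} (M j) (e j) (X j))"
proof -
  define L where "L = (\<Sum>j=1..k. m j)"
  define V where "V = (\<Pi>\<^sub>E l\<in>{1..L}. carrier (N l))"
  define W where "W j = (\<Pi>\<^sub>E i\<in>{1..m j}. carrier (M j i))" for j
  define g where "g j w = (\<Otimes>i\<in>{1..m j}. e j i (w i))" for j w
  define G where "G j = tensor_form R {1..m j} (M j) (e j)" for j
  define c where "c j = tensor_coord R {1..m j} (M j) (e j) (X j)" for j
  have dualL: "cyclic_dual R (N l) (\<epsilon> l) (u l)" if "l \<in> {1..L}" for l
    by (rule dual) (use that L_def in simp)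
  have dual': "cyclic_dual R (M j i) (e j i) (u (offset m j + i))"
    if "j \<in> {1..k}" "i \<in> {1..m j}" for j i
    unfolding MN[OF that] e[OF that] by (rule dual[OF block_mem[where m = m, OF that]])
  have Gdef: "G j = combination_form R (W j) (g j)" for j
    by (simp add: G_def tensor_form_def W_def g_def[abs_def])
  have gc: "g j w \<in> carrier R" if "j \<in> {1..k}" "w \<in> W j" for j w
    unfolding g_def
    by (rule product_form_closed[OF is_cring finite_atLeastAtMost dual'[OF that(1)] that(2)[unfolded W_def]])
  have Xc: "X j = level_set (tensor_pre R {1..m j} (M j)) (G j) (c j)" if "j \<in> {1..k}" for j
    unfolding c_def G_def
    by (rule tensor_level_coord(1)[OF is_cring finite_atLeastAtMost dual'[OF that] X[OF that]])
  have cimg: "c j \<in> G j ` carrier (tensor_pre R {1..m j} (M j))" if "j \<in> {1..k}" for j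
    unfolding c_def G_def
    by (rule tensor_level_coord(2)[OF is_cring finite_atLeastAtMost dual'[OF that] X[OF that]])
  have Vbij: "bij_betw (\<lambda>v. \<lambda>j\<in>{1..k}. tuple_block m j v) V (\<Pi>\<^sub>E j\<in>{1..k}. W j)"
  proof -
    have "(\<Pi>\<^sub>E j\<in>{1..k}. W j) = (\<Pi>\<^sub>E j\<in>{1..k}. \<Pi>\<^sub>E i\<in>{1..m j}. carrier (N (offset m j + i)))"
      unfolding W_def by (intro PiE_cong) (simp only: MN)
    then show ?thesis
      using tuple_blocks_bij[where m = m and k = k and A = "\<lambda>l. carrier (N l)"]
      by (simp add: V_def L_def)
  qed
  have block: "tuple_block m j v \<in> W j" if "v \<in> V" "j \<in> {1..k}" for v j
  proof -
    have "(\<lambda>j\<in>{1..k}. tuple_block m j v) \<in> (\<Pi>\<^sub>E j\<in>{1..k}. W j)"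
      using bij_betw_apply[OF Vbij that(1)] .
    from PiE_mem[OF this that(2)] show ?thesis using that(2) by simp
  qed
  have \<epsilon>c: "\<epsilon> l (v l) \<in> carrier R" if "v \<in> V" "l \<in> {1..L}" for v l
    by (rule cyclic_dualD(5)[OF dualL[OF that(2)]]) (use that in \<open>auto simp: V_def\<close>)
  have prodV: "(\<Otimes>l\<in>{1..L}. \<epsilon> l (v l)) = (\<Otimes>j\<in>{1..k}. g j (tuple_block m j v))" if v: "v \<in> V" for v
  proof -
    have "(\<Otimes>l\<in>{1..L}. \<epsilon> l (v l)) = (\<Otimes>j\<in>{1..k}. \<Otimes>i\<in>{1..m j}. \<epsilon> (offset m j + i) (v (offset m j + i)))"
      unfolding L_def by (rule finprod_blocks) (use \<epsilon>c[OF v] L_def in simp)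
    also have "\<dots> = (\<Otimes>j\<in>{1..k}. g j (tuple_block m j v))"
    proof (rule finprod_cong')
      fix j assume j: "j \<in> {1..k}"
      show "(\<Otimes>i\<in>{1..m j}. \<epsilon> (offset m j + i) (v (offset m j + i))) = g j (tuple_block m j v)"
        unfolding g_def
      proof (rule finprod_cong')
        show "(\<lambda>i. e j i (tuple_block m j v i)) \<in> {1..m j} \<rightarrow> carrier R"
          using block_mem[where m = m, OF j] \<epsilon>c[OF v, unfolded L_def] e[OF j] by (simp add: tuple_block_def)
      qed (simp_all add: tuple_block_def e[OF j])
    qed (use gc block[OF v] in auto)
    finally show ?thesis .
  qed
  define F where "F f = (\<lambda>v\<in>V. \<Otimes>j\<in>{1..k}. f j (tuple_block m j v))" for f :: "nat \<Rightarrow> (nat \<Rightarrow> 'm) \<Rightarrow> 'a"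
  have key: "F f \<in> carrier (tensor_pre R {1..L} N) \<and>
      tensor_form R {1..L} N \<epsilon> (F f) = (\<Otimes>j\<in>{1..k}. c j)"
    if f: "f \<in> (\<Pi>\<^sub>E j\<in>{1..k}. X j)" for f
  proof -
    have fX: "f j \<in> carrier (free_module R (W j))" "G j (f j) = c j" if "j \<in> {1..k}" for j
      using PiE_mem[OF f that] unfolding Xc[OF that] by (simp_all add: level_set_def tensor_pre_def W_def)
    define S where "S j = {w \<in> W j. f j w \<noteq> \<zero>}" for j
    have Sfin: "finite (S j)" if "j \<in> {1..k}" for j
      using fX(1)[OF that] by (simp add: free_module_carrier S_def)
    have fc: "f j w \<in> carrier R" if "j \<in> {1..k}" "w \<in> W j" for j w
      using fX(1)[OF that(1)] that(2) by (auto simp: free_module_carrier)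
    have Fc: "F f \<in> V \<rightarrow>\<^sub>E carrier R"
      unfolding F_def by (rule restrict_PiE_iff[THEN iffD2]) (use fc block in \<open>auto intro!: finprod_closed\<close>)
    \<comment> \<open>\<open>B\<close> is the set of long tuples with every block in the support of
      its factor. With zero divisors it can exceed the support of \<open>F f\<close>, but it is
      finite and, unlike that support, in bijection with the product of the supports.\<close>
    define B where "B = {v \<in> V. \<forall>j\<in>{1..k}. tuple_block m j v \<in> S j}"
    have Bbij: "bij_betw (\<lambda>v. \<lambda>j\<in>{1..k}. tuple_block m j v) B (\<Pi>\<^sub>E j\<in>{1..k}. S j)"
    proof (rule bij_betw_imageI)
      show "inj_on (\<lambda>v. \<lambda>j\<in>{1..k}. tuple_block m j v) B"
        by (rule inj_on_subset[OF bij_betw_imp_inj_on[OF Vbij]]) (simp add: B_def)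
      show "(\<lambda>v. \<lambda>j\<in>{1..k}. tuple_block m j v) ` B = (\<Pi>\<^sub>E j\<in>{1..k}. S j)"
      proof
        show "(\<lambda>v. \<lambda>j\<in>{1..k}. tuple_block m j v) ` B \<subseteq> (\<Pi>\<^sub>E j\<in>{1..k}. S j)"
          by (rule image_subsetI) (simp add: B_def)
        show "(\<Pi>\<^sub>E j\<in>{1..k}. S j) \<subseteq> (\<lambda>v. \<lambda>j\<in>{1..k}. tuple_block m j v) ` B"
        proof
          fix d assume d: "d \<in> (\<Pi>\<^sub>E j\<in>{1..k}. S j)"
          then have "d \<in> (\<Pi>\<^sub>E j\<in>{1..k}. W j)"
            by (rule subsetD[OF PiE_mono, rotated]) (simp add: S_def)
          then obtain v where v: "v \<in> V" "d = (\<lambda>j\<in>{1..k}. tuple_block m j v)"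
            using bij_betw_imp_surj_on[OF Vbij] by blast
          have "tuple_block m j v \<in> S j" if "j \<in> {1..k}" for j
            using PiE_mem[OF d that] that by (simp add: v(2))
          then show "d \<in> (\<lambda>v. \<lambda>j\<in>{1..k}. tuple_block m j v) ` B"
            using v by (auto simp: B_def)
        qed
      qed
    qed
    have Bfin: "finite B"
      unfolding bij_betw_finite[OF Bbij] by (rule finite_PiE) (use Sfin in auto)
    have supp: "{v \<in> V. F f v \<noteq> \<zero>} \<subseteq> B"
    proof clarify
      fix v assume v: "v \<in> V" and "F f v \<noteq> \<zero>"
      then have nz: "(\<Otimes>j\<in>{1..k}. f j (tuple_block m j v)) \<noteq> \<zero>" by (simp add: F_def)
      have "f j (tuple_block m j v) \<noteq> \<zero>" if "j \<in> {1..k}" for j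
      proof
        assume "f j (tuple_block m j v) = \<zero>"
        then have "(\<Otimes>j\<in>{1..k}. f j (tuple_block m j v)) = \<zero>"
          by (intro finprod_zero[OF _ that]) (use fc block[OF v] in auto)
        with nz show False ..
      qed
      then show "v \<in> B" using v block[OF v] by (simp add: B_def S_def)
    qed
    have "tensor_form R {1..L} N \<epsilon> (F f) = (\<Oplus>v\<in>B. F f v \<otimes> (\<Otimes>l\<in>{1..L}. \<epsilon> l (v l)))"
      unfolding tensor_form_def V_def[symmetric]
      by (rule combination_form_superset[OF Bfin _ supp])
        (use Fc \<epsilon>c in \<open>auto simp: B_def PiE_def intro!: finprod_closed\<close>)
    also have "\<dots> = (\<Oplus>v\<in>B. \<Otimes>j\<in>{1..k}. f j ((\<lambda>j\<in>{1..k}. tuple_block m j v) j) \<otimes>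
        g j ((\<lambda>j\<in>{1..k}. tuple_block m j v) j))"
    proof (rule finsum_cong')
      fix v assume "v \<in> B"
      then have v: "v \<in> V" by (simp add: B_def)
      have "F f v \<otimes> (\<Otimes>l\<in>{1..L}. \<epsilon> l (v l)) =
          (\<Otimes>j\<in>{1..k}. f j (tuple_block m j v)) \<otimes> (\<Otimes>j\<in>{1..k}. g j (tuple_block m j v))"
        unfolding prodV[OF v] using v by (simp add: F_def)
      also have "\<dots> = (\<Otimes>j\<in>{1..k}. f j (tuple_block m j v) \<otimes> g j (tuple_block m j v))"
        by (rule finprod_multf[symmetric]) (use fc gc block[OF v] in auto)
      also have "\<dots> = (\<Otimes>j\<in>{1..k}. f j ((\<lambda>j\<in>{1..k}. tuple_block m j v) j) \<otimes>
          g j ((\<lambda>j\<in>{1..k}. tuple_block m j v) j))"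
        by (rule finprod_cong') (use fc gc block[OF v] in auto)
      finally show "F f v \<otimes> (\<Otimes>l\<in>{1..L}. \<epsilon> l (v l)) = (\<Otimes>j\<in>{1..k}. f j ((\<lambda>j\<in>{1..k}. tuple_block m j v) j) \<otimes>
          g j ((\<lambda>j\<in>{1..k}. tuple_block m j v) j))" .
    qed (use fc gc block in \<open>auto simp: B_def intro!: finprod_closed\<close>)
    also have "\<dots> = (\<Oplus>d\<in>(\<lambda>v. \<lambda>j\<in>{1..k}. tuple_block m j v) ` B. \<Otimes>j\<in>{1..k}. f j (d j) \<otimes> g j (d j))"
      by (rule finsum_reindex[symmetric, OF _ bij_betw_imp_inj_on[OF Bbij]])
        (use fc gc block in \<open>auto simp: B_def intro!: finprod_closed\<close>)
    also have "\<dots> = (\<Otimes>j\<in>{1..k}. \<Oplus>w\<in>S j. f j w \<otimes> g j w)"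
      unfolding bij_betw_imp_surj_on[OF Bbij]
      by (rule finprod_finsum_distrib[symmetric]) (use fc gc Sfin in \<open>auto simp: S_def\<close>)
    also have "\<dots> = (\<Otimes>j\<in>{1..k}. c j)"
    proof (rule finprod_cong')
      fix j assume "j \<in> {1..k}"
      then show "(\<Oplus>w\<in>S j. f j w \<otimes> g j w) = c j"
        using fX(2)[of j] by (simp add: Gdef combination_form_def S_def)
    next
      show "c \<in> {1..k} \<rightarrow> carrier R"
      proof
        fix j assume j: "j \<in> {1..k}"
        have "(\<Oplus>w\<in>S j. f j w \<otimes> g j w) \<in> carrier R"
          by (rule finsum_closed) (use fc gc j in \<open>auto simp: S_def\<close>)
        then show "c j \<in> carrier R"
          using fX(2)[OF j] by (simp add: Gdef combination_form_def S_def)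
      qed
    qed simp
    finally have "tensor_form R {1..L} N \<epsilon> (F f) = (\<Otimes>j\<in>{1..k}. c j)" .
    moreover have "F f \<in> carrier (tensor_pre R {1..L} N)"
      unfolding tensor_pre_def V_def[symmetric] free_module_carrier
      using Fc finite_subset[OF supp Bfin] by blast
    ultimately show ?thesis by blast
  qed
  \<comment> \<open>Without representatives the union defining the join would be empty instead of a
    coset.\<close>
  have X_nonempty: "X j \<noteq> {}" if "j \<in> {1..k}" for j
    using cimg[OF that] unfolding Xc[OF that] by (auto simp: level_set_def)
  then have ne: "(\<Pi>\<^sub>E j\<in>{1..k}. X j) \<noteq> {}" by (simp add: PiE_eq_empty_iff)
  have rel: "tensor_relations R {1..L} N = form_kernel R (tensor_pre R {1..L} N) (tensor_form R {1..L} N \<epsilon>)"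
    by (rule tensor_relations_kernel[OF is_cring finite_atLeastAtMost dualL])
  have lin: "linear_form R (tensor_pre R {1..L} N) (tensor_form R {1..L} N \<epsilon>)"
    by (rule tensor_form_linear[OF is_cring finite_atLeastAtMost dualL])
  have coset: "tensor_relations R {1..L} N +>\<^bsub>tensor_pre R {1..L} N\<^esub> F f =
      level_set (tensor_pre R {1..L} N) (tensor_form R {1..L} N \<epsilon>) (\<Otimes>j\<in>{1..k}. c j)"
    if "f \<in> (\<Pi>\<^sub>E j\<in>{1..k}. X j)" for f
    unfolding rel form_kernel_coset[OF tensor_pre_module lin conjunct1[OF key[OF that]]]
      conjunct2[OF key[OF that]] ..
  have "tensor_join R k m N X = (\<Union>f\<in>(\<Pi>\<^sub>E j\<in>{1..k}. X j).
      tensor_relations R {1..L} N +>\<^bsub>tensor_pre R {1..L} N\<^esub> F f)"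
    unfolding tensor_join_def Let_def F_def V_def L_def tuple_block_def ..
  also have "\<dots> = (\<Union>f\<in>(\<Pi>\<^sub>E j\<in>{1..k}. X j).
      level_set (tensor_pre R {1..L} N) (tensor_form R {1..L} N \<epsilon>) (\<Otimes>j\<in>{1..k}. c j))"
    using coset by (rule SUP_cong[OF refl])
  also have "\<dots> = level_set (tensor_pre R {1..L} N) (tensor_form R {1..L} N \<epsilon>) (\<Otimes>j\<in>{1..k}. c j)"
    using ne by (rule UN_constant[THEN trans, OF if_not_P])
  finally have join: "tensor_join R k m N X =
    level_set (tensor_pre R {1..L} N) (tensor_form R {1..L} N \<epsilon>) (\<Otimes>j\<in>{1..k}. c j)" .
  obtain f where f: "f \<in> (\<Pi>\<^sub>E j\<in>{1..k}. X j)" using ne by blast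
  have img: "(\<Otimes>j\<in>{1..k}. c j) \<in> tensor_form R {1..L} N \<epsilon> ` carrier (tensor_pre R {1..L} N)"
    using key[OF f] by (metis imageI)
  show "tensor_join R k m N X \<in> carrier (tensor R {1..\<Sum>j=1..k. m j} N)"
    unfolding L_def[symmetric] join
    by (subst tensor_carrier[OF is_cring finite_atLeastAtMost dualL]) (assumption, rule imageI[OF img])
  show "tensor_coord R {1..\<Sum>j=1..k. m j} N \<epsilon> (tensor_join R k m N X) =
      (\<Otimes>j\<in>{1..k}. tensor_coord R {1..m j} (M j) (e j) (X j))"
    unfolding L_def[symmetric] join c_def[symmetric]
    by (rule tensor_coord_level[OF is_cring finite_atLeastAtMost dualL img])
qed

section \<open>Surjections, substitution and inversions\<close>

lemma SurD:
  assumes "t \<in> Sur n k"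
  shows "a \<in> {1..n} \<Longrightarrow> t a \<in> {1..k}" and "t ` {1..n} = {1..k}" and "t \<in> extensional {1..n}"
  using assms by (auto simp: Sur_def PiE_iff)

definition fiber_pos :: "nat \<Rightarrow> (nat \<Rightarrow> nat) \<Rightarrow> nat \<Rightarrow> nat" where
  "fiber_pos n t a = card {a' \<in> {1..n}. t a' = t a \<and> a' \<le> a}"

lemma surj_subst_apply:
  "a \<in> {1..n} \<Longrightarrow> surj_subst n t m ts a = offset m (t a) + ts (t a) (fiber_pos n t a)"
  by (simp add: surj_subst_def fiber_pos_def)

lemma fiber_pos_mono:
  assumes "b \<in> {1..n}" "t a = t b" "a < b"
  shows "fiber_pos n t a < fiber_pos n t b"
  unfolding fiber_pos_def
proof (rule psubset_card_mono)
  show "{a' \<in> {1..n}. t a' = t a \<and> a' \<le> a} \<subset> {a' \<in> {1..n}. t a' = t b \<and> a' \<le> b}"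
  proof
    show "{a' \<in> {1..n}. t a' = t a \<and> a' \<le> a} \<subseteq> {a' \<in> {1..n}. t a' = t b \<and> a' \<le> b}"
      using assms by auto
    have "b \<in> {a' \<in> {1..n}. t a' = t b \<and> a' \<le> b}" "b \<notin> {a' \<in> {1..n}. t a' = t a \<and> a' \<le> a}"
      using assms by auto
    then show "{a' \<in> {1..n}. t a' = t a \<and> a' \<le> a} \<noteq> {a' \<in> {1..n}. t a' = t b \<and> a' \<le> b}" by blast
  qed
qed simp

lemma fiber_pos_less_iff:
  assumes "a \<in> {1..n}" "b \<in> {1..n}" "t a = t b"
  shows "fiber_pos n t a < fiber_pos n t b \<longleftrightarrow> a < b"
  using assms fiber_pos_mono[of b n t a] fiber_pos_mono[of a n t b]
  by (cases a b rule: linorder_cases) auto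

lemma fiber_pos_bij: "bij_betw (fiber_pos n t) {a \<in> {1..n}. t a = j} {1..fiber_card n t j}"
proof (rule bij_betw_imageI)
  show inj: "inj_on (fiber_pos n t) {a \<in> {1..n}. t a = j}"
  proof (rule inj_onI)
    fix a b assume "a \<in> {a \<in> {1..n}. t a = j}" "b \<in> {a \<in> {1..n}. t a = j}"
      "fiber_pos n t a = fiber_pos n t b"
    then show "a = b"
      using fiber_pos_mono[of b n t a] fiber_pos_mono[of a n t b]
      by (cases a b rule: linorder_cases) auto
  qed
  have sub: "fiber_pos n t ` {a \<in> {1..n}. t a = j} \<subseteq> {1..fiber_card n t j}"
  proof (rule image_subsetI)
    fix a assume a: "a \<in> {a \<in> {1..n}. t a = j}"
    have "fiber_pos n t a \<le> fiber_card n t j"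
      unfolding fiber_pos_def fiber_card_def by (rule card_mono) (use a in auto)
    moreover have "0 < fiber_pos n t a"
      unfolding fiber_pos_def card_gt_0_iff using a by auto
    ultimately show "fiber_pos n t a \<in> {1..fiber_card n t j}" by simp
  qed
  show "fiber_pos n t ` {a \<in> {1..n}. t a = j} = {1..fiber_card n t j}"
    by (rule card_subset_eq[OF _ sub]) (simp, simp only: card_image[OF inj] fiber_card_def card_atLeastAtMost diff_Suc_1)
qed

lemma fiber_pos_mem:
  "a \<in> {1..n} \<Longrightarrow> fiber_pos n t a \<in> {1..fiber_card n t (t a)}"
  using bij_betw_apply[OF fiber_pos_bij[of n t "t a"], of a] by simp

context
  fixes n k :: nat and t m ts
  assumes t: "t \<in> Sur n k" and ts: "\<And>j. j \<in> {1..k} \<Longrightarrow> ts j \<in> Sur (fiber_card n t j) (m j)"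
begin

lemma subst_block:
  assumes a: "a \<in> {1..n}"
  shows "t a \<in> {1..k}" "ts (t a) (fiber_pos n t a) \<in> {1..m (t a)}"
proof -
  show ta: "t a \<in> {1..k}" by (rule SurD(1)[OF t a])
  show "ts (t a) (fiber_pos n t a) \<in> {1..m (t a)}"
    by (rule SurD(1)[OF ts[OF ta] fiber_pos_mem[OF a]])
qed

lemma surj_subst_eq_iff:
  assumes a: "a \<in> {1..n}" and j: "j \<in> {1..k}" and i: "i \<in> {1..m j}"
  shows "surj_subst n t m ts a = offset m j + i \<longleftrightarrow> t a = j \<and> ts j (fiber_pos n t a) = i"
proof
  assume "surj_subst n t m ts a = offset m j + i"
  then have "offset m (t a) + ts (t a) (fiber_pos n t a) = offset m j + i"
    unfolding surj_subst_apply[OF a] .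
  then have "t a = j \<and> ts (t a) (fiber_pos n t a) = i"
    using subst_block[OF a] j i by (intro block_unique[where m = m]) auto
  then show "t a = j \<and> ts j (fiber_pos n t a) = i" by auto
qed (simp add: surj_subst_apply[OF a])

lemma surj_subst_Sur: "surj_subst n t m ts \<in> Sur n (\<Sum>j=1..k. m j)"
proof -
  have mem: "surj_subst n t m ts a \<in> {1..\<Sum>j=1..k. m j}" if "a \<in> {1..n}" for a
    unfolding surj_subst_apply[OF that] by (rule block_mem[where m = m, OF subst_block[OF that]])
  have "{1..\<Sum>j=1..k. m j} \<subseteq> surj_subst n t m ts ` {1..n}"
  proof
    fix l assume "l \<in> {1..\<Sum>j=1..k. m j}"
    then obtain j i where ji: "j \<in> {1..k}" "i \<in> {1..m j}" "l = offset m j + i"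
      using block_exists by blast
    have "i \<in> ts j ` {1..fiber_card n t j}"
      unfolding SurD(2)[OF ts[OF ji(1)]] by (rule ji(2))
    then obtain b where b: "b \<in> {1..fiber_card n t j}" "ts j b = i" by blast
    have "b \<in> fiber_pos n t ` {a \<in> {1..n}. t a = j}"
      unfolding bij_betw_imp_surj_on[OF fiber_pos_bij] by (rule b(1))
    then obtain a where a: "a \<in> {1..n}" "t a = j" "fiber_pos n t a = b" by blast
    have "surj_subst n t m ts a = l"
      unfolding ji(3) surj_subst_eq_iff[OF a(1) ji(1,2)] a(2,3) using b(2) by simp
    then show "l \<in> surj_subst n t m ts ` {1..n}" using a(1) by blast
  qed
  moreover have "surj_subst n t m ts ` {1..n} \<subseteq> {1..\<Sum>j=1..k. m j}" using mem by blast
  moreover have "surj_subst n t m ts \<in> extensional {1..n}" by (simp add: surj_subst_def)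
  ultimately show ?thesis using mem by (simp add: Sur_def PiE_iff)
qed

text \<open>\<open>fiber_pos\<close> carries the fiber of the substituted surjection over level i of
  block j to the fiber of \<open>ts j\<close> over i. Hence the arities of the decorations agree
  under substitution.\<close>

lemma surj_subst_fiber_card:
  assumes j: "j \<in> {1..k}" and i: "i \<in> {1..m j}"
  shows "fiber_card n (surj_subst n t m ts) (offset m j + i) = fiber_card (fiber_card n t j) (ts j) i"
proof -
  have "bij_betw (fiber_pos n t) {a \<in> {1..n}. surj_subst n t m ts a = offset m j + i}
      {b \<in> {1..fiber_card n t j}. ts j b = i}"
  proof (rule bij_betw_imageI)
    have sub: "{a \<in> {1..n}. surj_subst n t m ts a = offset m j + i} \<subseteq> {a \<in> {1..n}. t a = j}"
      using surj_subst_eq_iff[OF _ j i] by blast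
    show "inj_on (fiber_pos n t) {a \<in> {1..n}. surj_subst n t m ts a = offset m j + i}"
      by (rule inj_on_subset[OF bij_betw_imp_inj_on[OF fiber_pos_bij] sub])
    show "fiber_pos n t ` {a \<in> {1..n}. surj_subst n t m ts a = offset m j + i} =
        {b \<in> {1..fiber_card n t j}. ts j b = i}"
    proof
      show "fiber_pos n t ` {a \<in> {1..n}. surj_subst n t m ts a = offset m j + i} \<subseteq>
        {b \<in> {1..fiber_card n t j}. ts j b = i}"
        using surj_subst_eq_iff[OF _ j i] fiber_pos_mem[of _ n t] by blast
      show "{b \<in> {1..fiber_card n t j}. ts j b = i} \<subseteq>
        fiber_pos n t ` {a \<in> {1..n}. surj_subst n t m ts a = offset m j + i}"
      proof
        fix b assume b: "b \<in> {b \<in> {1..fiber_card n t j}. ts j b = i}"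
        then have "b \<in> fiber_pos n t ` {a \<in> {1..n}. t a = j}"
          unfolding bij_betw_imp_surj_on[OF fiber_pos_bij] by blast
        then obtain a where "a \<in> {1..n}" "t a = j" "fiber_pos n t a = b" by blast
        then show "b \<in> fiber_pos n t ` {a \<in> {1..n}. surj_subst n t m ts a = offset m j + i}"
          using surj_subst_eq_iff[OF _ j i, of a] b by blast
      qed
    qed
  qed
  then show ?thesis unfolding fiber_card_def[of n "surj_subst n t m ts"] fiber_card_def[of "fiber_card n t j"]
    by (rule bij_betw_same_card)
qed

end

section \<open>Inversions\<close>

definition inversions :: "nat \<Rightarrow> (nat \<Rightarrow> nat) \<Rightarrow> (nat \<times> nat) set" where
  "inversions n t = {(a, b). a \<in> {1..n} \<and> b \<in> {1..n} \<and> a < b \<and> t b < t a}"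

lemma finite_inversions: "finite (inversions n t)"
  by (rule finite_subset[of _ "{1..n} \<times> {1..n}"]) (auto simp: inversions_def)

text \<open>Two positions in different fibers of \<open>t\<close> are ordered as by
  \<open>t\<close>, because blocks of levels follow each other in the order of their index. Two
  positions in the fiber over j are ordered as by \<open>ts j\<close>, because
  \<open>fiber_pos\<close> is increasing on it; the sets \<open>A j\<close> in the proof collect
  these inversions.\<close>

lemma inversions_subst:
  assumes t: "t \<in> Sur n k" and ts: "\<And>j. j \<in> {1..k} \<Longrightarrow> ts j \<in> Sur (fiber_card n t j) (m j)"
  shows "card (inversions n (surj_subst n t m ts)) =
    card (inversions n t) + (\<Sum>j=1..k. card (inversions (fiber_card n t j) (ts j)))"
proof -
  let ?s = "surj_subst n t m ts"
  define A where "A j = {(a, b). a \<in> {1..n} \<and> b \<in> {1..n} \<and> a < b \<and> t a = j \<and> t b = j \<and>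
     ts j (fiber_pos n t b) < ts j (fiber_pos n t a)}" for j
  have blk: "t a \<in> {1..k}" "ts (t a) (fiber_pos n t a) \<in> {1..m (t a)}" if "a \<in> {1..n}" for a
    using subst_block[where m = m and ts = ts, OF t ts] that by blast+
  have less: "?s b < ?s a \<longleftrightarrow> t b < t a \<or> t a = t b \<and>
      ts (t a) (fiber_pos n t b) < ts (t a) (fiber_pos n t a)"
    if "a \<in> {1..n}" "b \<in> {1..n}" for a b
    using blk[OF that(1)] blk[OF that(2)] offset_block_mono[of "t a" "t b" m] offset_block_mono[of "t b" "t a" m]
    unfolding surj_subst_apply[OF that(1)] surj_subst_apply[OF that(2)]
    by (cases "t a" "t b" rule: linorder_cases) auto
  have Afin: "finite (A j)" for j
    by (rule finite_subset[of _ "{1..n} \<times> {1..n}"]) (auto simp: A_def)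
  have "(a, b) \<in> inversions n ?s \<longleftrightarrow> (a, b) \<in> inversions n t \<union> (\<Union>j\<in>{1..k}. A j)" for a b
  proof (cases "a \<in> {1..n} \<and> b \<in> {1..n} \<and> a < b")
    case True
    then have ab: "a \<in> {1..n}" "b \<in> {1..n}" "a < b" by blast+
    have "(a, b) \<in> A j \<longleftrightarrow> j = t a \<and> t a = t b \<and>
        ts (t a) (fiber_pos n t b) < ts (t a) (fiber_pos n t a)" for j
      using ab unfolding A_def by auto
    then have "(a, b) \<in> (\<Union>j\<in>{1..k}. A j) \<longleftrightarrow> t a = t b \<and>
        ts (t a) (fiber_pos n t b) < ts (t a) (fiber_pos n t a)"
      using blk(1)[OF ab(1)] by simp
    moreover have "(a, b) \<in> inversions n r \<longleftrightarrow> r b < r a" for r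
      using ab unfolding inversions_def by simp
    ultimately show ?thesis
      by (simp only: Un_iff less[OF ab(1,2)])
  next
    case False
    then show ?thesis unfolding inversions_def A_def by blast
  qed
  then have split: "inversions n ?s = inversions n t \<union> (\<Union>j\<in>{1..k}. A j)"
    by (simp only: set_eq_iff split_paired_All) blast
  have cardA: "card (A j) = card (inversions (fiber_card n t j) (ts j))" for j
  proof (rule bij_betw_same_card)
    show "bij_betw (map_prod (fiber_pos n t) (fiber_pos n t)) (A j) (inversions (fiber_card n t j) (ts j))"
    proof (rule bij_betw_imageI)
      show "inj_on (map_prod (fiber_pos n t) (fiber_pos n t)) (A j)"
        by (rule inj_on_subset[OF map_prod_inj_on[OF bij_betw_imp_inj_on[OF fiber_pos_bij[of n t j]]
            bij_betw_imp_inj_on[OF fiber_pos_bij[of n t j]]]])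
          (auto simp: A_def)
      show "map_prod (fiber_pos n t) (fiber_pos n t) ` A j = inversions (fiber_card n t j) (ts j)"
      proof
        show "map_prod (fiber_pos n t) (fiber_pos n t) ` A j \<subseteq> inversions (fiber_card n t j) (ts j)"
        proof (rule image_subsetI, unfold split_paired_all)
          fix a b assume "(a, b) \<in> A j"
          then have ab: "a \<in> {1..n}" "b \<in> {1..n}" "a < b" "t a = j" "t b = j"
             "ts j (fiber_pos n t b) < ts j (fiber_pos n t a)" by (auto simp: A_def)
          have "(fiber_pos n t a, fiber_pos n t b) \<in> inversions (fiber_card n t j) (ts j)"
            using ab fiber_pos_mem[OF ab(1), of t] fiber_pos_mem[OF ab(2), of t] fiber_pos_mono[of b n t a]
            by (simp add: inversions_def)
          then show "map_prod (fiber_pos n t) (fiber_pos n t) (a, b) \<in> inversions (fiber_card n t j) (ts j)"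
            by (simp only: map_prod_simp)
        qed
        show "inversions (fiber_card n t j) (ts j) \<subseteq> map_prod (fiber_pos n t) (fiber_pos n t) ` A j"
        proof (rule subsetI, unfold split_paired_all)
          fix c d assume "(c, d) \<in> inversions (fiber_card n t j) (ts j)"
          then have cd: "c \<in> {1..fiber_card n t j}" "d \<in> {1..fiber_card n t j}" "c < d" "ts j d < ts j c"
            by (auto simp: inversions_def)
          have "c \<in> fiber_pos n t ` {a \<in> {1..n}. t a = j}" "d \<in> fiber_pos n t ` {a \<in> {1..n}. t a = j}"
            unfolding bij_betw_imp_surj_on[OF fiber_pos_bij] by (rule cd(1), rule cd(2))
          then obtain a b where a: "a \<in> {1..n}" "t a = j" "fiber_pos n t a = c"
            and b: "b \<in> {1..n}" "t b = j" "fiber_pos n t b = d" by blast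
          have "a < b" using fiber_pos_less_iff[OF a(1) b(1), of t] a b cd(3) by simp
          then have "(a, b) \<in> A j" using a b cd by (simp add: A_def)
          then show "(c, d) \<in> map_prod (fiber_pos n t) (fiber_pos n t) ` A j"
            using a b by (intro image_eqI[of _ _ "(a, b)"]) auto
        qed
      qed
    qed
  qed
  have "card (inversions n ?s) = card (inversions n t) + card (\<Union>j\<in>{1..k}. A j)"
    unfolding split
    by (rule card_Un_disjoint) (auto simp: finite_inversions Afin, auto simp: inversions_def A_def)
  also have "card (\<Union>j\<in>{1..k}. A j) = (\<Sum>j=1..k. card (A j))"
    by (rule card_UN_disjoint) (auto simp: Afin, auto simp: A_def)
  finally show ?thesis unfolding cardA .
qed

lemma as_surj_Sur: "\<sigma> permutes {1..n} \<Longrightarrow> as_surj n \<sigma> \<in> Sur n n"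
  unfolding as_surj_def Sur_def using permutes_image[of \<sigma> "{1..n}"]
  by (auto simp: permutes_in_image simp del: atLeastAtMost_iff)

lemma corolla_Sur: "1 \<le> n \<Longrightarrow> corolla n \<in> Sur n 1"
  unfolding corolla_def Sur_def by auto

lemma Sur_inj_on: "s \<in> Sur n n \<Longrightarrow> inj_on s {1..n}"
  using SurD(2)[of s n n] by (intro eq_card_imp_inj_on) simp_all

lemma inversions_cong: "(\<And>a. a \<in> {1..n} \<Longrightarrow> s a = t a) \<Longrightarrow> inversions n s = inversions n t"
  unfolding inversions_def by auto

lemma inversions_restrict: "inversions n (restrict s {1..n}) = inversions n s"
  by (rule inversions_cong) simp

lemma inversions_id: "inversions n id = {}"
  by (auto simp: inversions_def)

lemma inversions_as_surj: "inversions n (as_surj n \<sigma>) = inversions n \<sigma>"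
  unfolding as_surj_def by (rule inversions_restrict)

section \<open>Merging two adjacent levels\<close>

definition merge_levels :: "nat \<Rightarrow> nat \<Rightarrow> (nat \<Rightarrow> nat) \<Rightarrow> nat \<Rightarrow> nat" where
  "merge_levels n j s = (\<lambda>x\<in>{1..n}. if s x \<le> j then s x else s x - 1)"

text \<open>These are at once the fiber sizes of the merged surjection and the numbers of levels put
  into the fibers, since only bijections are substituted.\<close>

definition block_sizes :: "nat \<Rightarrow> nat \<Rightarrow> nat" where
  "block_sizes j l = (if l = j then 2 else 1)"

definition block_perms :: "nat \<Rightarrow> (nat \<Rightarrow> nat) \<Rightarrow> nat \<Rightarrow> (nat \<Rightarrow> nat)" where
  "block_perms j p l = (if l = j then p else corolla 1)"

text \<open>A descent \<open>s a = j + 1\<close>, \<open>s b = j\<close> with \<open>a < b\<close> lets one factor \<open>s\<close> through the surjection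
  identifying \<open>j\<close> with \<open>j + 1\<close>; substituting the identity instead of the transposition then
  removes this descent.\<close>

context
  fixes n j a b :: nat and s :: "nat \<Rightarrow> nat"
  assumes s: "s \<in> Sur n n" and j: "j \<in> {1..<n}" and a: "a \<in> {1..n}" and b: "b \<in> {1..n}"
    and ab: "a < b" and sa: "s a = Suc j" and sb: "s b = j"
begin

private lemma eqs: "x \<in> {1..n} \<Longrightarrow> s x = Suc j \<longleftrightarrow> x = a" "x \<in> {1..n} \<Longrightarrow> s x = j \<longleftrightarrow> x = b"
  using inj_on_eq_iff[OF Sur_inj_on[OF s] _ a, of x] inj_on_eq_iff[OF Sur_inj_on[OF s] _ b, of x]
  unfolding sa sb by blast+

private lemma fiber_s: "v \<in> {1..n} \<Longrightarrow> card {x \<in> {1..n}. s x = v} = 1"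
proof -
  assume "v \<in> {1..n}"
  then have "v \<in> s ` {1..n}" by (simp only: SurD(2)[OF s])
  then obtain x where x: "x \<in> {1..n}" "v = s x" by (elim imageE)
  then have "{y \<in> {1..n}. s y = v} = {x}"
    using inj_on_eq_iff[OF Sur_inj_on[OF s] _ x(1)] by blast
  then show ?thesis by simp
qed

private abbreviation "t \<equiv> merge_levels n j s"
private abbreviation "m \<equiv> block_sizes j"

private lemma s_range: "x \<in> {1..n} \<Longrightarrow> 1 \<le> s x \<and> s x \<le> n"
  using SurD(1)[OF s, of x] by simp

private lemma fibers_t: "{x \<in> {1..n}. t x = l} =
   (if l = j then {a, b} else if l < j then {x \<in> {1..n}. s x = l} else {x \<in> {1..n}. s x = Suc l})"
  if l: "l \<in> {1..n-1}"
proof -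
  have key: "t x = l \<longleftrightarrow> (if l = j then x = a \<or> x = b else if l < j then s x = l else s x = Suc l)"
    if x: "x \<in> {1..n}" for x
    using eqs[OF x] s_range[OF x] x l j unfolding merge_levels_def by auto
  have "{x \<in> {1..n}. t x = l} = {x \<in> {1..n}. if l = j then x = a \<or> x = b else if l < j then s x = l else s x = Suc l}"
    by (intro Collect_cong conj_cong refl) (rule key)
  also have "\<dots> = (if l = j then {a, b} else if l < j then {x \<in> {1..n}. s x = l} else {x \<in> {1..n}. s x = Suc l})"
    using a b by auto
  finally show ?thesis .
qed

lemma merge_fiber_card: "l \<in> {1..n-1} \<Longrightarrow> fiber_card n t l = block_sizes j l"
  unfolding fiber_card_def block_sizes_def using ab fiber_s[of l] fiber_s[of "Suc l"]
  by (subst fibers_t) auto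

lemma merge_Sur: "t \<in> Sur n (n - 1)"
proof -
  have mem: "t x \<in> {1..n-1}" if "x \<in> {1..n}" for x
    using that s_range[OF that] j unfolding merge_levels_def by auto
  have "{1..n-1} \<subseteq> t ` {1..n}"
  proof
    fix l assume l: "l \<in> {1..n-1}"
    have "fiber_card n t l \<noteq> 0" using merge_fiber_card[OF l] by (simp add: block_sizes_def)
    then have "{x \<in> {1..n}. t x = l} \<noteq> {}" unfolding fiber_card_def by (metis card.empty)
    then show "l \<in> t ` {1..n}" by auto
  qed
  moreover have "t ` {1..n} \<subseteq> {1..n-1}" using mem by blast
  moreover have "t \<in> extensional {1..n}" by (simp add: merge_levels_def)
  ultimately show ?thesis using mem by (simp add: Sur_def PiE_iff)
qed

text \<open>The block of length 2 at j shifts all later blocks by one, which restores the 1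
  subtracted in \<open>merge_levels\<close>.\<close>

private lemma offset_m: "1 \<le> l \<Longrightarrow> offset m l = (if l \<le> j then l - 1 else l)"
proof (induction l rule: nat_induct_at_least)
  case base
  then show ?case using j by (simp add: offset_def)
next
  case (Suc l)
  then show ?case using j by (auto simp: offset_Suc block_sizes_def)
qed

lemma merge_sizes: "(\<Sum>l=1..n-1. block_sizes j l) = n"
  using offset_m[of n] offset_Suc_sum[of m "n - 1"] j by simp

lemma block_perms_Sur:
  assumes "p \<in> Sur 2 2" "l \<in> {1..n-1}"
  shows "block_perms j p l \<in> Sur (fiber_card n t l) (block_sizes j l)"
  unfolding merge_fiber_card[OF assms(2)] using assms(1) corolla_Sur[of 1]
  by (simp add: block_perms_def block_sizes_def)

text \<open>Here \<open>a < b\<close> enters: in the merged fiber \<open>a\<close> comes first and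
  \<open>b\<close> second, so a substituted \<open>p\<close> acts on \<open>a\<close> by
  \<open>p 1\<close> and on \<open>b\<close> by \<open>p 2\<close>.\<close>

private lemma pos_a: "fiber_pos n t a = 1"
proof -
  have "{x \<in> {1..n}. t x = t a \<and> x \<le> a} = {x \<in> {1..n}. t x = j} \<inter> {..a}"
    using a sa by (auto simp: merge_levels_def)
  also have "\<dots> = {a}" using j ab by (subst fibers_t) auto
  finally show ?thesis by (simp add: fiber_pos_def)
qed

private lemma pos_b: "fiber_pos n t b = 2"
proof -
  have "{x \<in> {1..n}. t x = t b \<and> x \<le> b} = {x \<in> {1..n}. t x = j} \<inter> {..b}"
    using b sb by (auto simp: merge_levels_def)
  also have "\<dots> = {a, b}" using j ab by (subst fibers_t) auto
  finally show ?thesis using ab by (simp add: fiber_pos_def)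
qed

private lemma pos_other:
  assumes x: "x \<in> {1..n}" and "x \<noteq> a" "x \<noteq> b"
  shows "fiber_pos n t x = 1" "t x \<noteq> j"
proof -
  show tx: "t x \<noteq> j"
    using assms eqs[OF x] s_range[OF x] by (auto simp: merge_levels_def)
  have "t x \<in> {1..n-1}" by (rule SurD(1)[OF merge_Sur x])
  from merge_fiber_card[OF this] tx have "fiber_card n t (t x) = 1" by (simp add: block_sizes_def)
  then show "fiber_pos n t x = 1" using fiber_pos_mem[OF x, of t] by simp
qed

text \<open>The hypotheses say that \<open>p\<close> permutes 1 and 2. The block of j starts after
  offset j - 1, whence the levels j - 1 + \<open>p 1\<close> and j - 1 + \<open>p 2\<close>; all
  other elements are alone in their fiber and recover their old level.\<close>

lemma merge_subst:
  assumes p: "p 1 \<in> {1,2}" "p 2 = 3 - p 1"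
  shows "surj_subst n t m (block_perms j p) = (\<lambda>x\<in>{1..n}. if x = a then j + p 1 - 1 else if x = b then j + p 2 - 1 else s x)"
proof
  fix x
  show "surj_subst n t m (block_perms j p) x = (\<lambda>x\<in>{1..n}. if x = a then j + p 1 - 1 else if x = b then j + p 2 - 1 else s x) x"
  proof (cases "x \<in> {1..n}")
    case False
    then show ?thesis by (simp only: surj_subst_def restrict_apply if_False)
  next
    case True
    have ta: "t a = j" and tb: "t b = j" using a b sa sb by (auto simp: merge_levels_def)
    have oj: "offset m j = j - 1" using j by (simp add: offset_m)
    consider "x = a" | "x = b" | "x \<noteq> a" "x \<noteq> b" by blast
    then show ?thesis
    proof cases
      case 1
      then show ?thesis
        using True pos_a j p ta oj by (simp add: surj_subst_apply block_perms_def)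
    next
      case 2
      then show ?thesis
        using True pos_b j p ta tb oj ab by (simp add: surj_subst_apply block_perms_def)
    next
      case 3
      have tx: "t x \<in> {1..n-1}" by (rule SurD(1)[OF merge_Sur True])
      have "offset m (t x) + 1 = s x"
        using True 3 pos_other(2)[OF True 3] eqs[OF True] s_range[OF True] offset_m[of "t x"] tx
        by (auto simp: merge_levels_def split: if_splits)
      then show ?thesis
        using True 3 pos_other[OF True 3] by (simp add: surj_subst_apply block_perms_def corolla_def)
    qed
  qed
qed

lemma merge_subst_transpose:
  "surj_subst n t m (block_perms j (as_surj 2 (transpose 1 2))) = s"
proof -
  have "surj_subst n t m (block_perms j (as_surj 2 (transpose 1 2))) =
    (\<lambda>x\<in>{1..n}. if x = a then j + 2 - 1 else if x = b then j + 1 - 1 else s x)"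
    by (subst merge_subst) (auto simp: as_surj_def)
  also have "\<dots> = s"
    using SurD(3)[OF s] sa sb by (auto simp: fun_eq_iff extensional_def)
  finally show ?thesis .
qed

lemma merge_subst_id:
  "surj_subst n t m (block_perms j (as_surj 2 id)) = (\<lambda>x\<in>{1..n}. transpose j (Suc j) (s x))"
proof -
  have "surj_subst n t m (block_perms j (as_surj 2 id)) =
    (\<lambda>x\<in>{1..n}. if x = a then j + 1 - 1 else if x = b then j + 2 - 1 else s x)"
    by (subst merge_subst) (auto simp: as_surj_def)
  also have "\<dots> = (\<lambda>x\<in>{1..n}. transpose j (Suc j) (s x))"
    using eqs sa sb by (auto simp: fun_eq_iff transpose_def)
  finally show ?thesis .
qed

private lemma inversions_merge:
  assumes "p \<in> Sur 2 2"
  shows "card (inversions n (surj_subst n t m (block_perms j p))) = card (inversions n t) + card (inversions 2 p)"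
proof -
  have "(\<Sum>l=1..n-1. card (inversions (fiber_card n t l) (block_perms j p l))) =
      (\<Sum>l=1..n-1. if l = j then card (inversions 2 p) else 0)"
  proof (rule sum.cong[OF refl])
    fix l assume l: "l \<in> {1..n-1}"
    have "inversions 1 f = {}" for f by (auto simp: inversions_def)
    then show "card (inversions (fiber_card n t l) (block_perms j p l)) = (if l = j then card (inversions 2 p) else 0)"
      unfolding merge_fiber_card[OF l] by (simp add: block_perms_def block_sizes_def)
  qed
  also have "\<dots> = card (inversions 2 p)"
  proof -
    have "j \<in> {1..n-1}" using j by auto
    then show ?thesis by (simp only: sum.delta finite_atLeastAtMost if_True)
  qed
  finally show ?thesis
    using inversions_subst[OF merge_Sur block_perms_Sur[OF assms]] by simp
qed

text \<open>\<open>s\<close> and its modification arise from the same merged surjection by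
  substituting the transposition and the identity, so by additivity they differ by the single
  inversion of the transposition.\<close>

lemma descent_inversions:
  "card (inversions n s) = Suc (card (inversions n (\<lambda>x\<in>{1..n}. transpose j (Suc j) (s x))))"
proof -
  have "inversions 2 (as_surj 2 (transpose 1 2)) = {(1, 2)}"
    unfolding as_surj_def inversions_restrict by (auto simp: inversions_def transpose_def)
  then have "card (inversions 2 (as_surj 2 (transpose 1 2))) = 1" by simp
  moreover have "as_surj 2 (transpose 1 2) \<in> Sur 2 2"
    by (rule as_surj_Sur, rule permutes_swap_id) auto
  moreover have "as_surj 2 id \<in> Sur 2 2"
    by (rule as_surj_Sur, rule permutes_id)
  ultimately show ?thesis
    using inversions_merge[of "as_surj 2 (transpose 1 2)"] inversions_merge[of "as_surj 2 id"]
    unfolding merge_subst_transpose merge_subst_id inversions_as_surj[of 2 id] inversions_id by simp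
qed

end

section \<open>Descents and the Coxeter length\<close>

lemma descent_exists:
  assumes s: "s \<in> Sur n n" and "s \<noteq> as_surj n id"
  obtains j a b where "j \<in> {1..<n}" "a \<in> {1..n}" "b \<in> {1..n}" "a < b" "s a = Suc j" "s b = j"
proof (rule ccontr)
  assume none: "\<not> thesis"
  note found = that
  define r where "r = inv_into {1..n} s"
  have r: "r v \<in> {1..n}" "s (r v) = v" if "v \<in> {1..n}" for v
    using that SurD(2)[OF s] inv_into_into[of v s "{1..n}"] f_inv_into_f[of v s "{1..n}"]
    unfolding r_def by simp_all
  \<comment> \<open>Without a descent the inverse \<open>r\<close> of \<open>s\<close> is strictly
    increasing on 1, ..., n, and an increasing self-map of an interval is squeezed onto the identity
    from both sides.\<close>
  have step: "r j < r (Suc j)" if j: "j \<in> {1..<n}" for j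
  proof -
    have j1: "j \<in> {1..n}" "Suc j \<in> {1..n}" using j by auto
    have "r j \<noteq> r (Suc j)" using r(2)[OF j1(1)] r(2)[OF j1(2)] by auto
    moreover have "\<not> r (Suc j) < r j"
      using found[OF j r(1)[OF j1(2)] r(1)[OF j1(1)] _ r(2)[OF j1(2)] r(2)[OF j1(1)]] none by blast
    ultimately show ?thesis by simp
  qed
  have lower: "v \<le> r v" if "1 \<le> v" "v \<le> n" for v
    using that
  proof (induction v rule: nat_induct_at_least)
    case base
    then show ?case using r(1)[of 1] by simp
  next
    case (Suc v)
    then show ?case using step[of v] by simp
  qed
  \<comment> \<open>Induction from the top of the interval, with d the distance from n.\<close>
  have upper: "r (n - d) \<le> n - d" if "d < n" for d
    using that
  proof (induction d)
    case 0
    then show ?case using r(1)[of n] by simp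
  next
    case (Suc d)
    have "n - Suc d \<in> {1..<n}" using Suc.prems by auto
    then have "r (n - Suc d) < r (n - d)" using step Suc.prems Suc_diff_Suc[of d n] by fastforce
    moreover have "r (n - d) \<le> n - d" using Suc by simp
    ultimately show ?case by linarith
  qed
  have "s x = as_surj n id x" for x
  proof (cases "x \<in> {1..n}")
    case True
    then have "r x = x" using lower[of x] upper[of "n - x"] by simp
    then show ?thesis using r(2)[OF True] True by (simp add: as_surj_def)
  next
    case False
    then show ?thesis using extensional_arb[OF SurD(3)[OF s] False]
      by (simp only: as_surj_def restrict_apply if_False)
  qed
  then show False using assms(2) by blast
qed

text \<open>Exactly one of the two permutations has j + 1 to the left of j, and
  \<open>descent_inversions\<close> applied to that one shows that the counts differ by one.\<close>

lemma inversions_transpose_le: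
  assumes \<sigma>: "\<sigma> permutes {1..n}" and j: "j \<in> {1..<n}"
  shows "card (inversions n (transpose j (Suc j) \<circ> \<sigma>)) \<le> Suc (card (inversions n \<sigma>))"
proof -
  let ?\<tau> = "transpose j (Suc j) \<circ> \<sigma>"
  have \<tau>: "?\<tau> permutes {1..n}"
    by (rule permutes_compose[OF \<sigma>], rule permutes_swap_id) (use j in auto)
  define a where "a = inv_into UNIV \<sigma> (Suc j)"
  define b where "b = inv_into UNIV \<sigma> j"
  have \<sigma>ab: "\<sigma> a = Suc j" "\<sigma> b = j"
    unfolding a_def b_def by (simp_all add: permutes_inverses[OF \<sigma>])
  have mem: "a \<in> {1..n}" "b \<in> {1..n}"
    unfolding a_def b_def permutes_in_image[OF permutes_inv[OF \<sigma>]] using j by auto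
  consider "a < b" | "b < a" using \<sigma>ab by (cases a b rule: linorder_cases) auto
  then show ?thesis
  proof cases
    case 1
    have "card (inversions n (as_surj n \<sigma>)) =
        Suc (card (inversions n (\<lambda>x\<in>{1..n}. transpose j (Suc j) (as_surj n \<sigma> x))))"
      by (rule descent_inversions[OF as_surj_Sur[OF \<sigma>] j mem 1])
        (use \<sigma>ab mem in \<open>auto simp: as_surj_def\<close>)
    moreover have "inversions n (\<lambda>x\<in>{1..n}. transpose j (Suc j) (as_surj n \<sigma> x)) = inversions n ?\<tau>"
      by (rule inversions_cong) (simp add: as_surj_def)
    moreover have "inversions n (as_surj n \<sigma>) = inversions n \<sigma>"
      by (rule inversions_as_surj)
    ultimately show ?thesis by simp
  next
    case 2
    have "card (inversions n (as_surj n ?\<tau>)) =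
        Suc (card (inversions n (\<lambda>x\<in>{1..n}. transpose j (Suc j) (as_surj n ?\<tau> x))))"
      by (rule descent_inversions[OF as_surj_Sur[OF \<tau>] j mem(2,1) 2])
        (use \<sigma>ab mem in \<open>auto simp: as_surj_def\<close>)
    moreover have "inversions n (\<lambda>x\<in>{1..n}. transpose j (Suc j) (as_surj n ?\<tau> x)) = inversions n \<sigma>"
      by (rule inversions_cong) (simp add: as_surj_def)
    moreover have "inversions n (as_surj n ?\<tau>) = inversions n ?\<tau>"
      by (rule inversions_as_surj)
    ultimately show ?thesis by simp
  qed
qed

text \<open>Each letter creates at most one inversion, which bounds the length of every word from
  below.\<close>

lemma word_inversions_le:
  assumes "set is \<subseteq> {1..<n}"
  shows "foldr (\<circ>) (map (\<lambda>i. transpose i (Suc i)) is) id permutes {1..n} \<and>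
    card (inversions n (foldr (\<circ>) (map (\<lambda>i. transpose i (Suc i)) is) id)) \<le> length is"
  using assms
proof (induction "is")
  case Nil
  have word: "foldr (\<circ>) (map (\<lambda>i. transpose i (Suc i)) []) id = (id :: nat \<Rightarrow> nat)" by simp
  show ?case unfolding word inversions_id by (intro conjI permutes_id) simp
next
  case (Cons i "is")
  let ?\<tau> = "foldr (\<circ>) (map (\<lambda>i. transpose i (Suc i)) is) id"
  have i: "i \<in> {1..<n}" and "set is \<subseteq> {1..<n}" using Cons.prems by simp_all
  then have \<tau>: "?\<tau> permutes {1..n}" "card (inversions n ?\<tau>) \<le> length is"
    using Cons.IH by (blast, blast)
  have word: "foldr (\<circ>) (map (\<lambda>i. transpose i (Suc i)) (i # is)) id = transpose i (Suc i) \<circ> ?\<tau>"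
    by (simp only: list.map foldr.simps o_apply)
  have "transpose i (Suc i) \<circ> ?\<tau> permutes {1..n}"
    by (rule permutes_compose[OF \<tau>(1)], rule permutes_swap_id) (use i in auto)
  then show ?case using inversions_transpose_le[OF \<tau>(1) i] \<tau>(2) unfolding word list.size by linarith
qed

text \<open>Sorting by removal of descents: each removal uses up one inversion and contributes one
  letter, so the bound of \<open>word_inversions_le\<close> is attained.\<close>

lemma inversions_word:
  assumes "\<sigma> permutes {1..n}"
  shows "\<exists>is. length is = card (inversions n \<sigma>) \<and> set is \<subseteq> {1..<n} \<and>
       \<sigma> = foldr (\<circ>) (map (\<lambda>i. transpose i (Suc i)) is) id"
  using assms
proof (induction "card (inversions n \<sigma>)" arbitrary: \<sigma> rule: less_induct)
  case less
  show ?case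
  proof (cases "as_surj n \<sigma> = as_surj n id")
    case True
    have "\<sigma> x = x" for x
    proof (cases "x \<in> {1..n}")
      case x: True
      then show ?thesis using fun_cong[OF True, of x] by (simp add: as_surj_def)
    qed (use permutes_not_in[OF less.prems] in blast)
    then have "\<sigma> = id" by auto
    moreover from this have "card (inversions n \<sigma>) = 0" by (simp only: inversions_id card.empty)
    ultimately show ?thesis by (intro exI[of _ "[]"]) simp
  next
    case False
    obtain j a b where j: "j \<in> {1..<n}" and d: "a \<in> {1..n}" "b \<in> {1..n}" "a < b"
      "as_surj n \<sigma> a = Suc j" "as_surj n \<sigma> b = j"
      using descent_exists[OF as_surj_Sur[OF less.prems] False] .
    let ?\<tau> = "transpose j (Suc j) \<circ> \<sigma>"
    have \<tau>: "?\<tau> permutes {1..n}"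
      by (rule permutes_compose[OF less.prems], rule permutes_swap_id) (use j in auto)
    have "inversions n (\<lambda>x\<in>{1..n}. transpose j (Suc j) (as_surj n \<sigma> x)) = inversions n ?\<tau>"
      by (rule inversions_cong) (simp add: as_surj_def)
    moreover have "inversions n (as_surj n \<sigma>) = inversions n \<sigma>"
      by (rule inversions_as_surj)
    ultimately have card: "card (inversions n \<sigma>) = Suc (card (inversions n ?\<tau>))"
      using descent_inversions[OF as_surj_Sur[OF less.prems] j d] by simp
    obtain "is" where "is": "length is = card (inversions n ?\<tau>)" "set is \<subseteq> {1..<n}"
       "?\<tau> = foldr (\<circ>) (map (\<lambda>i. transpose i (Suc i)) is) id"
      using less.hyps[OF _ \<tau>] card by auto
    have "\<sigma> = transpose j (Suc j) \<circ> ?\<tau>" by (simp add: fun_eq_iff)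
    then have "\<sigma> = foldr (\<circ>) (map (\<lambda>i. transpose i (Suc i)) (j # is)) id"
      unfolding list.map foldr.simps o_apply "is"(3)[symmetric] .
    then show ?thesis using "is"(1,2) card j by (intro exI[of _ "j # is"]) auto
  qed
qed

lemma coxeter_length_inversions:
  assumes "\<sigma> permutes {1..n}"
  shows "coxeter_length n \<sigma> = card (inversions n \<sigma>)"
  unfolding coxeter_length_def
proof (rule Least_equality)
  fix l assume "\<exists>is. length is = l \<and> set is \<subseteq> {1..<n} \<and>
       \<sigma> = foldr (\<circ>) (map (\<lambda>i. transpose i (Suc i)) is) id"
  then show "card (inversions n \<sigma>) \<le> l" using word_inversions_le by blast
qed (rule inversions_word[OF assms])

lemma Sur_fiber_card: "s \<in> Sur n n \<Longrightarrow> j \<in> {1..n} \<Longrightarrow> fiber_card n s j = 1"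
proof -
  assume s: "s \<in> Sur n n" and "j \<in> {1..n}"
  then have "j \<in> s ` {1..n}" by (simp only: SurD(2)[OF s])
  then obtain x where x: "x \<in> {1..n}" "j = s x" by (elim imageE)
  have "{y \<in> {1..n}. s y = j} = {x}"
    using x inj_on_eq_iff[OF Sur_inj_on[OF s] _ x(1)] by blast
  then show ?thesis by (simp add: fiber_card_def)
qed

lemma Sur_fiber_card_all_one:
  assumes t: "t \<in> Sur n k" and one: "\<And>j. j \<in> {1..k} \<Longrightarrow> fiber_card n t j = 1"
  shows "k = n"
proof -
  have "inj_on t {1..n}"
  proof (rule inj_onI)
    fix x y assume x: "x \<in> {1..n}" and y: "y \<in> {1..n}" and eq: "t x = t y"
    have "card {z \<in> {1..n}. t z = t x} = 1"
      using one[OF SurD(1)[OF t x]] by (simp add: fiber_card_def)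
    then obtain w where w: "{z \<in> {1..n}. t z = t x} = {w}" by (rule card_1_singletonE)
    then have "x \<in> {w}" "y \<in> {w}" unfolding w[symmetric] using x y eq by simp_all
    then show "x = y" by simp
  qed
  from card_image[OF this] show ?thesis using SurD(2)[OF t] by simp
qed

lemma surj_subst_cong:
  assumes t: "t \<in> Sur n k"
    and m: "\<And>j. j \<in> {1..k} \<Longrightarrow> m j = m' j" and ts: "\<And>j. j \<in> {1..k} \<Longrightarrow> ts j = ts' j"
  shows "surj_subst n t m ts = surj_subst n t m' ts'"
proof
  fix a
  show "surj_subst n t m ts a = surj_subst n t m' ts' a"
  proof (cases "a \<in> {1..n}")
    case True
    have ta: "t a \<in> {1..k}" by (rule SurD(1)[OF t True])
    then have "offset m (t a) = offset m' (t a)"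
      unfolding offset_def by (intro sum.cong) (auto simp: m)
    then show ?thesis unfolding surj_subst_apply[OF True] ts[OF ta] by simp
  qed (simp only: surj_subst_def restrict_apply if_False)
qed

lemma one_Sur: "corolla 1 \<in> Sur 1 1"
  by (rule corolla_Sur) simp

lemma swap_Sur: "as_surj 2 (transpose 1 2) \<in> Sur 2 2"
  by (rule as_surj_Sur, rule permutes_swap_id) auto

lemma id_Sur: "as_surj n id \<in> Sur n n"
  by (rule as_surj_Sur, rule permutes_id)

lemma swap_neq_id: "as_surj 2 (transpose 1 2) \<noteq> as_surj 2 id"
proof
  assume "as_surj 2 (transpose 1 2) = as_surj 2 id"
  from fun_cong[OF this, of 1] show False by (simp add: as_surj_def)
qed

section \<open>The free permutad on a binary generator\<close>

definition arity_form :: "('k, 'z) ring_scheme \<Rightarrow> nat \<Rightarrow> (unit \<Rightarrow> 'k) \<Rightarrow> 'k" where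
  "arity_form K d y = (if d = 2 then y () else \<zero>\<^bsub>K\<^esub>)"

text \<open>Outside arity 2 the module is free on the empty set, and
  \<open>\<lambda>_. undefined\<close> is its only element, the zero.\<close>

definition arity_gen :: "('k, 'z) ring_scheme \<Rightarrow> nat \<Rightarrow> (unit \<Rightarrow> 'k)" where
  "arity_gen K d = (if d = 2 then free_gen K {()} () else (\<lambda>_. undefined))"

lemma (in cring) binary_gens_dual: "cyclic_dual R (binary_gens R d) (arity_form R d) (arity_gen R d)"
proof (cases "d = 2")
  case True
  then show ?thesis
    unfolding cyclic_dual_def linear_form_def
    by (auto simp: binary_gens_def arity_form_def arity_gen_def free_module_module free_gen_closed
        free_module_carrier free_module_ops)
      (auto simp: free_gen_def sum_inj_def regular_module_def fun_eq_iff PiE_iff)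
next
  case False
  then show ?thesis
    unfolding cyclic_dual_def linear_form_def
    by (auto simp: binary_gens_def arity_form_def arity_gen_def free_module_module
        free_module_carrier free_module_ops)
qed

abbreviation (in cring) "binary_summand n \<equiv> free_summand R (binary_gens R) n"

abbreviation (in cring) "binary_comp n \<equiv> direct_sum (surj_index n) (binary_summand n)"

definition (in cring) summand_coord ::
  "nat \<Rightarrow> nat \<times> (nat \<Rightarrow> nat) \<Rightarrow> ((nat \<Rightarrow> unit \<Rightarrow> 'a) \<Rightarrow> 'a) set \<Rightarrow> 'a" where
  "summand_coord n i = tensor_coord R {1..fst i} (decoration (binary_gens R) n (snd i))
     (\<lambda>j. arity_form R (fiber_card n (snd i) j + 1))"

definition (in cring) summand_gen ::
  "nat \<Rightarrow> nat \<times> (nat \<Rightarrow> nat) \<Rightarrow> ((nat \<Rightarrow> unit \<Rightarrow> 'a) \<Rightarrow> 'a) set" where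
  "summand_gen n i = pure_tensor R {1..fst i} (decoration (binary_gens R) n (snd i))
     (\<lambda>j\<in>{1..fst i}. arity_gen R (fiber_card n (snd i) j + 1))"

text \<open>For a bijection \<open>s\<close>, the element with index \<open>(n, s)\<close> turns out
  to be the composite of n copies of \<mu> along \<open>s\<close> (\<open>free_gam_bij\<close>);
  surjections onto fewer than n levels give zero (\<open>basis_elem_nonbij\<close>).\<close>

definition (in cring) basis_elem :: "nat \<Rightarrow> nat \<times> (nat \<Rightarrow> nat) \<Rightarrow> ('a, unit \<Rightarrow> 'a) free_permutad_elem" where
  "basis_elem n i = sum_inj (surj_index n) (binary_summand n) i (summand_gen n i)"

text \<open>The candidate for the map of permutads to the permutad that has the ground ring in every
  arity and multiplies by \<open>q\<close> once for every inversion.\<close>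

definition (in cring) q_form :: "'a \<Rightarrow> nat \<Rightarrow> ('a, unit \<Rightarrow> 'a) free_permutad_elem \<Rightarrow> 'a" where
  "q_form q n x = (\<Oplus>i\<in>surj_index n. q [^] card (inversions n (snd i)) \<otimes> summand_coord n i (x i))"

lemma Sur_le: "t \<in> Sur n k \<Longrightarrow> k \<le> n"
  using card_image_le[of "{1..n}" t] SurD(2)[of t n k] by simp

lemma Sur_index: "t \<in> Sur n k \<Longrightarrow> (k, t) \<in> surj_index n"
  using Sur_le[of t n k] by (simp add: surj_index_def)

lemma surj_indexD: "i \<in> surj_index n \<Longrightarrow> snd i \<in> Sur n (fst i)"
  by (auto simp: surj_index_def)

lemma finite_surj_index: "finite (surj_index n)"
proof -
  have "finite (Sur n k)" for k
    by (rule finite_subset[of _ "{1..n} \<rightarrow>\<^sub>E {1..k}"]) (auto simp: Sur_def intro: finite_PiE)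
  then show ?thesis by (simp add: surj_index_def)
qed

lemma free_comp_Suc: "free_comp K M (Suc n) = direct_sum (surj_index n) (free_summand K M n)"
  "free_comp K M (n + 1) = direct_sum (surj_index n) (free_summand K M n)"
  by (simp_all add: free_comp_def)

section \<open>Coordinates on the free permutad\<close>

context cring begin

lemma binary_summand_eq:
  "binary_summand n i = tensor R {1..fst i} (decoration (binary_gens R) n (snd i))"
  by (simp add: free_summand_def split_beta)

lemma decoration_dual:
  "cyclic_dual R (decoration (binary_gens R) n t j) (arity_form R (fiber_card n t j + 1))
     (arity_gen R (fiber_card n t j + 1))"
  unfolding decoration_def by (rule binary_gens_dual)

lemma binary_summand_module: "module R (binary_summand n i)"
  unfolding binary_summand_eq
  by (rule tensor_module[OF is_cring finite_atLeastAtMost decoration_dual])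

lemma summand_coord_linear: "linear_form R (binary_summand n i) (summand_coord n i)"
  unfolding binary_summand_eq summand_coord_def
  by (rule tensor_coord_linear[OF is_cring finite_atLeastAtMost decoration_dual])

lemma summand_gen_closed: "summand_gen n i \<in> carrier (binary_summand n i)"
  unfolding binary_summand_eq summand_gen_def
  by (rule pure_tensor_closed[OF is_cring finite_atLeastAtMost decoration_dual])
    (use cyclic_dualD(3)[OF decoration_dual] in auto)

lemma summand_expand:
  "X \<in> carrier (binary_summand n i) \<Longrightarrow>
   X = summand_coord n i X \<odot>\<^bsub>binary_summand n i\<^esub> summand_gen n i"
  unfolding binary_summand_eq summand_coord_def summand_gen_def
  by (rule tensor_expand[OF is_cring finite_atLeastAtMost decoration_dual])

lemma summand_gen_coord:
  "summand_coord n i (summand_gen n i) =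
     (\<Otimes>j\<in>{1..fst i}. if fiber_card n (snd i) j = 1 then \<one> else \<zero>)"
proof -
  have u: "(\<lambda>j\<in>{1..fst i}. arity_gen R (fiber_card n (snd i) j + 1)) \<in>
      (\<Pi>\<^sub>E j\<in>{1..fst i}. carrier (decoration (binary_gens R) n (snd i) j))"
    using cyclic_dualD(3)[OF decoration_dual] by auto
  have "summand_coord n i (summand_gen n i) = (\<Otimes>j\<in>{1..fst i}. arity_form R (fiber_card n (snd i) j + 1)
      ((\<lambda>j\<in>{1..fst i}. arity_gen R (fiber_card n (snd i) j + 1)) j))"
    unfolding summand_coord_def summand_gen_def
    by (rule pure_tensor_coord[OF is_cring finite_atLeastAtMost decoration_dual u])
  also have "\<dots> = (\<Otimes>j\<in>{1..fst i}. if fiber_card n (snd i) j = 1 then \<one> else \<zero>)"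
    by (rule finprod_cong') (auto simp: arity_form_def arity_gen_def free_gen_def sum_inj_def)
  finally show ?thesis .
qed

lemma binary_comp_module: "module R (binary_comp n)"
  by (rule direct_sum_module) (rule binary_summand_module)

lemma binary_inj_closed:
  "Y \<in> carrier (binary_summand n i) \<Longrightarrow> sum_inj (surj_index n) (binary_summand n) i Y \<in> carrier (binary_comp n)"
  by (rule sum_inj_closed[OF binary_summand_module])

lemma basis_elem_closed: "basis_elem n i \<in> carrier (binary_comp n)"
  unfolding basis_elem_def by (rule binary_inj_closed[OF summand_gen_closed])

lemma binary_comp_coord_closed:
  "x \<in> carrier (binary_comp n) \<Longrightarrow> i \<in> surj_index n \<Longrightarrow> summand_coord n i (x i) \<in> carrier R"
  by (auto simp: direct_sum_simps intro!: linear_formD(1)[OF summand_coord_linear])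

lemma sum_inj_coord:
  assumes "i \<in> surj_index n" "Y \<in> carrier (binary_summand n i)" "i' \<in> surj_index n"
  shows "summand_coord n i' (sum_inj (surj_index n) (binary_summand n) i Y i') =
     (if i' = i then summand_coord n i Y else \<zero>)"
  using assms linear_form_zero[OF binary_summand_module summand_coord_linear, of n i']
  by (simp add: sum_inj_def)

text \<open>Each summand is cyclic, so the \<open>basis_elem\<close> alone span the component. Both
  the expansion of compositions and the comparison of kernel and ideal rest on this.\<close>

lemma binary_inj_expand:
  assumes i: "i \<in> surj_index n" and Y: "Y \<in> carrier (binary_summand n i)"
  shows "sum_inj (surj_index n) (binary_summand n) i Y = summand_coord n i Y \<odot>\<^bsub>binary_comp n\<^esub> basis_elem n i"
proof -
  have "summand_coord n i Y \<odot>\<^bsub>binary_summand n j\<^esub> \<zero>\<^bsub>binary_summand n j\<^esub> = \<zero>\<^bsub>binary_summand n j\<^esub>" for j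
    by (rule module.smult_r_null[OF binary_summand_module linear_formD(1)[OF summand_coord_linear Y]])
  then show ?thesis
    using summand_expand[OF Y] by (auto simp: direct_sum_simps basis_elem_def sum_inj_def intro!: restrict_ext)
qed

lemma q_form_linear:
  assumes "q \<in> carrier R"
  shows "linear_form R (binary_comp n) (q_form q n)"
  unfolding q_form_def
  by (rule direct_sum_form[OF binary_summand_module finite_surj_index _ summand_coord_linear])
    (use assms in simp)

lemma q_form_inj:
  assumes q: "q \<in> carrier R" and i: "i \<in> surj_index n" and Y: "Y \<in> carrier (binary_summand n i)"
  shows "q_form q n (sum_inj (surj_index n) (binary_summand n) i Y) =
    q [^] card (inversions n (snd i)) \<otimes> summand_coord n i Y"
proof -
  note c = linear_formD(1)[OF summand_coord_linear Y]
  have "q_form q n (sum_inj (surj_index n) (binary_summand n) i Y) =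
    (\<Oplus>i'\<in>surj_index n. if i' = i then q [^] card (inversions n (snd i')) \<otimes> summand_coord n i Y else \<zero>)"
    unfolding q_form_def
    by (rule finsum_cong') (use q c in \<open>auto simp: sum_inj_coord[OF i Y]\<close>)
  also have "\<dots> = q [^] card (inversions n (snd i)) \<otimes> summand_coord n i Y"
    by (rule add.finprod_singleton_swap[OF i finite_surj_index]) (use q c in auto)
  finally show ?thesis .
qed

lemma finprod_pow_sum: "finite A \<Longrightarrow> q \<in> carrier R \<Longrightarrow> (\<Otimes>a\<in>A. q [^] (f a :: nat)) = q [^] sum f A"
  by (induction A rule: finite_induct) (simp_all add: nat_pow_mult Pi_def)

section \<open>Compositions in the free permutad\<close>

abbreviation "binary_dom n k t \<equiv> \<Pi>\<^sub>E j\<in>{1..k}. carrier (free_comp R (binary_gens R) (fiber_card n t j + 1))"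

abbreviation "subst_index n k t c \<equiv>
  (\<Sum>j=1..k. fst (c j), surj_subst n t (\<lambda>j. fst (c j)) (\<lambda>j. snd (c j)))"

context
  fixes n k t x
  assumes n: "1 \<le> n" and t: "t \<in> Sur n k" and x: "x \<in> binary_dom n k t"
begin

private abbreviation "choices \<equiv> \<Pi>\<^sub>E j\<in>{1..k}. surj_index (fiber_card n t j)"

private definition "choice_join c = tensor_join R k (\<lambda>j. fst (c j))
   (decoration (binary_gens R) n (snd (subst_index n k t c))) (\<lambda>j. x j (c j))"

private lemma choice_Sur: "c \<in> choices \<Longrightarrow> j \<in> {1..k} \<Longrightarrow> snd (c j) \<in> Sur (fiber_card n t j) (fst (c j))"
  by (rule surj_indexD) (rule PiE_mem)

private lemma x_mem: "j \<in> {1..k} \<Longrightarrow> x j \<in> carrier (binary_comp (fiber_card n t j))"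
  using PiE_mem[OF x, of j] by (simp only: free_comp_Suc)

private lemma x_coord: "c \<in> choices \<Longrightarrow> j \<in> {1..k} \<Longrightarrow> x j (c j) \<in> carrier (binary_summand (fiber_card n t j) (c j))"
  using x_mem[of j] PiE_mem[of c "{1..k}" _ j] by (auto simp: direct_sum_simps)

lemma subst_index_mem: "c \<in> choices \<Longrightarrow> subst_index n k t c \<in> surj_index n"
  by (rule Sur_index, rule surj_subst_Sur[OF t choice_Sur])

private lemma choice_join:
  assumes c: "c \<in> choices"
  shows "choice_join c \<in> carrier (binary_summand n (subst_index n k t c))"
    and "summand_coord n (subst_index n k t c) (choice_join c) =
      (\<Otimes>j\<in>{1..k}. summand_coord (fiber_card n t j) (c j) (x j (c j)))"
proof -
  note fc = surj_subst_fiber_card[OF t choice_Sur[OF c]]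
  have deco: "decoration (binary_gens R) (fiber_card n t j) (snd (c j)) i =
      decoration (binary_gens R) n (snd (subst_index n k t c)) (offset (\<lambda>j. fst (c j)) j + i)"
    if "j \<in> {1..k}" "i \<in> {1..fst (c j)}" for j i
    using fc[OF _ that] by (simp add: decoration_def)
  have form: "arity_form R (fiber_card (fiber_card n t j) (snd (c j)) i + 1) =
      arity_form R (fiber_card n (snd (subst_index n k t c)) (offset (\<lambda>j. fst (c j)) j + i) + 1)"
    if "j \<in> {1..k}" "i \<in> {1..fst (c j)}" for j i
    using fc[OF _ that] by simp
  have mem: "x j (c j) \<in> carrier (tensor R {1..fst (c j)} (decoration (binary_gens R) (fiber_card n t j) (snd (c j))))"
    if "j \<in> {1..k}" for j
    using x_coord[OF c that] by (simp only: binary_summand_eq)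
  show "choice_join c \<in> carrier (binary_summand n (subst_index n k t c))"
    unfolding binary_summand_eq choice_join_def fst_conv
    by (rule tensor_join_closed[OF decoration_dual deco form mem])
  show "summand_coord n (subst_index n k t c) (choice_join c) =
      (\<Otimes>j\<in>{1..k}. summand_coord (fiber_card n t j) (c j) (x j (c j)))"
    unfolding summand_coord_def choice_join_def fst_conv
    by (rule tensor_join_coord[OF decoration_dual deco form mem])
qed

private lemma free_gam_choices: "free_gam R (binary_gens R) n k t x =
   (\<Oplus>\<^bsub>binary_comp n\<^esub>c\<in>choices. sum_inj (surj_index n) (binary_summand n) (subst_index n k t c) (choice_join c))"
  by (simp add: free_gam_def free_comp_Suc Let_def choice_join_def)

lemma free_gam_closed: "free_gam R (binary_gens R) n k t x \<in> carrier (binary_comp n)"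
proof -
  interpret D: module R "binary_comp n" by (rule binary_comp_module)
  show ?thesis
    unfolding free_gam_choices by (rule D.finsum_closed) (use binary_inj_closed choice_join(1) in blast)
qed

lemma coord_closed: "c \<in> choices \<Longrightarrow> j \<in> {1..k} \<Longrightarrow> summand_coord (fiber_card n t j) (c j) (x j (c j)) \<in> carrier R"
  by (rule linear_formD(1)[OF summand_coord_linear x_coord])

text \<open>A choice \<open>c\<close> fixes one summand per argument. The target summand is cyclic,
  so the joined tensor is known from its coordinate, and coordinates multiply under joining.\<close>

lemma free_gam_expand: "free_gam R (binary_gens R) n k t x =
   (\<Oplus>\<^bsub>binary_comp n\<^esub>c\<in>choices. (\<Otimes>j\<in>{1..k}. summand_coord (fiber_card n t j) (c j) (x j (c j)))
      \<odot>\<^bsub>binary_comp n\<^esub> basis_elem n (subst_index n k t c))"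
proof -
  interpret D: module R "binary_comp n" by (rule binary_comp_module)
  show ?thesis
    unfolding free_gam_choices
  proof (rule D.finsum_cong')
    fix c assume c: "c \<in> choices"
    show "sum_inj (surj_index n) (binary_summand n) (subst_index n k t c) (choice_join c) =
      (\<Otimes>j\<in>{1..k}. summand_coord (fiber_card n t j) (c j) (x j (c j)))
      \<odot>\<^bsub>binary_comp n\<^esub> basis_elem n (subst_index n k t c)"
      unfolding binary_inj_expand[OF subst_index_mem[OF c] choice_join(1)[OF c]] choice_join(2)[OF c] ..
  next
    show "(\<lambda>c. (\<Otimes>j\<in>{1..k}. summand_coord (fiber_card n t j) (c j) (x j (c j)))
      \<odot>\<^bsub>binary_comp n\<^esub> basis_elem n (subst_index n k t c)) \<in> choices \<rightarrow> carrier (binary_comp n)"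
      by (intro funcsetI D.smult_closed basis_elem_closed finprod_closed coord_closed)
  qed simp
qed

text \<open>This is the compatibility of the form with composition. For a single choice of summands
  the exponents of q add up by \<open>inversions_subst\<close> and the coordinates multiply;
  distributivity then resums over all choices.\<close>

lemma q_form_gam:
  assumes q: "q \<in> carrier R"
  shows "q_form q n (free_gam R (binary_gens R) n k t x) =
     q [^] card (inversions n t) \<otimes> (\<Otimes>j\<in>{1..k}. q_form q (fiber_card n t j) (x j))"
proof -
  define F where "F j i = q [^] card (inversions (fiber_card n t j) (snd i)) \<otimes>
      summand_coord (fiber_card n t j) i (x j i)" for j i
  have cc: "summand_coord (fiber_card n t j) i (x j i) \<in> carrier R"
    if "j \<in> {1..k}" "i \<in> surj_index (fiber_card n t j)" for j i
    by (rule binary_comp_coord_closed[OF x_mem[OF that(1)] that(2)])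
  have Fc: "F j i \<in> carrier R" if "j \<in> {1..k}" "i \<in> surj_index (fiber_card n t j)" for j i
    using cc[OF that] q by (simp add: F_def)
  have PF: "(\<Otimes>j\<in>{1..k}. F j (c j)) \<in> carrier R" if "c \<in> choices" for c
    by (rule finprod_closed, rule funcsetI, rule Fc, assumption, rule PiE_mem[OF that])
  have fin: "finite choices" by (rule finite_PiE) (auto intro: finite_surj_index)
  have "q_form q n (free_gam R (binary_gens R) n k t x) =
     (\<Oplus>c\<in>choices. q_form q n (sum_inj (surj_index n) (binary_summand n) (subst_index n k t c) (choice_join c)))"
    unfolding free_gam_choices
    by (rule linear_form_finsum[OF binary_comp_module q_form_linear[OF q]])
      (use binary_inj_closed choice_join(1) in blast)
  also have "\<dots> = (\<Oplus>c\<in>choices. q [^] card (inversions n t) \<otimes> (\<Otimes>j\<in>{1..k}. F j (c j)))"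
  proof (rule finsum_cong')
    fix c assume c: "c \<in> choices"
    note cj = PiE_mem[OF c]
    have "(\<Otimes>j\<in>{1..k}. F j (c j)) = (\<Otimes>j\<in>{1..k}. q [^] card (inversions (fiber_card n t j) (snd (c j)))) \<otimes>
        (\<Otimes>j\<in>{1..k}. summand_coord (fiber_card n t j) (c j) (x j (c j)))"
      unfolding F_def by (rule finprod_multf) (use q cc cj in \<open>auto simp del: atLeastAtMost_iff\<close>)
    also have "(\<Otimes>j\<in>{1..k}. q [^] card (inversions (fiber_card n t j) (snd (c j)))) =
        q [^] (\<Sum>j=1..k. card (inversions (fiber_card n t j) (snd (c j))))"
      by (rule finprod_pow_sum[OF finite_atLeastAtMost q])
    finally have prod: "(\<Otimes>j\<in>{1..k}. F j (c j)) =
      q [^] (\<Sum>j=1..k. card (inversions (fiber_card n t j) (snd (c j)))) \<otimes>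
        (\<Otimes>j\<in>{1..k}. summand_coord (fiber_card n t j) (c j) (x j (c j)))" .
    have pc: "(\<Otimes>j\<in>{1..k}. summand_coord (fiber_card n t j) (c j) (x j (c j))) \<in> carrier R"
      by (intro finprod_closed funcsetI cc cj)
    have inv: "card (inversions n (snd (subst_index n k t c))) = card (inversions n t) +
        (\<Sum>j=1..k. card (inversions (fiber_card n t j) (snd (c j))))"
      unfolding snd_conv by (rule inversions_subst[OF t choice_Sur[OF c]])
    show "q_form q n (sum_inj (surj_index n) (binary_summand n) (subst_index n k t c) (choice_join c)) =
       q [^] card (inversions n t) \<otimes> (\<Otimes>j\<in>{1..k}. F j (c j))"
      unfolding q_form_inj[OF q subst_index_mem[OF c] choice_join(1)[OF c]] choice_join(2)[OF c] prod inv
      unfolding nat_pow_mult[OF q, symmetric]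
      by (rule m_assoc[OF nat_pow_closed[OF q] nat_pow_closed[OF q] pc])
  next
    show "(\<lambda>c. q [^] card (inversions n t) \<otimes> (\<Otimes>j\<in>{1..k}. F j (c j))) \<in> choices \<rightarrow> carrier R"
      by (intro funcsetI m_closed PF nat_pow_closed q)
  qed simp
  also have "\<dots> = q [^] card (inversions n t) \<otimes> (\<Oplus>c\<in>choices. \<Otimes>j\<in>{1..k}. F j (c j))"
    by (rule finsum_rdistr[symmetric, OF fin])
      (rule nat_pow_closed[OF q], rule funcsetI, rule PF)
  also have "(\<Oplus>c\<in>choices. \<Otimes>j\<in>{1..k}. F j (c j)) = (\<Otimes>j\<in>{1..k}. \<Oplus>i\<in>surj_index (fiber_card n t j). F j i)"
    by (rule finprod_finsum_distrib[symmetric]) (use Fc finite_surj_index in \<open>auto simp del: atLeastAtMost_iff\<close>)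
  also have "\<dots> = (\<Otimes>j\<in>{1..k}. q_form q (fiber_card n t j) (x j))"
    by (simp add: F_def q_form_def)
  finally show ?thesis .
qed

end

lemma binary_proj_linear:
  assumes "i \<in> surj_index n"
  shows "linear_form R (binary_comp n) (\<lambda>x. summand_coord n i (x i))"
  using assms unfolding linear_form_def
  by (auto simp: direct_sum_simps PiE_iff linear_formD[OF summand_coord_linear])

text \<open>Indexed by arity, as ideals are: arity d belongs to surjections defined on d - 1
  elements, whence the shift.\<close>

definition q_kernel :: "'a \<Rightarrow> nat \<Rightarrow> ('a, unit \<Rightarrow> 'a) free_permutad_elem set" where
  "q_kernel q d = form_kernel R (free_comp R (binary_gens R) d) (q_form q (d - 1))"

lemma free_comp_pos: "1 \<le> d \<Longrightarrow> free_comp R (binary_gens R) d = binary_comp (d - 1)"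
  by (simp add: free_comp_def)

lemma free_permutad_simps:
  "comp (free_permutad R M) = free_comp R M" "gam (free_permutad R M) = free_gam R M"
  by (simp_all add: free_permutad_def)

text \<open>By \<open>q_form_gam\<close> the value of a composition is a multiple of the product of
  the values of its arguments, so one argument of value zero suffices.\<close>

lemma q_kernel_ideal:
  assumes q: "q \<in> carrier R"
  shows "permutad_ideal R (free_permutad R (binary_gens R)) (q_kernel q)"
  unfolding permutad_ideal_def free_permutad_simps
proof (intro conjI allI impI ballI)
  fix d :: nat assume d: "1 \<le> d"
  show "submodule (q_kernel q d) R (free_comp R (binary_gens R) d)"
    unfolding q_kernel_def free_comp_pos[OF d]
    by (rule form_kernel_submodule[OF binary_comp_module q_form_linear[OF q]])
next
  fix n k t x
  assume n: "1 \<le> n" and t: "t \<in> Sur n k" and x: "x \<in> binary_dom n k t"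
    and "\<exists>j\<in>{1..k}. x j \<in> q_kernel q (fiber_card n t j + 1)"
  then obtain j where j: "j \<in> {1..k}" "x j \<in> q_kernel q (fiber_card n t j + 1)" by blast
  then have zero: "q_form q (fiber_card n t j) (x j) = \<zero>"
    by (simp add: q_kernel_def form_kernel_def)
  have "q_form q (fiber_card n t l) (x l) \<in> carrier R" if "l \<in> {1..k}" for l
    by (rule linear_formD(1)[OF q_form_linear[OF q]]) (use PiE_mem[OF x that] in \<open>simp add: free_comp_Suc\<close>)
  then have "(\<Otimes>l\<in>{1..k}. q_form q (fiber_card n t l) (x l)) = \<zero>"
    by (intro finprod_zero[where f = "\<lambda>l. q_form q (fiber_card n t l) (x l)", OF _ j(1) zero]) auto
  then show "free_gam R (binary_gens R) n k t x \<in> q_kernel q (n + 1)"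
    using free_gam_closed[OF n t x] q
    by (simp add: q_kernel_def form_kernel_def q_form_gam[OF n t x q] free_comp_Suc)
qed

section \<open>Basis elements and their compositions\<close>

lemma summand_gen_coord_bij:
  assumes "s \<in> Sur n n"
  shows "summand_coord n (n, s) (summand_gen n (n, s)) = \<one>"
  unfolding summand_gen_coord
  by (rule finprod_one_eqI) (use Sur_fiber_card[OF assms] in simp)

lemma summand_gen_coord_nonbij:
  assumes "i \<in> surj_index n" "fst i \<noteq> n"
  shows "summand_coord n i (summand_gen n i) = \<zero>"
proof -
  obtain j where j: "j \<in> {1..fst i}" "fiber_card n (snd i) j \<noteq> 1"
    using Sur_fiber_card_all_one[OF surj_indexD[OF assms(1)]] assms(2) by blast
  then show ?thesis
    unfolding summand_gen_coord by (intro finprod_zero[OF _ j(1)]) auto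
qed

lemma basis_elem_coord:
  assumes s: "s \<in> Sur n n" and i: "i \<in> surj_index n"
  shows "summand_coord n i (basis_elem n (n, s) i) = (if i = (n, s) then \<one> else \<zero>)"
  unfolding basis_elem_def sum_inj_coord[OF Sur_index[OF s] summand_gen_closed i]
    summand_gen_coord_bij[OF s] ..

lemma q_form_basis:
  assumes "q \<in> carrier R" "s \<in> Sur n n"
  shows "q_form q n (basis_elem n (n, s)) = q [^] card (inversions n s)"
  unfolding basis_elem_def q_form_inj[OF assms(1) Sur_index[OF assms(2)] summand_gen_closed]
    summand_gen_coord_bij[OF assms(2)] using assms(1) by simp

text \<open>A surjection onto fewer than n levels has a fiber of size other than 1, decorated by the
  zero module. The coordinate of its generator is therefore 0, and expanding the generator in terms
  of itself gives 0 times itself.\<close>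

lemma basis_elem_nonbij:
  assumes "i \<in> surj_index n" "fst i \<noteq> n"
  shows "basis_elem n i = \<zero>\<^bsub>binary_comp n\<^esub>"
proof -
  interpret D: module R "binary_comp n" by (rule binary_comp_module)
  have "basis_elem n i = \<zero> \<odot>\<^bsub>binary_comp n\<^esub> basis_elem n i"
    using binary_inj_expand[OF assms(1) summand_gen_closed]
    unfolding summand_gen_coord_nonbij[OF assms] basis_elem_def[symmetric] .
  also have "\<dots> = \<zero>\<^bsub>binary_comp n\<^esub>" by (rule D.smult_l_null[OF basis_elem_closed])
  finally show ?thesis .
qed

lemma free_mu_basis: "free_mu R = basis_elem 1 (1, corolla 1)"
proof -
  have "fiber_card 1 (corolla 1) 1 = 1"
    by (rule Sur_fiber_card[OF one_Sur]) simp
  then have "(\<lambda>j\<in>{1..1}. arity_gen R (fiber_card 1 (corolla 1) j + 1)) = (\<lambda>j\<in>{1..1}. free_gen R {()} ())"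
    by (auto simp: arity_gen_def fun_eq_iff)
  then show ?thesis
    by (simp only: free_mu_def free_incl_def basis_elem_def summand_gen_def fst_conv snd_conv)
qed

lemma free_mu_closed: "free_mu R \<in> carrier (binary_comp 1)"
  unfolding free_mu_basis by (rule basis_elem_closed)

text \<open>Among all choices of summands only the one that picks the home of every argument has
  nonzero coordinates throughout, so the expansion has a single term.\<close>

lemma free_gam_basis:
  assumes n: "1 \<le> n" and t: "t \<in> Sur n k"
    and r: "\<And>j. j \<in> {1..k} \<Longrightarrow> r j \<in> Sur (fiber_card n t j) (fiber_card n t j)"
    and x: "\<And>j. j \<in> {1..k} \<Longrightarrow> x j = basis_elem (fiber_card n t j) (fiber_card n t j, r j)"
    and xe: "x \<in> extensional {1..k}"
  shows "free_gam R (binary_gens R) n k t x =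
    basis_elem n (\<Sum>j=1..k. fiber_card n t j, surj_subst n t (fiber_card n t) r)"
proof -
  interpret D: module R "binary_comp n" by (rule binary_comp_module)
  let ?C = "\<Pi>\<^sub>E j\<in>{1..k}. surj_index (fiber_card n t j)"
  define f where "f c = (\<Otimes>j\<in>{1..k}. summand_coord (fiber_card n t j) (c j) (x j (c j)))
      \<odot>\<^bsub>binary_comp n\<^esub> basis_elem n (subst_index n k t c)" for c
  have xd: "x \<in> binary_dom n k t"
    using xe x basis_elem_closed by (auto simp: PiE_iff free_comp_Suc simp del: atLeastAtMost_iff)
  define c0 where "c0 = (\<lambda>j\<in>{1..k}. (fiber_card n t j, r j))"
  have c0: "c0 \<in> ?C" unfolding c0_def restrict_PiE_iff using Sur_index[OF r] by blast
  have coord: "summand_coord (fiber_card n t j) (c j) (x j (c j)) = (if c j = c0 j then \<one> else \<zero>)"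
    if "c \<in> ?C" "j \<in> {1..k}" for c j
    unfolding x[OF that(2)] basis_elem_coord[OF r[OF that(2)] PiE_mem[OF that]]
    using that(2) by (simp add: c0_def)
  have zero: "f c = \<zero>\<^bsub>binary_comp n\<^esub>" if c: "c \<in> ?C - {c0}" for c
  proof -
    have "c \<noteq> c0" "c \<in> ?C" using c by auto
    then obtain j where j: "j \<in> {1..k}" "c j \<noteq> c0 j"
      using PiE_ext[OF _ c0, of c] by blast
    have "(\<Otimes>j\<in>{1..k}. summand_coord (fiber_card n t j) (c j) (x j (c j))) = \<zero>"
      using c j by (intro finprod_zero[OF _ j(1)]) (auto simp: coord simp del: atLeastAtMost_iff)
    then show ?thesis by (simp add: f_def basis_elem_closed)
  qed
  have "(\<Otimes>j\<in>{1..k}. summand_coord (fiber_card n t j) (c0 j) (x j (c0 j))) = \<one>"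
    by (rule finprod_one_eqI) (simp add: coord[OF c0])
  then have f0: "f c0 = basis_elem n (subst_index n k t c0)"
    by (simp add: f_def basis_elem_closed)
  have "free_gam R (binary_gens R) n k t x = (\<Oplus>\<^bsub>binary_comp n\<^esub>c\<in>?C. f c)"
    unfolding f_def by (rule free_gam_expand[OF n t xd])
  also have "\<dots> = (\<Oplus>\<^bsub>binary_comp n\<^esub>c\<in>{c0}. f c)"
  proof (rule D.add.finprod_mono_neutral_cong_right)
    show "finite ?C" by (rule finite_PiE) (auto intro: finite_surj_index)
    show "f \<in> ?C \<rightarrow> carrier (binary_comp n)"
      unfolding f_def
      by (intro funcsetI D.smult_closed basis_elem_closed finprod_closed coord_closed[OF n t xd])
  qed (use c0 zero in auto)
  also have "\<dots> = f c0"
    using basis_elem_closed by (simp add: f0)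
  also have "\<dots> = basis_elem n (\<Sum>j=1..k. fiber_card n t j, surj_subst n t (fiber_card n t) r)"
  proof -
    have "surj_subst n t (\<lambda>j. fst (c0 j)) (\<lambda>j. snd (c0 j)) = surj_subst n t (fiber_card n t) r"
      by (rule surj_subst_cong[OF t]) (simp_all add: c0_def)
    moreover have "(\<Sum>j=1..k. fst (c0 j)) = (\<Sum>j=1..k. fiber_card n t j)"
      by (rule sum.cong) (auto simp: c0_def)
    ultimately show ?thesis unfolding f0 by (simp only:)
  qed
  finally show ?thesis .
qed

text \<open>For a bijection all fibers are singletons, so only corollas are substituted.\<close>

lemma free_gam_bij:
  assumes n: "1 \<le> n" and s: "s \<in> Sur n n"
  shows "free_gam R (binary_gens R) n n s (\<lambda>j\<in>{1..n}. free_mu R) = basis_elem n (n, s)"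
proof -
  have "free_gam R (binary_gens R) n n s (\<lambda>j\<in>{1..n}. free_mu R) =
     basis_elem n (\<Sum>j=1..n. fiber_card n s j, surj_subst n s (fiber_card n s) (\<lambda>_. corolla 1))"
    by (rule free_gam_basis[OF n s])
      (use Sur_fiber_card[OF s] one_Sur in \<open>simp_all add: free_mu_basis\<close>)
  also have "(\<Sum>j=1..n. fiber_card n s j) = n"
    using Sur_fiber_card[OF s] by simp
  also have "surj_subst n s (fiber_card n s) (\<lambda>_. corolla 1) = s"
  proof
    fix a
    show "surj_subst n s (fiber_card n s) (\<lambda>_. corolla 1) a = s a"
    proof (cases "a \<in> {1..n}")
      case True
      have sa: "s a \<in> {1..n}" by (rule SurD(1)[OF s True])
      have "offset (fiber_card n s) (s a) = s a - 1"
        unfolding offset_def using sa Sur_fiber_card[OF s] by simp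
      moreover have "fiber_pos n s a = 1"
        using fiber_pos_mem[OF True, of s] Sur_fiber_card[OF s sa] by simp
      ultimately show ?thesis
        unfolding surj_subst_apply[OF True] using sa by (simp add: corolla_def)
    next
      case False
      then show ?thesis using extensional_arb[OF SurD(3)[OF s] False]
        by (simp only: surj_subst_def restrict_apply if_False)
    qed
  qed
  finally show ?thesis .
qed

section \<open>The defining relation and its compositions\<close>

definition swap_relation :: "'a \<Rightarrow> ('a, unit \<Rightarrow> 'a) free_permutad_elem" where
  "swap_relation q = basis_elem 2 (2, as_surj 2 (transpose 1 2)) \<ominus>\<^bsub>binary_comp 2\<^esub>
     q \<odot>\<^bsub>binary_comp 2\<^esub> basis_elem 2 (2, as_surj 2 id)"

lemma q_relations_eq: "q_relations R q d = (if d = 3 then {swap_relation q} else {})"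
proof -
  have c3: "free_comp R (binary_gens R) 3 = binary_comp 2"
    by (simp add: free_comp_def)
  have two: "(1::nat) \<le> 2" by simp
  show ?thesis
    unfolding q_relations_def Let_def free_permutad_simps c3 swap_relation_def
      free_gam_bij[OF two swap_Sur] free_gam_bij[OF two id_Sur] ..
qed

lemma swap_relation_closed: "q \<in> carrier R \<Longrightarrow> swap_relation q \<in> carrier (binary_comp 2)"
proof -
  interpret D: module R "binary_comp 2" by (rule binary_comp_module)
  show "q \<in> carrier R \<Longrightarrow> swap_relation q \<in> carrier (binary_comp 2)"
    unfolding swap_relation_def by (intro D.minus_closed D.smult_closed basis_elem_closed)
qed

lemma swap_relation_coord:
  assumes q: "q \<in> carrier R" and i: "i \<in> surj_index 2"
  shows "summand_coord 2 i (swap_relation q i) =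
    (if i = (2, as_surj 2 (transpose 1 2)) then \<one> else if i = (2, as_surj 2 id) then \<ominus> q else \<zero>)"
proof -
  interpret D: module R "binary_comp 2" by (rule binary_comp_module)
  note L = binary_proj_linear[OF i]
  have "summand_coord 2 i (swap_relation q i) =
    summand_coord 2 i (basis_elem 2 (2, as_surj 2 (transpose 1 2)) i) \<ominus>
     q \<otimes> summand_coord 2 i (basis_elem 2 (2, as_surj 2 id) i)"
    unfolding swap_relation_def linear_form_diff[OF binary_comp_module L basis_elem_closed
        D.smult_closed[OF q basis_elem_closed]] linear_formD(3)[OF L q basis_elem_closed] ..
  also have "\<dots> = (if i = (2, as_surj 2 (transpose 1 2)) then \<one> else if i = (2, as_surj 2 id) then \<ominus> q else \<zero>)"
    unfolding basis_elem_coord[OF swap_Sur i] basis_elem_coord[OF id_Sur i]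
    using q swap_neq_id diff_zero by (auto simp: a_minus_def)
  finally show ?thesis .
qed

lemma swap_relation_form:
  assumes q: "q \<in> carrier R"
  shows "q_form q 2 (swap_relation q) = \<zero>"
proof -
  interpret D: module R "binary_comp 2" by (rule binary_comp_module)
  have "inversions 2 (transpose 1 2) = {(1, 2)}"
    by (auto simp: inversions_def transpose_def)
  then have "card (inversions 2 (as_surj 2 (transpose 1 2))) = 1"
    by (simp add: inversions_as_surj)
  then show ?thesis
    unfolding swap_relation_def
      linear_form_diff[OF binary_comp_module q_form_linear[OF q] basis_elem_closed
        D.smult_closed[OF q basis_elem_closed]]
      linear_formD(3)[OF q_form_linear[OF q] q basis_elem_closed]
      q_form_basis[OF q swap_Sur] q_form_basis[OF q id_Sur] inversions_as_surj[of 2 id] inversions_id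
    using q by (simp add: a_minus_def r_neg)
qed

lemma q_ideal_subset_kernel:
  assumes q: "q \<in> carrier R" and "1 \<le> d"
  shows "q_ideal R q d \<subseteq> q_kernel q d"
proof -
  have "swap_relation q \<in> q_kernel q 3"
    using swap_relation_closed[OF q] swap_relation_form[OF q]
    by (simp add: q_kernel_def form_kernel_def free_comp_pos)
  then have "\<forall>m\<ge>1. q_relations R q m \<subseteq> q_kernel q m"
    by (simp add: q_relations_eq)
  then show ?thesis
    unfolding q_ideal_def generated_ideal_def using q_kernel_ideal[OF q] by blast
qed

text \<open>Composing the defining relation along the surjection that merges the levels \<open>j\<close> and
  \<open>j + 1\<close> of \<open>s\<close> relates \<open>s\<close> to the permutation with this descent removed.\<close>

lemma free_gam_merge:
  assumes q: "q \<in> carrier R" and s: "s \<in> Sur n n" and j: "j \<in> {1..<n}"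
    and ab: "a \<in> {1..n}" "b \<in> {1..n}" "a < b" "s a = Suc j" "s b = j"
  defines "t \<equiv> merge_levels n j s"
    and "x \<equiv> \<lambda>l\<in>{1..n-1}. if l = j then swap_relation q else free_mu R"
  shows "x \<in> binary_dom n (n - 1) t"
    and "free_gam R (binary_gens R) n (n - 1) t x =
      basis_elem n (n, s) \<ominus>\<^bsub>binary_comp n\<^esub>
        q \<odot>\<^bsub>binary_comp n\<^esub> basis_elem n (n, \<lambda>x\<in>{1..n}. transpose j (Suc j) (s x))"
proof -
  interpret D: module R "binary_comp n" by (rule binary_comp_module)
  let ?C = "\<Pi>\<^sub>E l\<in>{1..n-1}. surj_index (fiber_card n t l)"
  have n: "1 \<le> n" using j by simp
  have jk: "j \<in> {1..n-1}" using j by auto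
  have t: "t \<in> Sur n (n - 1)" unfolding t_def by (rule merge_Sur[OF s j ab])
  have fc: "fiber_card n t l = block_sizes j l" if "l \<in> {1..n-1}" for l
    unfolding t_def by (rule merge_fiber_card[OF s j ab that])
  have fcj: "fiber_card n t j = 2" using fc[OF jk] by (simp add: block_sizes_def)
  have fc1: "fiber_card n t l = 1" if "l \<in> {1..n-1}" "l \<noteq> j" for l
    using fc[OF that(1)] that(2) by (simp add: block_sizes_def)
  have bp: "block_perms j p l \<in> Sur (fiber_card n t l) (block_sizes j l)"
    if "p \<in> Sur 2 2" "l \<in> {1..n-1}" for p l
    unfolding t_def by (rule block_perms_Sur[OF s j ab that])
  have "x l \<in> carrier (free_comp R (binary_gens R) (fiber_card n t l + 1))" if "l \<in> {1..n-1}" for l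
    unfolding free_comp_Suc
  proof (cases "l = j")
    case True
    then show "x l \<in> carrier (binary_comp (fiber_card n t l))"
      using jk swap_relation_closed[OF q] by (simp add: x_def fcj)
  next
    case False
    then show "x l \<in> carrier (binary_comp (fiber_card n t l))"
      using that free_mu_closed by (simp add: x_def fc1)
  qed
  then show x: "x \<in> binary_dom n (n - 1) t"
    unfolding x_def restrict_PiE_iff by (simp only: restrict_apply' x_def) blast
  \<comment> \<open>The relation at place j lives in two summands, the transposition and the
    identity, and \<mu> at every other place lives in one. \<open>choice\<close> applied to these
    two permutations gives the choices that survive in the expansion.\<close>
  define choice where "choice p = (\<lambda>l\<in>{1..n-1}. (block_sizes j l, block_perms j p l))" for p
  let ?\<tau> = "as_surj 2 (transpose 1 2)" and ?\<iota> = "as_surj 2 id"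
  have choice: "choice p \<in> ?C" if "p \<in> Sur 2 2" for p
    unfolding choice_def restrict_PiE_iff using Sur_index[OF bp[OF that]] by blast
  have choice_j: "choice p j = (2, p)" for p
    using jk by (simp add: choice_def block_sizes_def block_perms_def)
  have choice_other: "choice p l = (1, corolla 1)" if "l \<in> {1..n-1}" "l \<noteq> j" for p l
    using that by (simp add: choice_def block_sizes_def block_perms_def)
  have coord_j: "summand_coord (fiber_card n t j) (c j) (x j (c j)) =
     (if c j = choice ?\<tau> j then \<one> else if c j = choice ?\<iota> j then \<ominus> q else \<zero>)" if "c \<in> ?C" for c
    using swap_relation_coord[OF q, of "c j"] PiE_mem[OF that jk] jk
    unfolding fcj choice_j by (simp add: x_def)
  have coord_other: "summand_coord (fiber_card n t l) (c l) (x l (c l)) =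
     (if c l = (1, corolla 1) then \<one> else \<zero>)" if "c \<in> ?C" "l \<in> {1..n-1}" "l \<noteq> j" for c l
    using basis_elem_coord[OF one_Sur, of "c l"] PiE_mem[OF that(1,2)] that(2,3)
    unfolding fc1[OF that(2,3)] by (simp add: x_def free_mu_basis)
  define P where "P c = (\<Otimes>l\<in>{1..n-1}. summand_coord (fiber_card n t l) (c l) (x l (c l)))" for c
  have Pc: "P c \<in> carrier R" if "c \<in> ?C" for c
    unfolding P_def by (intro finprod_closed funcsetI coord_closed[OF n t x that])
  have P\<tau>: "P (choice ?\<tau>) = \<one>"
    unfolding P_def
  proof (rule finprod_one_eqI)
    fix l assume l: "l \<in> {1..n-1}"
    show "summand_coord (fiber_card n t l) (choice ?\<tau> l) (x l (choice ?\<tau> l)) = \<one>"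
      using coord_j[OF choice[OF swap_Sur]] coord_other[OF choice[OF swap_Sur] l] choice_other[OF l, of ?\<tau>]
      by (cases "l = j") simp_all
  qed
  have P\<iota>: "P (choice ?\<iota>) = \<ominus> q"
  proof -
    have "P (choice ?\<iota>) = (\<Otimes>l\<in>{1..n-1}. if l = j then \<ominus> q else \<one>)"
      unfolding P_def
    proof (rule finprod_cong')
      fix l assume l: "l \<in> {1..n-1}"
      show "summand_coord (fiber_card n t l) (choice ?\<iota> l) (x l (choice ?\<iota> l)) = (if l = j then \<ominus> q else \<one>)"
        using coord_j[OF choice[OF id_Sur]] coord_other[OF choice[OF id_Sur] l] choice_other[OF l, of ?\<iota>]
          choice_j swap_neq_id
        by (cases "l = j") simp_all
    qed (use q in auto)
    also have "\<dots> = \<ominus> q"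
      by (rule finprod_singleton_swap[OF jk]) (use q in auto)
    finally show ?thesis .
  qed
  \<comment> \<open>Any other choice meets a zero coordinate: either at a place other than j where
    it is not the corolla or, if it agrees with both choices there, at j itself.\<close>
  have P0: "P c = \<zero>" if c: "c \<in> ?C" "c \<noteq> choice ?\<tau>" "c \<noteq> choice ?\<iota>" for c
  proof -
    have "\<exists>l\<in>{1..n-1}. summand_coord (fiber_card n t l) (c l) (x l (c l)) = \<zero>"
    proof (cases "\<exists>l\<in>{1..n-1}. l \<noteq> j \<and> c l \<noteq> (1, corolla 1)")
      case True
      then show ?thesis using coord_other[OF c(1)] by (metis (lifting))
    next
      case False
      then have other: "c l = choice p l" if "l \<in> {1..n-1}" "l \<noteq> j" for p l
        using choice_other[OF that] that by metis
      have "c j \<noteq> choice p j" if p: "p \<in> Sur 2 2" "c \<noteq> choice p" for p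
      proof
        assume "c j = choice p j"
        then have "c = choice p"
          using other by (intro PiE_ext[OF c(1) choice[OF p(1)]]) metis
        with p(2) show False ..
      qed
      then show ?thesis using coord_j[OF c(1)] swap_Sur id_Sur c(2,3) jk by auto
    qed
    then obtain l where l: "l \<in> {1..n-1}" "summand_coord (fiber_card n t l) (c l) (x l (c l)) = \<zero>" by blast
    then show ?thesis
      unfolding P_def using coord_closed[OF n t x c(1)]
      by (intro finprod_zero[where f = "\<lambda>l. summand_coord (fiber_card n t l) (c l) (x l (c l))", OF _ l]) auto
  qed
  have index: "subst_index n (n - 1) t (choice p) = (n, surj_subst n t (block_sizes j) (block_perms j p))" for p
  proof -
    have "(\<Sum>l=1..n-1. fst (choice p l)) = (\<Sum>l=1..n-1. block_sizes j l)"
      by (rule sum.cong) (simp_all add: choice_def)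
    moreover have "surj_subst n t (\<lambda>l. fst (choice p l)) (\<lambda>l. snd (choice p l)) =
        surj_subst n t (block_sizes j) (block_perms j p)"
      by (rule surj_subst_cong[OF t]) (simp_all add: choice_def)
    ultimately show ?thesis using merge_sizes[OF s j ab] by simp
  qed
  define f where "f c = P c \<odot>\<^bsub>binary_comp n\<^esub> basis_elem n (subst_index n (n - 1) t c)" for c
  have fcl: "f c \<in> carrier (binary_comp n)" if "c \<in> ?C" for c
    unfolding f_def by (rule D.smult_closed[OF Pc[OF that] basis_elem_closed])
  have "choice ?\<tau> j \<noteq> choice ?\<iota> j"
    using swap_neq_id by (simp add: choice_j)
  then have neq: "choice ?\<tau> \<noteq> choice ?\<iota>" by auto
  have "free_gam R (binary_gens R) n (n - 1) t x = (\<Oplus>\<^bsub>binary_comp n\<^esub>c\<in>?C. f c)"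
    unfolding f_def P_def by (rule free_gam_expand[OF n t x])
  also have "\<dots> = (\<Oplus>\<^bsub>binary_comp n\<^esub>c\<in>{choice ?\<tau>, choice ?\<iota>}. f c)"
  proof (rule D.add.finprod_mono_neutral_cong_right)
    show "finite ?C" by (rule finite_PiE) (auto intro: finite_surj_index)
    show "f c = \<zero>\<^bsub>binary_comp n\<^esub>" if "c \<in> ?C - {choice ?\<tau>, choice ?\<iota>}" for c
      using that P0[of c] by (simp add: f_def basis_elem_closed)
    show "{choice ?\<tau>, choice ?\<iota>} \<subseteq> ?C" using choice[OF swap_Sur] choice[OF id_Sur] by blast
    show "f \<in> ?C \<rightarrow> carrier (binary_comp n)" using fcl by blast
  qed simp
  also have "\<dots> = f (choice ?\<tau>) \<oplus>\<^bsub>binary_comp n\<^esub> f (choice ?\<iota>)"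
    using neq fcl[OF choice[OF swap_Sur]] fcl[OF choice[OF id_Sur]] by simp
  also have "f (choice ?\<tau>) = basis_elem n (n, s)"
    unfolding f_def P\<tau> index
    unfolding t_def merge_subst_transpose[OF s j ab] by (rule D.smult_one[OF basis_elem_closed])
  also have "f (choice ?\<iota>) = \<ominus>\<^bsub>binary_comp n\<^esub> (q \<odot>\<^bsub>binary_comp n\<^esub>
      basis_elem n (n, \<lambda>x\<in>{1..n}. transpose j (Suc j) (s x)))"
    unfolding f_def P\<iota> index
    unfolding t_def merge_subst_id[OF s j ab] by (rule D.smult_l_minus[OF q basis_elem_closed])
  finally show "free_gam R (binary_gens R) n (n - 1) t x =
      basis_elem n (n, s) \<ominus>\<^bsub>binary_comp n\<^esub>
        q \<odot>\<^bsub>binary_comp n\<^esub> basis_elem n (n, \<lambda>x\<in>{1..n}. transpose j (Suc j) (s x))"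
    by (simp only: a_minus_def)
qed

section \<open>Lower bound for an arbitrary ideal containing the relation\<close>

context
  fixes q and J
  assumes q: "q \<in> carrier R" and J: "permutad_ideal R (free_permutad R (binary_gens R)) J"
    and rel: "swap_relation q \<in> J 3"
begin

private lemma J_submodule: "1 \<le> n \<Longrightarrow> submodule (J (n + 1)) R (binary_comp n)"
  using J unfolding permutad_ideal_def free_permutad_simps by (metis free_comp_Suc(2) le_add2)

private lemma J_gam:
  "1 \<le> n \<Longrightarrow> t \<in> Sur n k \<Longrightarrow> x \<in> binary_dom n k t \<Longrightarrow> j \<in> {1..k} \<Longrightarrow>
   x j \<in> J (fiber_card n t j + 1) \<Longrightarrow> free_gam R (binary_gens R) n k t x \<in> J (n + 1)"
  using J unfolding permutad_ideal_def free_permutad_simps by blast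

private lemma J_zero: "1 \<le> n \<Longrightarrow> \<zero>\<^bsub>binary_comp n\<^esub> \<in> J (n + 1)"
  using subgroup.one_closed[OF submodule.axioms(1)[OF J_submodule]] by simp

text \<open>\<open>J\<close> absorbs the composition in \<open>free_gam_merge\<close>, which makes
  \<open>(n, s)\<close> congruent to q times the index with one inversion fewer. The generated ideal
  is the intersection of all such \<open>J\<close>, so it is enough to argue in each of
  them.\<close>

lemma basis_reduce:
  assumes n: "1 \<le> n" and s: "s \<in> Sur n n"
  shows "basis_elem n (n, s) \<ominus>\<^bsub>binary_comp n\<^esub> (q [^] card (inversions n s)) \<odot>\<^bsub>binary_comp n\<^esub>
     basis_elem n (n, as_surj n id) \<in> J (n + 1)"
  using s
proof (induction "card (inversions n s)" arbitrary: s rule: less_induct)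
  case less
  interpret D: module R "binary_comp n" by (rule binary_comp_module)
  show ?case
  proof (cases "s = as_surj n id")
    case True
    show ?thesis
      unfolding True inversions_as_surj inversions_id
      using J_zero[OF n] basis_elem_closed[of n] by (simp add: a_minus_def D.M.r_neg)
  next
    case False
    obtain j a b where j: "j \<in> {1..<n}"
      and ab: "a \<in> {1..n}" "b \<in> {1..n}" "a < b" "s a = Suc j" "s b = j"
      by (rule descent_exists[OF less.prems False])
    let ?s = "\<lambda>x\<in>{1..n}. transpose j (Suc j) (s x)"
    have jk: "j \<in> {1..n-1}" using j by auto
    have s': "?s \<in> Sur n n"
    proof -
      have p: "transpose j (Suc j) permutes {1..n}" by (rule permutes_swap_id) (use j in auto)
      have "?s ` {1..n} = transpose j (Suc j) ` s ` {1..n}" by (simp add: image_image)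
      also have "\<dots> = {1..n}" unfolding SurD(2)[OF less.prems] by (rule permutes_image[OF p])
      finally have "?s ` {1..n} = {1..n}" .
      then show ?thesis unfolding Sur_def mem_Collect_eq by (intro conjI PiE_I) auto
    qed
    have inv: "card (inversions n s) = Suc (card (inversions n ?s))"
      by (rule descent_inversions[OF less.prems j ab])
    have fcj: "fiber_card n (merge_levels n j s) j = 2"
      using merge_fiber_card[OF less.prems j ab jk] by (simp add: block_sizes_def)
    have "free_gam R (binary_gens R) n (n - 1) (merge_levels n j s)
        (\<lambda>l\<in>{1..n-1}. if l = j then swap_relation q else free_mu R) \<in> J (n + 1)"
      by (rule J_gam[OF n merge_Sur[OF less.prems j ab] free_gam_merge(1)[OF q less.prems j ab] jk])
        (use rel jk fcj in simp)
    then have "basis_elem n (n, s) \<ominus>\<^bsub>binary_comp n\<^esub> q \<odot>\<^bsub>binary_comp n\<^esub> basis_elem n (n, ?s) \<in> J (n + 1)"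
      unfolding free_gam_merge(2)[OF q less.prems j ab] .
    moreover have "basis_elem n (n, ?s) \<ominus>\<^bsub>binary_comp n\<^esub> (q [^] card (inversions n ?s)) \<odot>\<^bsub>binary_comp n\<^esub>
     basis_elem n (n, as_surj n id) \<in> J (n + 1)"
      by (rule less.hyps[OF _ s']) (simp only: inv lessI)
    ultimately have "basis_elem n (n, s) \<ominus>\<^bsub>binary_comp n\<^esub> (q \<otimes> q [^] card (inversions n ?s)) \<odot>\<^bsub>binary_comp n\<^esub>
     basis_elem n (n, as_surj n id) \<in> J (n + 1)"
      by (rule D.submodule_chain[OF J_submodule[OF n] _ _ q nat_pow_closed[OF q] basis_elem_closed
            basis_elem_closed basis_elem_closed])
    moreover have "q \<otimes> q [^] card (inversions n ?s) = q [^] card (inversions n s)"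
      unfolding inv nat_pow_Suc by (rule m_comm[OF q nat_pow_closed[OF q]])
    ultimately show ?thesis by (simp only:)
  qed
qed

text \<open>The elements x congruent modulo \<open>J\<close> to their value times \<open>?e\<close>
  form a submodule that contains all basis elements, hence everything. For x of value zero the
  congruence says that x lies in \<open>J\<close>.\<close>

lemma kernel_subset_ideal:
  assumes n: "1 \<le> n"
  shows "q_kernel q (n + 1) \<subseteq> J (n + 1)"
proof
  interpret D: module R "binary_comp n" by (rule binary_comp_module)
  let ?e = "basis_elem n (n, as_surj n id)"
  let ?N = "{x \<in> carrier (binary_comp n). x \<ominus>\<^bsub>binary_comp n\<^esub> q_form q n x \<odot>\<^bsub>binary_comp n\<^esub> ?e \<in> J (n + 1)}"
  have N: "submodule ?N R (binary_comp n)"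
    by (rule form_multiples_submodule[OF binary_comp_module J_submodule[OF n] q_form_linear[OF q] basis_elem_closed])
  have basis: "basis_elem n i \<in> ?N" if i: "i \<in> surj_index n" for i
  proof (cases "fst i = n")
    case True
    then obtain s where s: "i = (n, s)" "s \<in> Sur n n"
      using surj_indexD[OF i] by (metis prod.collapse)
    show ?thesis
      unfolding s(1) mem_Collect_eq q_form_basis[OF q s(2)]
      by (intro conjI basis_elem_closed basis_reduce[OF n s(2)])
  next
    case False
    then show ?thesis
      unfolding basis_elem_nonbij[OF i False] using subgroup.one_closed[OF submodule.axioms(1)[OF N]] by simp
  qed
  fix x assume "x \<in> q_kernel q (n + 1)"
  then have x: "x \<in> carrier (binary_comp n)" "q_form q n x = \<zero>"
    by (simp_all add: q_kernel_def form_kernel_def free_comp_Suc)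
  have "x \<in> ?N"
  proof (rule direct_sum_generated[OF binary_summand_module N _ x(1)])
    fix i Y assume i: "i \<in> surj_index n" and Y: "Y \<in> carrier (binary_summand n i)"
    show "sum_inj (surj_index n) (binary_summand n) i Y \<in> ?N"
      unfolding binary_inj_expand[OF i Y]
      by (rule D.submoduleE(4)[OF N linear_formD(1)[OF summand_coord_linear Y] basis[OF i]])
  qed
  then have "x \<ominus>\<^bsub>binary_comp n\<^esub> q_form q n x \<odot>\<^bsub>binary_comp n\<^esub> ?e \<in> J (n + 1)" by blast
  then show "x \<in> J (n + 1)"
    unfolding x(2) D.smult_l_null[OF basis_elem_closed] D.diff_zero[OF x(1)] .
qed

end

section \<open>The ideal of relations and the quotient permutad\<close>

lemma q_ideal_kernel:
  assumes q: "q \<in> carrier R" and n: "1 \<le> n"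
  shows "q_ideal R q (n + 1) = form_kernel R (binary_comp n) (q_form q n)"
proof -
  have "q_ideal R q (n + 1) \<subseteq> q_kernel q (n + 1)"
    by (rule q_ideal_subset_kernel[OF q]) simp
  moreover have "q_kernel q (n + 1) \<subseteq> q_ideal R q (n + 1)"
    unfolding q_ideal_def generated_ideal_def
  proof (rule Inter_greatest)
    fix X assume "X \<in> {J (n + 1) |J. permutad_ideal R (free_permutad R (binary_gens R)) J \<and>
        (\<forall>m\<ge>1. q_relations R q m \<subseteq> J m)}"
    then obtain J where J: "X = J (n + 1)" "permutad_ideal R (free_permutad R (binary_gens R)) J"
      "\<forall>m\<ge>1. q_relations R q m \<subseteq> J m" by blast
    have "q_relations R q 3 \<subseteq> J 3" using J(3) by simp
    then have "swap_relation q \<in> J 3" by (simp add: q_relations_eq)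
    then show "q_kernel q (n + 1) \<subseteq> X"
      unfolding J(1) by (rule kernel_subset_ideal[OF q J(2) _ n])
  qed
  ultimately have "q_ideal R q (n + 1) = q_kernel q (n + 1)" by (rule equalityI)
  also have "\<dots> = form_kernel R (binary_comp n) (q_form q n)"
    by (simp add: q_kernel_def free_comp_Suc)
  finally show ?thesis .
qed

lemma q_permAs_comp:
  assumes "q \<in> carrier R" "1 \<le> n"
  shows "comp (q_permAs R q) (n + 1) =
    quotient_module (binary_comp n) (form_kernel R (binary_comp n) (q_form q n))"
  unfolding q_permAs_def quotient_permutad_def permutad_data.simps free_permutad_simps free_comp_Suc
    q_ideal_kernel[OF assms] ..

lemma q_form_mu:
  assumes q: "q \<in> carrier R"
  shows "q_form q 1 (free_mu R) = \<one>"
proof -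
  have "inversions 1 (corolla 1) = {}" by (auto simp: inversions_def)
  then show ?thesis
    unfolding free_mu_basis q_form_basis[OF q one_Sur] by simp
qed

lemma q_mu_level:
  assumes q: "q \<in> carrier R"
  shows "q_mu R q = level_set (binary_comp 1) (q_form q 1) \<one>"
proof -
  have "q_ideal R q 2 = form_kernel R (binary_comp 1) (q_form q 1)"
    using q_ideal_kernel[OF q order_refl] by (simp only: one_add_one)
  moreover have "free_comp R (binary_gens R) 2 = binary_comp 1" by (simp add: free_comp_def)
  ultimately show ?thesis
    unfolding q_mu_def free_permutad_simps
    by (simp only: q_form_mu[OF q] form_kernel_coset[OF binary_comp_module q_form_linear[OF q] free_mu_closed])
qed

text \<open>Composition in the quotient ranges over all tuples of representatives of \<mu>. Each
  representative has value 1, so by \<open>q_form_gam\<close> every composite has the value q to the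
  number of inversions and all of them give one coset.\<close>

lemma q_permAs_gam_level:
  assumes q: "q \<in> carrier R" and n: "1 \<le> n" and s: "s \<in> Sur n n"
  shows "gam (q_permAs R q) n n s (\<lambda>j\<in>{1..n}. q_mu R q) =
    level_set (binary_comp n) (q_form q n) (q [^] card (inversions n s))"
proof -
  let ?X = "\<Pi>\<^sub>E j\<in>{1..n}. (\<lambda>j\<in>{1..n}. q_mu R q) j"
  have coset: "q_ideal R q (n + 1) +>\<^bsub>free_comp R (binary_gens R) (n + 1)\<^esub> free_gam R (binary_gens R) n n s x =
      level_set (binary_comp n) (q_form q n) (q [^] card (inversions n s))" if x: "x \<in> ?X" for x
  proof -
    have xj: "x j \<in> carrier (binary_comp 1)" "q_form q 1 (x j) = \<one>" if "j \<in> {1..n}" for j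
      using PiE_mem[OF x that] that by (simp_all add: q_mu_level[OF q] level_set_def)
    have dom: "x \<in> binary_dom n n s"
      using x xj(1) Sur_fiber_card[OF s] by (auto simp: PiE_iff free_comp_Suc simp del: atLeastAtMost_iff)
    have "(\<Otimes>j\<in>{1..n}. q_form q (fiber_card n s j) (x j)) = \<one>"
      by (rule finprod_one_eqI) (simp only: Sur_fiber_card[OF s] xj(2))
    then have "q_form q n (free_gam R (binary_gens R) n n s x) = q [^] card (inversions n s)"
      unfolding q_form_gam[OF n s dom q] using q by simp
    then show ?thesis
      unfolding q_ideal_kernel[OF q n] free_comp_Suc
      by (simp only: form_kernel_coset[OF binary_comp_module q_form_linear[OF q] free_gam_closed[OF n s dom]])
  qed
  \<comment> \<open>A constant union still needs a nonempty index set; the generator itself supplies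
    a tuple of representatives.\<close>
  have "free_mu R \<in> q_mu R q"
    unfolding q_mu_level[OF q] level_set_def using free_mu_closed q_form_mu[OF q] by blast
  then have "(\<lambda>j\<in>{1..n}. free_mu R) \<in> ?X" by auto
  then have "?X \<noteq> {}" by blast
  have "gam (q_permAs R q) n n s (\<lambda>j\<in>{1..n}. q_mu R q) =
      (\<Union>x\<in>?X. level_set (binary_comp n) (q_form q n) (q [^] card (inversions n s)))"
    unfolding q_permAs_def quotient_permutad_def permutad_data.simps free_permutad_simps
    by (rule SUP_cong[OF refl coset])
  also have "\<dots> = level_set (binary_comp n) (q_form q n) (q [^] card (inversions n s))"
    using \<open>?X \<noteq> {}\<close> by (rule UN_constant[THEN trans, OF if_not_P])
  finally show ?thesis .
qed

end

theorem proposition4p6: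
  fixes K :: "('k, 'z) ring_scheme" and q :: 'k and n :: nat
  assumes "cring K" and "q \<in> carrier K" and "1 \<le> n"
  shows "module_basis K (comp (q_permAs K q) (n + 1))
           {gam (q_permAs K q) n n (as_surj n id) (\<lambda>j\<in>{1..n}. q_mu K q)} \<and>
         (\<forall>\<sigma>. \<sigma> permutes {1..n} \<longrightarrow>
           gam (q_permAs K q) n n (as_surj n \<sigma>) (\<lambda>j\<in>{1..n}. q_mu K q) =
           (q [^]\<^bsub>K\<^esub> coxeter_length n \<sigma>) \<odot>\<^bsub>comp (q_permAs K q) (n + 1)\<^esub>
             gam (q_permAs K q) n n (as_surj n id) (\<lambda>j\<in>{1..n}. q_mu K q))"
proof -
  interpret cring K by (rule assms)
  note q = assms(2) and n = assms(3)
  let ?\<phi> = "q_form q n" and ?e = "basis_elem n (n, as_surj n id)"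
  have e: "?e \<in> carrier (binary_comp n)" "?\<phi> ?e = \<one>\<^bsub>K\<^esub>"
    using q by (simp_all add: basis_elem_closed q_form_basis[OF q id_Sur] inversions_as_surj inversions_id)
  have gen: "gam (q_permAs K q) n n (as_surj n id) (\<lambda>j\<in>{1..n}. q_mu K q) =
      level_set (binary_comp n) ?\<phi> \<one>\<^bsub>K\<^esub>"
    unfolding q_permAs_gam_level[OF q n id_Sur] inversions_as_surj inversions_id by simp
  show ?thesis
    unfolding gen q_permAs_comp[OF q n]
  proof (intro conjI allI impI)
    show "module_basis K (quotient_module (binary_comp n) (form_kernel K (binary_comp n) ?\<phi>))
        {level_set (binary_comp n) ?\<phi> \<one>\<^bsub>K\<^esub>}"
      by (rule quotient_kernel_basis[where \<phi> = ?\<phi> and e = ?e, OF binary_comp_module q_form_linear[OF q] e])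
  next
    fix \<sigma> assume \<sigma>: "\<sigma> permutes {1..n}"
    have one: "\<one>\<^bsub>K\<^esub> \<in> ?\<phi> ` carrier (binary_comp n)" using e by (metis imageI)
    have "gam (q_permAs K q) n n (as_surj n \<sigma>) (\<lambda>j\<in>{1..n}. q_mu K q) =
        level_set (binary_comp n) ?\<phi> (q [^]\<^bsub>K\<^esub> coxeter_length n \<sigma>)"
      unfolding q_permAs_gam_level[OF q n as_surj_Sur[OF \<sigma>]] inversions_as_surj
        coxeter_length_inversions[OF \<sigma>] ..
    then show "gam (q_permAs K q) n n (as_surj n \<sigma>) (\<lambda>j\<in>{1..n}. q_mu K q) =
        (q [^]\<^bsub>K\<^esub> coxeter_length n \<sigma>) \<odot>\<^bsub>quotient_module (binary_comp n) (form_kernel K (binary_comp n) ?\<phi>)\<^esub>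
          level_set (binary_comp n) ?\<phi> \<one>\<^bsub>K\<^esub>"
      unfolding quotient_kernel_smult[OF binary_comp_module q_form_linear[OF q] nat_pow_closed[OF q] one]
      using q by simp
  qed
qed

end
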